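(* Let $\mathcal H$ be a separable Hilbert space over $\mathbb F$, where $\mathbb F$ is either $\mathbb R$ or $\mathbb C$, with $\dim\mathcal H>1$. If an isometry $T$ on $\mathcal H$ is weakly l-sequentially supercyclic, then $T$ is a weakly quasistable singular-continuous unitary operator.
   Context: An isometry on $\mathcal H$ is a linear map $T:\mathcal H\to\mathcal H$ with $\|Tx\|=\|x\|$ for all $x\in\mathcal H$; a unitary operator on $\mathcal H$ is a surjective isometry. $T$ is weakly quasistable if $\liminf_n|f(T^nx)|=0$ for every $x\in\mathcal H$ and every $f$ in the dual $\mathcal H^*$ of $\mathcal H$. The projective orbit of a nonzero vector $y\in\mathcal H$ under $T$ is $\mathcal O_T([y])=\{\alpha T^ny:\alpha\in\mathbb F,\ n\ge0 \text{ an integer}\}$. The weak limit set $A^{-wl}$ of a set $A\subseteq\mathcal H$ is the set of all weak limits of weakly convergent $A$-valued sequences. A nonzero $y\in\mathcal H$ is a weakly l-sequentially supercyclic vector for $T$ if $\mathcal O_T([y])^{-wl}=\mathcal H$, and $T$ is weakly l-sequentially supercyclic if it has such a vector. A unitary operator (acting on a Hilbert space) is singular-continuous if its scalar spectral measure (a finite positive Borel measure on the unit circle having the same null sets as the spectral measure of the operator) is singular-continuous with respect to normalized Lebesgue measure on the $\sigma$-algebra of Borel subsets of the unit circle, i.e., it is singular with respect to Lebesgue measure and has no atoms.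
   Formalization: For F = R with dim H = 2 singular-continuity is not claimed, since it fails there (irrational rotation of the plane: its complexification has eigenvalues); weak quasistability and unitarity are still claimed. For F = R the spectral measure is that of the complexification. *)

theory Defs
  imports "HOL-Analysis.Analysis"
begin

text \<open>
  The scalar field \<open>'f\<close> (\<open>real\<close> or \<open>complex\<close>) acts by \<open>sc\<close>, while addition, norm and topology come from
  the type class. For a real space \<open>sc\<close> is \<open>(*\<^sub>R)\<close>; for a complex one the locale
  \<open>complex_hilbert_space\<close> below makes it compatible with the class structure.
\<close>

subsection \<open>Isometries, weak convergence, supercyclicity\<close>

text \<open>The library's \<open>dim\<close> is \<open>0\<close> on infinite-dimensional spaces, hence the explicit basis.\<close>

definition dim_gt_one :: "('f::field \<Rightarrow> 'h::ab_group_add \<Rightarrow> 'h) \<Rightarrow> bool" where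
  "dim_gt_one sc \<longleftrightarrow>
     (\<exists>B. \<not> module.dependent sc B \<and> module.span sc B = UNIV \<and> (infinite B \<or> card B > 1))"

definition isometry :: "('f::field \<Rightarrow> 'h::real_normed_vector \<Rightarrow> 'h) \<Rightarrow> ('h \<Rightarrow> 'h) \<Rightarrow> bool" where
  "isometry sc T \<longleftrightarrow> Vector_Spaces.linear sc sc T \<and> (\<forall>x. norm (T x) = norm x)"

definition unitary :: "('f::field \<Rightarrow> 'h::real_normed_vector \<Rightarrow> 'h) \<Rightarrow> ('h \<Rightarrow> 'h) \<Rightarrow> bool" where
  "unitary sc T \<longleftrightarrow> isometry sc T \<and> surj T"

definition dual :: "('f::real_normed_field \<Rightarrow> 'h::real_normed_vector \<Rightarrow> 'h) \<Rightarrow> ('h \<Rightarrow> 'f) set" where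
  "dual sc = {f. Vector_Spaces.linear sc (*) f \<and> (\<exists>K. \<forall>x. norm (f x) \<le> K * norm x)}"

definition weakly_converges ::
  "('f::real_normed_field \<Rightarrow> 'h::real_normed_vector \<Rightarrow> 'h) \<Rightarrow> (nat \<Rightarrow> 'h) \<Rightarrow> 'h \<Rightarrow> bool" where
  "weakly_converges sc X l \<longleftrightarrow> (\<forall>f\<in>dual sc. (\<lambda>n. f (X n)) \<longlonglongrightarrow> f l)"

definition weakly_quasistable ::
  "('f::real_normed_field \<Rightarrow> 'h::real_normed_vector \<Rightarrow> 'h) \<Rightarrow> ('h \<Rightarrow> 'h) \<Rightarrow> bool" where
  "weakly_quasistable sc T \<longleftrightarrow>
     (\<forall>x. \<forall>f\<in>dual sc. liminf (\<lambda>n. ereal (norm (f ((T ^^ n) x)))) = 0)"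

definition projective_orbit ::
  "('f \<Rightarrow> 'h \<Rightarrow> 'h) \<Rightarrow> ('h \<Rightarrow> 'h) \<Rightarrow> 'h \<Rightarrow> 'h set" where
  "projective_orbit sc T y = {sc \<alpha> ((T ^^ n) y) | \<alpha> n. True}"

definition weak_limit_set ::
  "('f::real_normed_field \<Rightarrow> 'h::real_normed_vector \<Rightarrow> 'h) \<Rightarrow> 'h set \<Rightarrow> 'h set" where
  "weak_limit_set sc A = {l. \<exists>X. (\<forall>n. X n \<in> A) \<and> weakly_converges sc X l}"

definition weakly_l_sequentially_supercyclic ::
  "('f::real_normed_field \<Rightarrow> 'h::real_normed_vector \<Rightarrow> 'h) \<Rightarrow> ('h \<Rightarrow> 'h) \<Rightarrow> bool" where
  "weakly_l_sequentially_supercyclic sc T \<longleftrightarrow>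
     (\<exists>y. y \<noteq> 0 \<and> weak_limit_set sc (projective_orbit sc T y) = UNIV)"

subsection \<open>Measures on the unit circle\<close>

definition circle_borel :: "complex measure" where
  "circle_borel = restrict_space borel (sphere 0 1)"

text \<open>Normalized Lebesgue measure, transported from \<open>[0, 1]\<close>.\<close>

definition circle_lebesgue :: "complex measure" where
  "circle_lebesgue = distr (restrict_space lborel {0..1}) circle_borel (\<lambda>t. cis (2 * pi * t))"

definition mutually_singular :: "'a measure \<Rightarrow> 'a measure \<Rightarrow> bool" where
  "mutually_singular \<mu> \<nu> \<longleftrightarrow>
     (\<exists>N\<in>sets \<mu>. emeasure \<mu> (space \<mu> - N) = 0 \<and> emeasure \<nu> N = 0)"

definition singular_continuous_measure :: "complex measure \<Rightarrow> bool" where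
  "singular_continuous_measure \<mu> \<longleftrightarrow>
     mutually_singular \<mu> circle_lebesgue \<and> (\<forall>z\<in>sphere 0 1. emeasure \<mu> {z} = 0)"

subsection \<open>Complex Hilbert spaces and spectral measures\<close>

text \<open>
  Inner products are linear in the first argument. Completeness is part of the type class \<open>banach\<close>.
\<close>

locale complex_hilbert_space = vector_space scaleC
  for scaleC :: "complex \<Rightarrow> 'h::banach \<Rightarrow> 'h" (infixr \<open>*\<^sub>C\<close> 75) +
  fixes cinner :: "'h \<Rightarrow> 'h \<Rightarrow> complex"
  assumes scaleC_of_real: "complex_of_real r *\<^sub>C x = r *\<^sub>R x"
    and cinner_commute: "cinner x y = cnj (cinner y x)"
    and cinner_add_left: "cinner (x + y) z = cinner x z + cinner y z"
    and cinner_scaleC_left: "cinner (c *\<^sub>C x) y = c * cinner x y"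
    and cinner_self: "cinner x x = complex_of_real ((norm x)\<^sup>2)"
begin

definition orthogonal_projection :: "('h \<Rightarrow> 'h) \<Rightarrow> bool" where
  "orthogonal_projection P \<longleftrightarrow>
     Vector_Spaces.linear scaleC scaleC P \<and> (\<forall>x. P (P x) = P x) \<and>
     (\<forall>x y. cinner (P x) y = cinner x (P y))"

text \<open>Projection-valued measures on the Borel sets of the circle (strongly countably additive).\<close>

definition spectral_measure :: "(complex set \<Rightarrow> 'h \<Rightarrow> 'h) \<Rightarrow> bool" where
  "spectral_measure E \<longleftrightarrow>
     (\<forall>A\<in>sets circle_borel. orthogonal_projection (E A)) \<and>
     E (sphere 0 1) = id \<and>
     (\<forall>A\<in>sets circle_borel. \<forall>B\<in>sets circle_borel. E (A \<inter> B) = E A \<circ> E B) \<and>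
     (\<forall>A x. range A \<subseteq> sets circle_borel \<longrightarrow> disjoint_family A \<longrightarrow>
        (\<lambda>n. E (A n) x) sums E (\<Union>n. A n) x)"

text \<open>The positive measure \<open>A \<mapsto> \<langle>E(A)x, x\<rangle>\<close>.\<close>

definition spectral_distribution :: "(complex set \<Rightarrow> 'h \<Rightarrow> 'h) \<Rightarrow> 'h \<Rightarrow> complex measure" where
  "spectral_distribution E x =
     measure_of (space circle_borel) (sets circle_borel) (\<lambda>A. ennreal (Re (cinner (E A x) x)))"

text \<open>
  \<open>T = \<integral> z dE(z)\<close>: the spectral integral is the operator with
  \<open>\<langle>(\<integral> z dE(z)) x, x\<rangle> = \<integral> z d\<langle>E(z)x, x\<rangle>\<close>; by polarization this fixes all \<open>\<langle>(\<integral> z dE(z)) x, y\<rangle>\<close>.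
\<close>

definition spectral_measure_of :: "(complex set \<Rightarrow> 'h \<Rightarrow> 'h) \<Rightarrow> ('h \<Rightarrow> 'h) \<Rightarrow> bool" where
  "spectral_measure_of E T \<longleftrightarrow> spectral_measure E \<and>
     (\<forall>x. cinner (T x) x = (\<integral>z. z \<partial>spectral_distribution E x))"

definition scalar_spectral_measure :: "(complex set \<Rightarrow> 'h \<Rightarrow> 'h) \<Rightarrow> complex measure \<Rightarrow> bool" where
  "scalar_spectral_measure E \<mu> \<longleftrightarrow>
     sets \<mu> = sets circle_borel \<and> finite_measure \<mu> \<and>
     (\<forall>A\<in>sets circle_borel. emeasure \<mu> A = 0 \<longleftrightarrow> E A = (\<lambda>x. 0))"

text \<open>
  The spectral measure of a unitary operator is unique and its scalar spectral measures have the same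
  null sets, so this does not depend on the choice of \<open>E\<close> and \<open>\<mu>\<close>.
\<close>

definition singular_continuous :: "('h \<Rightarrow> 'h) \<Rightarrow> bool" where
  "singular_continuous T \<longleftrightarrow>
     (\<exists>E \<mu>. spectral_measure_of E T \<and> scalar_spectral_measure E \<mu> \<and> singular_continuous_measure \<mu>)"

end

subsection \<open>Real Hilbert spaces\<close>

text \<open>
  The spectral measure of a unitary operator on a real Hilbert space is that of its complexification.
  The pair \<open>(x, y)\<close> stands for \<open>x + \<i> y\<close>, and the product norm is the norm of the complexification.

  Pitfall: a rotation of the real plane by an irrational angle is a supercyclic isometry without real
  eigenvalues, but its complexification has two eigenvalues, so it is not singular-continuous.
\<close>

definition complexify_scale :: "complex \<Rightarrow> 'a::real_vector \<times> 'a \<Rightarrow> 'a \<times> 'a" where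
  "complexify_scale c = (\<lambda>(x, y). (Re c *\<^sub>R x - Im c *\<^sub>R y, Re c *\<^sub>R y + Im c *\<^sub>R x))"

definition complexify_inner :: "'a::real_inner \<times> 'a \<Rightarrow> 'a \<times> 'a \<Rightarrow> complex" where
  "complexify_inner = (\<lambda>(x, y) (u, v). Complex (inner x u + inner y v) (inner y u - inner x v))"

lemma complex_hilbert_space_complexify:
  "complex_hilbert_space complexify_scale
     (complexify_inner :: 'a::{real_inner,banach} \<times> 'a \<Rightarrow> 'a \<times> 'a \<Rightarrow> complex)"
  by unfold_locales
    (auto simp: complexify_scale_def complexify_inner_def complex_eq_iff algebra_simps
       inner_commute norm_prod_def power2_norm_eq_inner)

definition singular_continuous_real :: "('a::{real_inner,banach} \<Rightarrow> 'a) \<Rightarrow> bool" where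
  "singular_continuous_real T \<longleftrightarrow>
     complex_hilbert_space.singular_continuous complexify_scale complexify_inner (map_prod T T)"

end

theory Submission
  imports Defs "HOL-Probability.Probability"
begin

text \<open>
  Let \<open>y\<close> be supercyclic for the isometry \<open>T\<close>. If some \<open>e \<noteq> 0\<close> were orthogonal to the range of \<open>T\<close>, all
  weak limits not orthogonal to \<open>e\<close> would lie on the line through \<open>y\<close>; so \<open>T\<close> is unitary. The scalars in a
  weakly convergent sequence from the projective orbit are bounded. Compressing the orbit to the reducing
  subspace \<open>M\<close> of all \<open>x\<close> whose orbit tends to \<open>0\<close> weakly therefore shows that countably many lines cover
  \<open>M\<close>, and \<open>M = 0\<close>. Compressing it to an eigenspace shows that the scalars tend to \<open>0\<close> whenever the limit is
  orthogonal to the eigenspace, so there are no eigenvectors.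

  Since \<open>y\<close> is cyclic, the spectral measure of \<open>T\<close> has the null sets of the distribution \<open>\<mu>\<close> of \<open>y\<close>. An
  atom of \<open>\<mu>\<close> gives an eigenvector; if \<open>\<mu>\<close> is not singular, it is dominated by a multiple of Lebesgue
  measure on some non-null set \<open>Y\<close>, and Bessel's inequality puts \<open>E(Y) y\<close> into \<open>M\<close>. So \<open>\<mu>\<close> is singular and
  has no atoms, and Wiener's lemma yields weak quasistability.

  In the real case the complexification has no eigenvectors unless the space is a plane, where
  quasistability follows from recurrence of the orbit.
\<close>

subsection \<open>Hilbert spaces over the real or complex numbers\<close>

text \<open>The complexification of a real supercyclic isometry need not be supercyclic: for an
  irrational rotation of the plane it has eigenvectors, which supercyclicity forbids over the
  complex numbers. The spectral half therefore never mentions dense orbits.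
  \<open>singular_continuousI\<close> asks for a cyclic vector, the absence of atoms and the absence
  of nonzero weakly null vectors. Cyclicity and the last property pass from a real space to its
  complexification, while an atom there produces a real invariant plane. The half about orbits runs
  once for both fields.

  Two choices shape the rest. The functional calculus grows from polynomials to Borel functions
  through the isometry that equates the squared norm of f(T)x with the integral of |f|^2 against the
  distribution of x: bounded pointwise convergence of functions makes the vectors Cauchy.
  Quasistability is first proved in the stronger form that the Cesaro means of |<T^n x, z>|^2 tend
  to 0. Vectors with this property form a closed subspace, whereas a zero lower limit for two
  vectors need not be attained along a common subsequence.\<close>

text \<open>The conjugation \<open>cj\<close> is the identity in the real case and \<open>cnj\<close> in the complex case.\<close>

locale scalar_hilbert_space = vector_space sc
  for sc :: "'f::{real_normed_field,heine_borel} \<Rightarrow> 'h::banach \<Rightarrow> 'h" +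
  fixes ip :: "'h \<Rightarrow> 'h \<Rightarrow> 'f" and cj :: "'f \<Rightarrow> 'f"
  assumes sc_of_real: "sc (of_real r) x = r *\<^sub>R x"
    and ip_commute: "ip x y = cj (ip y x)"
    and ip_add_left: "ip (x + y) z = ip x z + ip y z"
    and ip_sc_left: "ip (sc c x) y = c * ip x y"
    and ip_self: "ip x x = of_real ((norm x)\<^sup>2)"
    and cj_add: "cj (a + b) = cj a + cj b"
    and cj_mult: "cj (a * b) = cj a * cj b"
    and cj_self: "a * cj a = of_real ((norm a)\<^sup>2)"
begin

lemma ip_add_right: "ip x (y + z) = ip x y + ip x z"
  by (metis ip_commute ip_add_left cj_add)

lemma ip_sc_right: "ip x (sc c y) = cj c * ip x y"
  by (metis ip_commute ip_sc_left cj_mult)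

lemma cj_zero: "cj 0 = 0"
  using cj_add[of 0 0] by simp

lemma ip_zero_left [simp]: "ip 0 y = 0"
  using ip_add_left[of 0 0 y] by simp

lemma ip_zero_right [simp]: "ip y 0 = 0"
  using ip_add_right[of y 0 0] by simp

lemma ip_diff_left: "ip (x - y) z = ip x z - ip y z"
  using ip_add_left[of "x - y" y z] by (simp add: algebra_simps)

lemma ip_diff_right: "ip z (x - y) = ip z x - ip z y"
  using ip_add_right[of z "x - y" y] by (simp add: algebra_simps)

lemma norm_cj: "norm (cj a) = norm a"
proof (cases "a = 0")
  case False
  have "norm (a * cj a) = (norm a)\<^sup>2"
    unfolding cj_self by (simp add: norm_power)
  then show ?thesis
    using False by (simp add: norm_mult power2_eq_square)
qed (simp add: cj_zero)

lemma cj_of_real: "cj (of_real r) = of_real r"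
proof (cases "r = 0")
  case False
  have "of_real r * cj (of_real r) = (of_real r * of_real r :: 'f)"
    unfolding cj_self by (simp add: power2_eq_square)
  then show ?thesis
    using False by simp
qed (simp add: cj_zero)

lemma norm_sc: "norm (sc a x) = norm a * norm x"
proof -
  have "of_real ((norm (sc a x))\<^sup>2) = (a * cj a) * ip x x"
    unfolding ip_self[symmetric] by (simp add: ip_sc_left ip_sc_right)
  also have "\<dots> = of_real ((norm a * norm x)\<^sup>2)"
    unfolding cj_self ip_self by (simp add: power_mult_distrib)
  finally have "(norm (sc a x))\<^sup>2 = (norm a * norm x)\<^sup>2"
    by (simp only: of_real_eq_iff)
  then show ?thesis
    by (simp add: power2_eq_iff_nonneg)
qed

text \<open>Pythagoras for the component of \<open>x\<close> along \<open>y\<close>; for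
  \<open>y = 0\<close> division by zero returns 0 and the identity survives. It gives the
  Cauchy-Schwarz inequality and, in the projection theorem, the gain from moving a candidate along a
  direction.\<close>

lemma norm_diff_component:
  "(norm (x - sc (ip x y / of_real ((norm y)\<^sup>2)) y))\<^sup>2 = (norm x)\<^sup>2 - (norm (ip x y))\<^sup>2 / (norm y)\<^sup>2"
proof (cases "y = 0")
  case False
  define c where "c = ip x y / of_real ((norm y)\<^sup>2)"
  have n: "of_real ((norm y)\<^sup>2) \<noteq> (0 :: 'f)"
    using False by simp
  have c: "c * ip y y = ip x y"
    unfolding c_def ip_self using n by simp
  have "cj c * ip y y = ip y x"
    by (metis c cj_mult ip_commute)
  then have "ip (x - sc c y) (x - sc c y) = ip x x - c * ip y x"
    by (simp add: ip_diff_left ip_diff_right ip_sc_left ip_sc_right c algebra_simps)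
  also have "c * ip y x = (ip x y * cj (ip x y)) / of_real ((norm y)\<^sup>2)"
    unfolding c_def using ip_commute[of y x] by simp
  finally have "of_real ((norm (x - sc c y))\<^sup>2) =
      (of_real ((norm x)\<^sup>2 - (norm (ip x y))\<^sup>2 / (norm y)\<^sup>2) :: 'f)"
    unfolding cj_self ip_self by simp
  then show ?thesis
    unfolding c_def of_real_eq_iff .
qed simp

lemma norm_ip_le: "norm (ip x y) \<le> norm x * norm y"
proof (cases "y = 0")
  case False
  have "(norm (ip x y))\<^sup>2 / (norm y)\<^sup>2 \<le> (norm x)\<^sup>2"
    using norm_diff_component[of x y] by (smt (verit) zero_le_power2)
  then have "(norm (ip x y))\<^sup>2 \<le> (norm x * norm y)\<^sup>2"
    using False by (simp add: field_simps power_mult_distrib)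
  then show ?thesis
    by (rule power2_le_imp_le) simp
qed simp

lemma bounded_bilinear_ip: "bounded_bilinear ip"
proof
  show "ip (r *\<^sub>R a) b = r *\<^sub>R ip a b" for r a b
    using ip_sc_left[of "of_real r" a b] by (simp add: sc_of_real scaleR_conv_of_real)
  show "ip a (r *\<^sub>R b) = r *\<^sub>R ip a b" for r a b
    using ip_sc_right[of a "of_real r" b] by (simp add: sc_of_real scaleR_conv_of_real cj_of_real)
  show "\<exists>K. \<forall>a b. norm (ip a b) \<le> norm a * norm b * K"
    using norm_ip_le by (intro exI[of _ 1]) simp
qed (simp_all add: ip_add_left ip_add_right)

lemma bounded_linear_sc_left: "bounded_linear (\<lambda>a. sc a u)"
proof
  show "sc (r *\<^sub>R a) u = r *\<^sub>R sc a u" for r a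
    unfolding scaleR_conv_of_real sc_of_real[symmetric] scale_scale ..
  show "\<exists>K. \<forall>a. norm (sc a u) \<le> norm a * K"
    by (intro exI[of _ "norm u"]) (simp add: norm_sc)
qed (rule scale_left_distrib)

lemma bounded_linear_sc_right: "bounded_linear (sc c)"
proof
  show "sc c (r *\<^sub>R x) = r *\<^sub>R sc c x" for r x
    unfolding sc_of_real[symmetric] by (rule scale_left_commute)
  show "\<exists>K. \<forall>x. norm (sc c x) \<le> norm x * K"
    by (intro exI[of _ "norm c"]) (simp add: norm_sc)
qed (rule scale_right_distrib)

lemmas tendsto_sc_right = bounded_linear.tendsto[OF bounded_linear_sc_right]
lemmas tendsto_sc_left = bounded_linear.tendsto[OF bounded_linear_sc_left]
lemmas tendsto_ip = bounded_bilinear.tendsto[OF bounded_bilinear_ip]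
lemmas continuous_on_ip = bounded_bilinear.continuous_on[OF bounded_bilinear_ip]

lemma ip_eq_zero_iff: "ip x x = 0 \<longleftrightarrow> x = 0"
  by (simp add: ip_self)

text \<open>A zero vector among \<open>u\<close>, \<open>v\<close> is harmless, its coefficient
  being \<open>0 / 0 = 0\<close>. So a line counts as the plane with \<open>v = 0\<close>, and
  eigenvectors and real planes share the same lemmas.\<close>

lemma orthogonal_expansion:
  assumes "ip u v = 0" and "x = sc a u + sc b v"
  shows "sc (ip x u / ip u u) u + sc (ip x v / ip v v) v = x"
proof -
  have "ip v u = 0"
    using assms(1) by (metis ip_commute cj_zero)
  then have "sc (ip x u / ip u u) u = sc a u" "sc (ip x v / ip v v) v = sc b v"
    unfolding assms(2)
    by (cases "u = 0"; cases "v = 0"; simp add: ip_add_left ip_sc_left assms(1) ip_eq_zero_iff)+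
  then show ?thesis
    by (simp only: assms(2))
qed

lemma orthogonalize_plane:
  obtains v' where "ip u v' = 0" and "{sc a u + sc b v | a b. True} = {sc a u + sc b v' | a b. True}"
proof -
  define c where "c = ip v u / ip u u"
  define v' where "v' = v - sc c u"
  have "ip v' u = 0"
    unfolding v'_def c_def by (cases "u = 0") (simp_all add: ip_diff_left ip_sc_left ip_eq_zero_iff)
  then have "ip u v' = 0"
    by (metis ip_commute cj_zero)
  moreover have "sc a u + sc b v = sc (a + b * c) u + sc b v'"
    and "sc a u + sc b v' = sc (a - b * c) u + sc b v" for a b
    unfolding v'_def by (simp_all add: scale_left_distrib scale_left_diff_distrib scale_right_diff_distrib)
  then have "{sc a u + sc b v | a b. True} = {sc a u + sc b v' | a b. True}"
    by blast
  ultimately show thesis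
    by (rule that)
qed

lemma parallelogram:
  fixes x y :: 'h
  shows "(norm (x + y))\<^sup>2 + (norm (x - y))\<^sup>2 = 2 * (norm x)\<^sup>2 + 2 * (norm y)\<^sup>2"
proof -
  have "ip (x + y) (x + y) + ip (x - y) (x - y) = 2 * ip x x + 2 * ip y y"
    by (simp add: ip_add_left ip_add_right ip_diff_left ip_diff_right)
  then have "of_real ((norm (x + y))\<^sup>2 + (norm (x - y))\<^sup>2) =
      (of_real (2 * (norm x)\<^sup>2 + 2 * (norm y)\<^sup>2) :: 'f)"
    unfolding ip_self by simp
  then show ?thesis
    unfolding of_real_eq_iff .
qed

lemma closed_subspace_projection:
  assumes M: "closed M" "subspace M"
  obtains m where "m \<in> M" "\<And>z. z \<in> M \<Longrightarrow> ip (x - m) z = 0"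
proof -
  define D where "D = (INF m\<in>M. (norm (x - m))\<^sup>2)"
  have ne: "M \<noteq> {}"
    using M(2) subspace_0 by blast
  have bdd: "bdd_below ((\<lambda>m. (norm (x - m))\<^sup>2) ` M)"
    by (rule bdd_belowI2[of _ 0]) simp
  have D: "D \<le> (norm (x - m))\<^sup>2" if "m \<in> M" for m
    unfolding D_def using bdd that by (rule cINF_lower)
  have "\<exists>m\<in>M. (norm (x - m))\<^sup>2 < D + 1 / Suc n" for n
    using cINF_less_iff[OF ne bdd, of "D + 1 / Suc n"] unfolding D_def by auto
  then obtain m where mM: "\<And>n. m n \<in> M" and m: "\<And>n. (norm (x - m n))\<^sup>2 < D + 1 / Suc n"
    by metis
  \<comment> \<open>The midpoint of \<open>m i\<close> and \<open>m j\<close> lies in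
    \<open>M\<close>, so its squared distance to \<open>x\<close> is at least \<open>D\<close>; the
    parallelogram law turns this into a bound on the distance between the two.\<close>
  have d: "(norm (m i - m j))\<^sup>2 \<le> 2 / Suc i + 2 / Suc j" for i j
  proof -
    have "sc (of_real (1/2)) (m i + m j) \<in> M"
      using mM M(2) by (intro subspace_scale subspace_add)
    then have "D \<le> (norm (x - (1/2) *\<^sub>R (m i + m j)))\<^sup>2"
      unfolding sc_of_real by (rule D)
    moreover have "(x - m j) + (x - m i) = 2 *\<^sub>R (x - (1/2) *\<^sub>R (m i + m j))"
      by (simp add: algebra_simps scaleR_2)
    then have "(norm ((x - m j) + (x - m i)))\<^sup>2 = 4 * (norm (x - (1/2) *\<^sub>R (m i + m j)))\<^sup>2"
      by (simp add: power_mult_distrib)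
    moreover have "(x - m j) - (x - m i) = m i - m j"
      by simp
    ultimately show ?thesis
      using parallelogram[of "x - m j" "x - m i"] m[of i] m[of j] by simp
  qed
  have "Cauchy m"
  proof (rule metric_CauchyI)
    fix e :: real
    assume "0 < e"
    obtain N where N: "inverse (of_nat (Suc N)) < e\<^sup>2 / 4"
      using reals_Archimedean[of "e\<^sup>2 / 4"] \<open>0 < e\<close> by auto
    show "\<exists>M. \<forall>i\<ge>M. \<forall>j\<ge>M. dist (m i) (m j) < e"
    proof (intro exI allI impI)
      fix i j
      assume "N \<le> i" "N \<le> j"
      then have "inverse (real (Suc i)) \<le> inverse (real (Suc N))"
          "inverse (real (Suc j)) \<le> inverse (real (Suc N))"
        by (intro le_imp_inverse_le; simp)+
      then have "2 * inverse (real (Suc i)) + 2 * inverse (real (Suc j)) < e\<^sup>2"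
        using N by linarith
      then have "2 / Suc i + 2 / Suc j < e\<^sup>2"
        by (simp only: divide_inverse)
      then have "(norm (m i - m j))\<^sup>2 < e\<^sup>2"
        using d[of i j] by linarith
      then show "dist (m i) (m j) < e"
        using \<open>0 < e\<close> by (simp add: dist_norm power2_less_imp_less)
    qed
  qed
  then obtain l where l: "m \<longlonglongrightarrow> l"
    using convergent_eq_Cauchy convergent_def by blast
  have lM: "l \<in> M"
    using closed_sequentially[OF M(1) _ l] mM by blast
  have "(\<lambda>n. (norm (x - m n))\<^sup>2) \<longlonglongrightarrow> (norm (x - l))\<^sup>2"
    using l by (intro tendsto_intros)
  moreover have "(\<lambda>n. D + 1 / Suc n) \<longlonglongrightarrow> D + 0"
    using LIMSEQ_inverse_real_of_nat by (intro tendsto_add) (simp_all add: inverse_eq_divide)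
  ultimately have lD: "(norm (x - l))\<^sup>2 \<le> D"
    using m by (intro LIMSEQ_le[of _ _ _ "D"]) (auto intro: less_imp_le)
  have "ip (x - l) z = 0" if "z \<in> M" for z
  proof -
    \<comment> \<open>The best step along \<open>z\<close>: it would lower the squared distance
      below the minimum \<open>D\<close> unless the inner product vanishes.\<close>
    define c where "c = ip (x - l) z / of_real ((norm z)\<^sup>2)"
    have "l + sc c z \<in> M"
      using lM that M(2) by (intro subspace_add subspace_scale)
    then have "D \<le> (norm (x - l - sc c z))\<^sup>2"
      using D by (metis diff_diff_add)
    then have "(norm (ip (x - l) z))\<^sup>2 / (norm z)\<^sup>2 \<le> 0"
      using lD norm_diff_component[of "x - l" z] unfolding c_def by linarith
    then show ?thesis
      by (cases "z = 0") (auto simp: divide_le_0_iff)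
  qed
  with lM show thesis
    using that by blast
qed

text \<open>Turns the later claims that a closed subspace is everything into the study of a vector
  orthogonal to it.\<close>

lemma closed_subspace_eq_UNIV:
  assumes "closed M" "subspace M" and "\<And>e. (\<And>z. z \<in> M \<Longrightarrow> ip e z = 0) \<Longrightarrow> e = 0"
  shows "M = UNIV"
proof -
  have "x \<in> M" for x
  proof -
    obtain m where "m \<in> M" "\<And>z. z \<in> M \<Longrightarrow> ip (x - m) z = 0"
      using closed_subspace_projection[OF assms(1,2)] by blast
    then show ?thesis
      using assms(3)[of "x - m"] by simp
  qed
  then show ?thesis
    by blast
qed

lemma ip_in_dual: "(\<lambda>x. ip x z) \<in> dual sc"
proof -
  have "vector_space ((*) :: 'f \<Rightarrow> 'f \<Rightarrow> 'f)"
    by unfold_locales (simp_all add: algebra_simps)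
  then have "Vector_Spaces.linear sc (*) (\<lambda>x. ip x z)"
    by (simp add: Vector_Spaces.linear_iff vector_space_axioms ip_add_left ip_sc_left)
  moreover have "\<exists>K. \<forall>x. norm (ip x z) \<le> K * norm x"
    using norm_ip_le[of _ z] by (intro exI[of _ "norm z"]) (simp add: mult.commute)
  ultimately show ?thesis
    unfolding dual_def by blast
qed

lemma weakly_converges_ip:
  "weakly_converges sc X l \<Longrightarrow> (\<lambda>n. ip (X n) z) \<longlonglongrightarrow> ip l z"
  unfolding weakly_converges_def by (drule bspec[OF _ ip_in_dual])

end

section \<open>Baire category, uniform boundedness and the Riesz representation\<close>

lemma closed_nat_cover_contains_ball:
  fixes F :: "nat \<Rightarrow> 'a::{complete_space,real_normed_vector} set"
  assumes "\<And>n. closed (F n)" and "(\<Union>n. F n) = UNIV"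
  obtains n x e where "0 < e" "ball x e \<subseteq> F n"
proof -
  have "\<exists>n. interior (F n) \<noteq> {}"
  proof (rule ccontr)
    assume "\<nexists>n. interior (F n) \<noteq> {}"
    then have "Met_TC.mtopology interior_of \<Union>(range F) = {}"
      using assms(1) complete_UNIV by (intro Met_TC.metric_Baire_category_alt) auto
    then show False
      using assms(2) by simp
  qed
  then show thesis
    using that by (metis all_not_in_conv mem_interior)
qed

context scalar_hilbert_space
begin

text \<open>The uniform boundedness principle: by Baire all functionals are bounded by one
  \<open>j\<close> on some ball, and differences of points of that ball reach every
  direction.\<close>

lemma weakly_bounded_imp_bounded:
  assumes "\<And>z. bounded (range (\<lambda>n. ip (X n) z))"
  obtains C where "\<And>n::nat. norm (X n) \<le> C"
proof -
  define F where "F j = {z. \<forall>n. norm (ip (X n) z) \<le> real j}" for j :: nat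
  have "closed (F j)" for j
    unfolding F_def
    by (intro closed_Collect_all closed_Collect_le continuous_intros continuous_on_ip)
  moreover have "(\<Union>j. F j) = UNIV"
  proof -
    have "z \<in> (\<Union>j. F j)" for z
    proof -
      obtain C where "\<And>n. norm (ip (X n) z) \<le> C"
        using assms[of z] unfolding bounded_iff by auto
      moreover obtain j :: nat where "C \<le> real j"
        using real_arch_simple by blast
      ultimately have "\<forall>n. norm (ip (X n) z) \<le> real j"
        by (meson order_trans)
      then show ?thesis
        unfolding F_def by blast
    qed
    then show ?thesis
      by blast
  qed
  ultimately obtain j c e where e: "0 < e" "ball c e \<subseteq> F j"
    by (rule closed_nat_cover_contains_ball)
  have *: "norm (ip (X n) z) \<le> real j" if "z \<in> ball c e" for n z
    using e(2) that unfolding F_def by blast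
  have "norm (X n) \<le> 4 * real j / e" for n
  proof (cases "X n = 0")
    case False
    \<comment> \<open>The direction of \<open>X n\<close>, scaled to half the radius:
      \<open>ip (X n) z\<close> has norm \<open>e * norm (X n) / 2\<close>, and the bound
      \<open>2 * real j\<close> on it becomes \<open>4 * real j / e\<close>.\<close>
    define z where "z = (e / (2 * norm (X n))) *\<^sub>R X n"
    have "norm z = e / 2"
      unfolding z_def using False e(1) by simp
    then have "c + z \<in> ball c e" "c \<in> ball c e"
      using e(1) by (simp_all add: dist_norm)
    then have "norm (ip (X n) (c + z)) \<le> real j" "norm (ip (X n) c) \<le> real j"
      using * by blast+
    moreover have "ip (X n) z = ip (X n) (c + z) - ip (X n) c"
      by (simp add: ip_add_right)
    then have "norm (ip (X n) z) \<le> norm (ip (X n) (c + z)) + norm (ip (X n) c)"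
      by (metis norm_triangle_ineq4)
    ultimately have "norm (ip (X n) z) \<le> 2 * real j"
      by linarith
    moreover have "ip (X n) z = of_real (e * norm (X n) / 2)"
      unfolding z_def using False ip_sc_right[of "X n" "of_real (e / (2 * norm (X n)))" "X n"]
      unfolding sc_of_real cj_of_real ip_self by (simp flip: of_real_mult of_real_divide add: power2_eq_square)
    then have "norm (ip (X n) z) = e * norm (X n) / 2"
      using e(1) by (simp only: norm_of_real) simp
    ultimately show ?thesis
      using e(1) by (simp add: field_simps)
  qed (use e(1) in simp)
  then show thesis
    using that by blast
qed

text \<open>Testing against \<open>g\<close> itself recovers the scalars, which therefore converge.
  The limit is assumed only against vectors of \<open>M\<close>, since this is all that survives a
  compression to \<open>M\<close>.\<close>

lemma weak_limit_on_line:
  assumes M: "subspace M" "g \<in> M" "h \<in> M"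
    and lim: "\<And>z. z \<in> M \<Longrightarrow> (\<lambda>k::nat. ip (sc (\<alpha> k) g) z) \<longlonglongrightarrow> ip h z"
  obtains a where "h = sc a g"
proof (cases "g = 0")
  case True
  then have "(\<lambda>k. 0) \<longlonglongrightarrow> ip h h"
    using lim[OF M(3)] by simp
  then have "ip h h = 0"
    using LIMSEQ_unique tendsto_const by metis
  then have "h = sc 0 g"
    by (simp add: ip_eq_zero_iff)
  then show thesis
    by (rule that)
next
  case False
  define a where "a = ip h g / ip g g"
  have ne: "ip g g \<noteq> 0"
    using False by (simp add: ip_eq_zero_iff)
  have "(\<lambda>k. \<alpha> k * ip g g / ip g g) \<longlonglongrightarrow> a"
    unfolding a_def using lim[OF M(2)] ne by (intro tendsto_divide) (auto simp: ip_sc_left)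
  then have "\<alpha> \<longlonglongrightarrow> a"
    using ne by simp
  then have "(\<lambda>k. ip (sc (\<alpha> k) g) z) \<longlonglongrightarrow> ip (sc a g) z" for z
    unfolding ip_sc_left by (intro tendsto_intros)
  then have "ip (h - sc a g) z = 0" if "z \<in> M" for z
    using LIMSEQ_unique[OF lim[OF that]] by (simp add: ip_diff_left)
  moreover have "h - sc a g \<in> M"
    using M by (intro subspace_diff subspace_scale)
  ultimately have "ip (h - sc a g) (h - sc a g) = 0"
    by blast
  then have "h = sc a g"
    by (simp add: ip_eq_zero_iff)
  then show thesis
    by (rule that)
qed

lemma riesz_representation:
  assumes f: "f \<in> dual sc"
  obtains z where "\<And>x. f x = ip x z"
proof -
  obtain K where lin: "Vector_Spaces.linear sc (*) f" and K: "\<And>x. norm (f x) \<le> K * norm x"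
    using f unfolding dual_def by blast
  have f_add: "f (x + y) = f x + f y" and f_sc: "f (sc c x) = c * f x" for x y c
    using lin unfolding Vector_Spaces.linear_iff by simp_all
  have f_0: "f 0 = 0"
    using f_add[of 0 0] by simp
  have "bounded_linear f"
  proof
    show "f (r *\<^sub>R x) = r *\<^sub>R f x" for r x
      using f_sc[of "of_real r" x] by (simp add: sc_of_real scaleR_conv_of_real)
    show "\<exists>K. \<forall>x. norm (f x) \<le> norm x * K"
      using K by (metis mult.commute)
  qed (rule f_add)
  then have cont: "continuous_on UNIV f"
    by (simp add: linear_continuous_on)
  define N where "N = {x. f x = 0}"
  have N: "closed N" "subspace N"
    unfolding N_def using cont
    by (auto intro!: closed_Collect_eq continuous_on_const simp: subspace_def f_add f_sc f_0)
  show thesis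
  proof (cases "\<exists>e. e \<noteq> 0 \<and> (\<forall>z\<in>N. ip e z = 0)")
    case True
    then obtain e where e: "e \<noteq> 0" "\<And>z. z \<in> N \<Longrightarrow> ip e z = 0"
      by blast
    then have fe: "f e \<noteq> 0"
      unfolding N_def using ip_eq_zero_iff by blast
    have ee: "ip e e \<noteq> 0"
      using e(1) by (simp add: ip_eq_zero_iff)
    \<comment> \<open>That \<open>cj\<close> is an involution is no axiom of the locale; it follows
      from applying \<open>ip_commute\<close> twice to multiples of the nonzero vector
      \<open>e\<close>.\<close>
    obtain c where c: "cj c = f e / ip e e"
    proof
      show "cj (cj (f e / ip e e)) = f e / ip e e"
        using ip_sc_right ip_commute ip_sc_left cj_mult ee
        by (metis mult_cancel_right nonzero_eq_divide_eq)
    qed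
    have "f x = ip x (sc c e)" for x
    proof -
      have "sc (f e) x - sc (f x) e \<in> N"
        unfolding N_def using f_add[of "sc (f e) x - sc (f x) e" "sc (f x) e"] by (simp add: f_sc mult.commute)
      then have "ip (sc (f e) x - sc (f x) e) e = 0"
        using e(2) ip_commute cj_zero by metis
      then have "f e * ip x e = f x * ip e e"
        by (simp add: ip_diff_left ip_sc_left)
      then show ?thesis
        using ee by (simp add: ip_sc_right c field_simps)
    qed
    then show thesis
      by (rule that)
  next
    case False
    then have "N = UNIV"
      using closed_subspace_eq_UNIV[OF N] by blast
    then have "f x = ip x 0" for x
      unfolding N_def by auto
    then show thesis
      by (rule that)
  qed
qed

text \<open>An independent set inside the span of one vector has at most one element.\<close>

lemma not_dim_gt_one_line:
  assumes "\<And>x. \<exists>a. x = sc a y"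
  shows "\<not> dim_gt_one sc"
proof
  assume "dim_gt_one sc"
  then obtain B where B: "independent B" "infinite B \<or> card B > 1"
    unfolding dim_gt_one_def by blast
  have "B \<subseteq> span {y}"
    using assms span_singleton by blast
  then show False
    using independent_span_bound[of "{y}" B] B by auto
qed

end

section \<open>Linear isometries\<close>

locale hilbert_isometry = scalar_hilbert_space +
  fixes T :: "'b \<Rightarrow> 'b"
  assumes isometry: "isometry sc T"
begin

lemma T_add: "T (x + y) = T x + T y"
  and T_sc: "T (sc c x) = sc c (T x)"
  and norm_T [simp]: "norm (T x) = norm x"
  using isometry unfolding isometry_def Vector_Spaces.linear_iff by simp_all

lemma pow_add: "(T ^^ n) (x + y) = (T ^^ n) x + (T ^^ n) y"
  by (induction n) (simp_all add: T_add)

lemma pow_sc: "(T ^^ n) (sc c x) = sc c ((T ^^ n) x)"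
  by (induction n) (simp_all add: T_sc)

lemma norm_pow [simp]: "norm ((T ^^ n) x) = norm x"
  by (induction n) simp_all

lemma pow_zero: "(T ^^ n) 0 = 0"
  using norm_pow[of n 0] by (simp del: norm_pow)

lemma T_diff: "T (x - y) = T x - T y"
  using T_add[of "x - y" y] by (simp add: algebra_simps)

lemma pow_diff: "(T ^^ n) (x - y) = (T ^^ n) x - (T ^^ n) y"
  using pow_add[of n "x - y" y] by (simp add: algebra_simps)

text \<open>Polarization for both fields at once. Expanding the norm of \<open>u + v\<close>
  controls only the sum of the defect \<open>d\<close> and its conjugate; scaling the first argument
  by \<open>cj d\<close> turns the defect into the real number |d|^2, which must then
  vanish.\<close>

lemma ip_T [simp]: "ip (T x) (T y) = ip x y"
proof -
  define d where "d = ip (T x) (T y) - ip x y"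
  have *: "ip (T u) (T v) + ip (T v) (T u) = ip u v + ip v u" for u v
  proof -
    have "ip (T u + T v) (T u + T v) = ip (u + v) (u + v)" "ip (T u) (T u) = ip u u" "ip (T v) (T v) = ip v v"
      unfolding ip_self T_add[symmetric] by simp_all
    then show ?thesis
      by (simp add: ip_add_left ip_add_right algebra_simps)
  qed
  have "c * d + cj (c * d) = 0" for c
  proof -
    have "cj (c * d) + cj (ip (sc c x) y) = cj (ip (sc c (T x)) (T y))"
      unfolding d_def ip_sc_left cj_add[symmetric] by (simp add: algebra_simps)
    then have cj_cd: "cj (c * d) = ip (T y) (sc c (T x)) - ip y (sc c x)"
      by (metis ip_commute add_diff_cancel_right')
    have cd: "c * d = ip (sc c (T x)) (T y) - ip (sc c x) y"
      unfolding d_def ip_sc_left by (simp add: algebra_simps)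
    show ?thesis
      unfolding cj_cd unfolding cd using *[of "sc c x" y] by (simp add: T_sc algebra_simps)
  qed
  moreover have "cj d * d = of_real ((norm d)\<^sup>2)"
    using cj_self[of d] by (simp only: mult.commute)
  ultimately have "of_real ((norm d)\<^sup>2) + of_real ((norm d)\<^sup>2) = (0 :: 'a)"
    by (metis cj_of_real)
  then have "of_real (2 * (norm d)\<^sup>2) = (of_real 0 :: 'a)"
    by simp
  then have "d = 0"
    unfolding of_real_eq_iff by simp
  then show ?thesis
    unfolding d_def by simp
qed

lemma ip_pow [simp]: "ip ((T ^^ n) x) ((T ^^ n) y) = ip x y"
  by (induction n) simp_all

lemma continuous_T: "continuous_on S T"
  and continuous_pow: "continuous_on S (T ^^ n)"
  by (auto intro!: continuous_onI exI simp: dist_norm T_diff[symmetric] pow_diff[symmetric] intro: less_imp_le)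

end

subsection \<open>Supercyclic isometries\<close>

locale supercyclic_isometry = hilbert_isometry +
  fixes y
  assumes orbit_weakly_dense: "weak_limit_set sc (projective_orbit sc T y) = UNIV"
    and y_nonzero: "y \<noteq> 0"
    and dim_gt_one: "dim_gt_one sc"
begin

lemma orbit_converges_weakly:
  obtains \<alpha> n where "\<And>z. (\<lambda>k. ip (sc (\<alpha> k) ((T ^^ n k) y)) z) \<longlonglongrightarrow> ip h z"
proof -
  obtain X where X: "\<And>k. X k \<in> projective_orbit sc T y" "weakly_converges sc X h"
    using orbit_weakly_dense unfolding weak_limit_set_def by blast
  have "\<forall>k. \<exists>a m. X k = sc a ((T ^^ m) y)"
    using X(1) unfolding projective_orbit_def by blast
  then obtain \<alpha> n where "\<And>k. X k = sc (\<alpha> k) ((T ^^ n k) y)"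
    by metis
  then have "(\<lambda>k. ip (sc (\<alpha> k) ((T ^^ n k) y)) z) \<longlonglongrightarrow> ip h z" for z
    using weakly_converges_ip[OF X(2)] by simp
  then show thesis
    by (rule that)
qed

text \<open>A vector \<open>e\<close> orthogonal to \<open>M\<close> is itself a weak limit of
  multiples of orbit vectors, all of which lie in \<open>M\<close>; hence
  \<open>ip e e = 0\<close>.\<close>

lemma cyclic:
  assumes "closed M" "subspace M" "\<And>x. x \<in> M \<Longrightarrow> T x \<in> M" "y \<in> M"
  shows "M = UNIV"
proof (rule closed_subspace_eq_UNIV[OF assms(1,2)])
  fix e
  assume e: "\<And>z. z \<in> M \<Longrightarrow> ip e z = 0"
  obtain \<alpha> n where lim: "\<And>z. (\<lambda>k. ip (sc (\<alpha> k) ((T ^^ n k) y)) z) \<longlonglongrightarrow> ip e z"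
    using orbit_converges_weakly[of e] by blast
  have "(T ^^ m) y \<in> M" for m
    using assms(3,4) by (induction m) auto
  then have "ip (sc a ((T ^^ m) y)) e = 0" for a m
    using e[of "sc a ((T ^^ m) y)"] assms(2) subspace_scale ip_commute cj_zero by metis
  then have "(\<lambda>k. 0) \<longlonglongrightarrow> ip e e"
    using lim[of e] by simp
  then show "e = 0"
    using LIMSEQ_unique tendsto_const ip_eq_zero_iff by metis
qed

lemma surj_T: "surj T"
proof (rule closed_subspace_eq_UNIV)
  show "subspace (range T)"
    unfolding subspace_def
  proof (intro conjI ballI allI)
    show "0 \<in> range T"
      using T_sc[of 0 0] by (metis rangeI scale_zero_left)
  qed (auto simp: T_add[symmetric] T_sc[symmetric])
  show "closed (range T)"
    unfolding closed_sequential_limits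
  proof (intro allI impI)
    fix x l
    assume "(\<forall>n. x n \<in> range T) \<and> x \<longlonglongrightarrow> l"
    then have "\<forall>n. \<exists>u. x n = T u" and l: "x \<longlonglongrightarrow> l"
      by auto
    then obtain u where u: "\<And>n. x n = T (u n)"
      by metis
    have "Cauchy x"
      using l convergent_Cauchy convergent_def by blast
    then have "Cauchy u"
      unfolding Cauchy_def u dist_norm T_diff[symmetric] norm_T .
    then obtain v where v: "u \<longlonglongrightarrow> v"
      using Cauchy_convergent convergent_def by blast
    have "x \<longlonglongrightarrow> T v"
      unfolding u using continuous_on_tendsto_compose[OF continuous_T[of UNIV] v] by simp
    then show "l \<in> range T"
      using l LIMSEQ_unique by blast
  qed
  fix e
  assume e: "\<And>z. z \<in> range T \<Longrightarrow> ip e z = 0"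
  show "e = 0"
  proof (rule ccontr)
    assume "e \<noteq> 0"
    \<comment> \<open>Every orbit vector except \<open>y\<close> lies in the range of
      \<open>T\<close> and is orthogonal to \<open>e\<close>. A limit not orthogonal to
      \<open>e\<close> thus forces the exponents to be 0 from some index on.\<close>
    have line: "\<exists>a. h = sc a y" if h: "ip h e \<noteq> 0" for h
    proof -
      obtain \<alpha> n where lim: "\<And>z. (\<lambda>k. ip (sc (\<alpha> k) ((T ^^ n k) y)) z) \<longlonglongrightarrow> ip h z"
        using orbit_converges_weakly[of h] by blast
      have "ip ((T ^^ Suc m) y) e = 0" for m
        using e[of "(T ^^ Suc m) y"] ip_commute[of "(T ^^ Suc m) y" e] by (simp add: cj_zero)
      then have "ip (sc a ((T ^^ Suc m) y)) e = 0" for a m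
        unfolding ip_sc_left by simp
      then have "n k = 0" if "ip (sc (\<alpha> k) ((T ^^ n k) y)) e \<noteq> 0" for k
        using that by (metis not0_implies_Suc)
      then have "eventually (\<lambda>k. n k = 0) sequentially"
        using tendsto_imp_eventually_ne[OF lim[of e] h] by (auto elim: eventually_mono)
      then obtain N where N: "\<And>k. n (k + N) = 0"
        unfolding eventually_sequentially by (metis le_add2)
      have "(\<lambda>k. ip (sc (\<alpha> (k + N)) y) z) \<longlonglongrightarrow> ip h z" for z
        using LIMSEQ_ignore_initial_segment[OF lim, of N z] by (simp add: N)
      then show ?thesis
        using weak_limit_on_line[of UNIV y h "\<lambda>k. \<alpha> (k + N)"] by auto
    qed
    have ee: "ip e e \<noteq> 0"
      using \<open>e \<noteq> 0\<close> by (simp add: ip_eq_zero_iff)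
    obtain b where b: "e = sc b y"
      using line[OF ee] by blast
    \<comment> \<open>If \<open>h\<close> is orthogonal to \<open>e\<close>, then
      \<open>h + e\<close> is not; as \<open>e\<close> is itself a multiple of \<open>y\<close>, so
      is the difference.\<close>
    have "\<exists>a. h = sc a y" for h
    proof (cases "ip h e = 0")
      case True
      then obtain a where "h + e = sc a y"
        using line[of "h + e"] ee by (auto simp: ip_add_left)
      then have "h = sc (a - b) y"
        using b by (simp add: scale_left_diff_distrib eq_diff_eq)
      then show ?thesis
        by blast
    qed (rule line)
    then show False
      using not_dim_gt_one_line dim_gt_one by blast
  qed
qed

text \<open>Since \<open>M\<close> is contained in its own image, a test vector can be pulled back:
  \<open>z = T z'\<close> removes one power of \<open>T\<close> from the other side.\<close>

lemma invariant_complement: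
  assumes M: "\<And>z. z \<in> M \<Longrightarrow> \<exists>z'\<in>M. T z' = z" and u: "\<And>z. z \<in> M \<Longrightarrow> ip u z = 0"
  shows "z \<in> M \<Longrightarrow> ip ((T ^^ n) u) z = 0"
proof (induction n arbitrary: z)
  case (Suc n)
  then obtain z' where "z' \<in> M" "T z' = z"
    using M by blast
  then show ?case
    using Suc.IH[of z'] by auto
qed (use u in simp)

text \<open>The scalars are bounded because \<open>T\<close> is isometric and weakly convergent sequences are bounded.\<close>

lemma compressed_orbit:
  assumes M: "\<And>z. z \<in> M \<Longrightarrow> \<exists>z'\<in>M. T z' = z" and g: "\<And>z. z \<in> M \<Longrightarrow> ip (y - g) z = 0"
  obtains \<alpha> n C where "\<And>k. norm (\<alpha> k) \<le> C"
    and "\<And>z. (\<lambda>k. ip (sc (\<alpha> k) ((T ^^ n k) y)) z) \<longlonglongrightarrow> ip h z"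
    and "\<And>z. z \<in> M \<Longrightarrow> (\<lambda>k. ip (sc (\<alpha> k) ((T ^^ n k) g)) z) \<longlonglongrightarrow> ip h z"
proof -
  obtain \<alpha> n where lim: "\<And>z. (\<lambda>k. ip (sc (\<alpha> k) ((T ^^ n k) y)) z) \<longlonglongrightarrow> ip h z"
    using orbit_converges_weakly[of h] by blast
  have "bounded (range (\<lambda>k. ip (sc (\<alpha> k) ((T ^^ n k) y)) z))" for z
    using lim by (rule convergent_imp_bounded)
  then obtain C where "\<And>k. norm (sc (\<alpha> k) ((T ^^ n k) y)) \<le> C"
    using weakly_bounded_imp_bounded[of "\<lambda>k. sc (\<alpha> k) ((T ^^ n k) y)"] by blast
  then have "norm (\<alpha> k) \<le> C / norm y" for k
    using y_nonzero by (simp add: norm_sc field_simps)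
  moreover have "(\<lambda>k. ip (sc (\<alpha> k) ((T ^^ n k) g)) z) \<longlonglongrightarrow> ip h z" if "z \<in> M" for z
  proof -
    have "ip ((T ^^ m) (y - g)) z = 0" for m
      using invariant_complement[OF M g that] by blast
    then have "ip (sc a ((T ^^ m) g)) z = ip (sc a ((T ^^ m) y)) z" for a m
      by (simp add: pow_diff ip_diff_left ip_sc_left)
    then show ?thesis
      using lim by simp
  qed
  ultimately show thesis
    using that lim by blast
qed

section \<open>Weakly null vectors and reducing planes\<close>

definition weakly_null :: "'b \<Rightarrow> bool" where
  "weakly_null x \<longleftrightarrow> (\<forall>z. (\<lambda>n. ip ((T ^^ n) x) z) \<longlonglongrightarrow> 0)"

text \<open>The powers of \<open>T\<close> are isometric, so replacing \<open>l\<close> by a nearby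
  \<open>X k\<close> costs an error uniform in \<open>n\<close>.\<close>

lemma closed_weakly_null: "closed {x. weakly_null x}"
  unfolding closed_sequential_limits
proof (intro allI impI, elim conjE)
  fix X l
  assume X: "\<forall>k. X k \<in> {x. weakly_null x}" "X \<longlonglongrightarrow> l"
  have "(\<lambda>n. ip ((T ^^ n) l) z) \<longlonglongrightarrow> 0" for z
  proof (rule LIMSEQ_I)
    fix e :: real
    assume "0 < e"
    have "(\<lambda>k. norm (l - X k) * norm z) \<longlonglongrightarrow> norm (l - l) * norm z"
      using X(2) by (intro tendsto_intros)
    then have "eventually (\<lambda>k. norm (l - X k) * norm z < e / 2) sequentially"
      using \<open>0 < e\<close> by (intro order_tendstoD(2)) auto
    then obtain k where k: "norm (l - X k) * norm z < e / 2"
      using eventually_happens' sequentially_bot by blast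
    have "(\<lambda>n. ip ((T ^^ n) (X k)) z) \<longlonglongrightarrow> 0"
      using X(1) unfolding weakly_null_def by blast
    then obtain N where N: "\<And>n. N \<le> n \<Longrightarrow> norm (ip ((T ^^ n) (X k)) z) < e / 2"
      using LIMSEQ_D[of _ 0 "e / 2"] \<open>0 < e\<close> by auto
    have "norm (ip ((T ^^ n) l) z - 0) < e" if "N \<le> n" for n
    proof -
      have "ip ((T ^^ n) l) z = ip ((T ^^ n) (l - X k)) z + ip ((T ^^ n) (X k)) z"
        by (simp add: pow_diff ip_diff_left)
      moreover have "norm (ip ((T ^^ n) (l - X k)) z) < e / 2"
        using norm_ip_le[of "(T ^^ n) (l - X k)" z] k by simp
      ultimately show ?thesis
        using N[OF that] norm_triangle_ineq[of "ip ((T ^^ n) (l - X k)) z" "ip ((T ^^ n) (X k)) z"]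
        by simp
    qed
    then show "\<exists>N. \<forall>n\<ge>N. norm (ip ((T ^^ n) l) z - 0) < e"
      by blast
  qed
  then show "l \<in> {x. weakly_null x}"
    by (simp add: weakly_null_def)
qed

text \<open>
  The weakly null vectors are covered by the countably many lines through \<open>T\<^sup>n g\<close>, where \<open>g\<close> is the
  projection of \<open>y\<close>; this leaves room for at most one dimension, on which \<open>T\<close> is a rotation.
\<close>

lemma weakly_null_eq_zero:
  assumes x: "weakly_null x"
  shows "x = 0"
proof -
  define N where "N = {x. weakly_null x}"
  have sub: "subspace N"
    unfolding subspace_def
  proof (intro conjI ballI allI)
    show "0 \<in> N"
      by (simp add: N_def weakly_null_def pow_zero)
    show "u + v \<in> N" if "u \<in> N" "v \<in> N" for u v
      using that tendsto_add_zero unfolding N_def weakly_null_def by (fastforce simp: pow_add ip_add_left)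
    show "sc c u \<in> N" if "u \<in> N" for c u
      using that unfolding N_def weakly_null_def by (auto simp: pow_sc ip_sc_left intro: tendsto_mult_right_zero)
  qed
  have TN: "T u \<in> N" if "u \<in> N" for u
    using that LIMSEQ_Suc unfolding N_def weakly_null_def by (fastforce simp: funpow_swap1)
  have surjN: "\<exists>z'\<in>N. T z' = z" if z: "z \<in> N" for z
  proof -
    obtain z' where z': "z = T z'"
      using surj_T by (metis surjD)
    have "(\<lambda>n. ip ((T ^^ Suc n) z') w) \<longlonglongrightarrow> 0" for w
      using z unfolding N_def weakly_null_def z' by (simp add: funpow_swap1)
    then have "(\<lambda>n. ip ((T ^^ n) z') w) \<longlonglongrightarrow> 0" for w
      by (rule LIMSEQ_imp_Suc)
    then have "z' \<in> N"
      by (simp add: N_def weakly_null_def)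
    then show ?thesis
      using z' by blast
  qed
  obtain g where g: "g \<in> N" "\<And>z. z \<in> N \<Longrightarrow> ip (y - g) z = 0"
    using closed_subspace_projection[of N y] closed_weakly_null sub unfolding N_def by blast
  have powN: "(T ^^ m) g \<in> N" for m
    using g(1) TN by (induction m) auto
  have cover: "\<exists>m a. h = sc a ((T ^^ m) g)" if h: "h \<in> N" for h
  proof -
    obtain \<alpha> n C where C: "\<And>k. norm (\<alpha> k) \<le> C"
      and lim: "\<And>z. z \<in> N \<Longrightarrow> (\<lambda>k. ip (sc (\<alpha> k) ((T ^^ n k) g)) z) \<longlonglongrightarrow> ip h z"
      by (rule compressed_orbit[of N g h]) (use surjN g(2) in auto)
    show ?thesis
    \<comment> \<open>Either one exponent \<open>m\<close> recurs along a subsequence, which puts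
      \<open>h\<close> on the line of \<open>(T ^^ m) g\<close>, or the exponents tend to infinity,
      and bounded scalars times a weakly null orbit leave only \<open>h = 0\<close>.\<close>
    proof (cases "\<exists>m. infinite {k. n k = m}")
      case True
      then obtain m where m: "infinite {k. n k = m}"
        by (rule exE)
      obtain r :: "nat \<Rightarrow> nat" where "strict_mono r" "\<forall>k. r k \<in> {k. n k = m}"
        using infinite_enumerate[OF m] by (elim exE conjE)
      then have r: "strict_mono r" "\<And>k. n (r k) = m"
        by auto
      have "(\<lambda>k. ip (sc (\<alpha> (r k)) ((T ^^ m) g)) z) \<longlonglongrightarrow> ip h z" if "z \<in> N" for z
        using LIMSEQ_subseq_LIMSEQ[OF lim[OF that] r(1)] by (simp add: comp_def r(2))
      then show ?thesis
        using weak_limit_on_line[OF sub powN h, of "\<lambda>k. \<alpha> (r k)" m] by blast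
    next
      case False
      have "filterlim n at_top sequentially"
        unfolding filterlim_at_top
      proof
        fix Z
        have "{k. \<not> Z \<le> n k} = (\<Union>m<Z. {k. n k = m})"
          by auto
        then have "finite {k. \<not> Z \<le> n k}"
          using False by simp
        then show "eventually (\<lambda>k. Z \<le> n k) sequentially"
          by (simp add: eventually_cofinite flip: cofinite_eq_sequentially)
      qed
      then have "(\<lambda>k. ip ((T ^^ n k) g) h) \<longlonglongrightarrow> 0"
        using g(1) unfolding N_def weakly_null_def by (auto intro: filterlim_compose)
      then have "(\<lambda>k. \<alpha> k * ip ((T ^^ n k) g) h) \<longlonglongrightarrow> 0"
        using C by (intro lim_null_mult_left_bounded[where B = C]) (auto simp: eventuallyI)
      then have "ip h h = 0"
        using lim[OF h] LIMSEQ_unique by (auto simp: ip_sc_left)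
      then have "h = sc 0 ((T ^^ 0) g)"
        by (simp add: ip_eq_zero_iff)
      then show ?thesis
        by blast
    qed
  qed
  have "g = 0"
  proof (rule ccontr)
    assume g0: "g \<noteq> 0"
    \<comment> \<open>An uncountable family of vectors on countably many lines: two parameters share
      an exponent. Their difference makes \<open>v\<close> a multiple of \<open>g\<close>, so
      \<open>g\<close> is an eigenvector whose eigenvalue has norm 1, and
      \<open>ip ((T ^^ n) g) g\<close> keeps a constant positive norm instead of tending to
      0.\<close>
    have "T g + sc (of_real t) g \<in> N" for t
      using g(1) TN sub by (intro subspace_add subspace_scale)
    then have "\<forall>t. \<exists>m a. T g + sc (of_real t) g = sc a ((T ^^ m) g)"
      using cover by blast
    then obtain m :: "real \<Rightarrow> nat" and a where ma: "\<And>t. T g + sc (of_real t) g = sc (a t) ((T ^^ m t) g)"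
      by metis
    have "\<not> inj m"
      using countableI uncountable_UNIV_real by blast
    then obtain s t where st: "s \<noteq> t" "m s = m t"
      unfolding inj_def by blast
    define v where "v = (T ^^ m t) g"
    have "sc (of_real t - of_real s) g = sc (a t - a s) v"
      using ma[of t] ma[of s] st(2) unfolding v_def scale_left_diff_distrib
      by (metis add_diff_cancel_left)
    moreover have "of_real t - of_real s \<noteq> (0 :: 'a)"
      using st(1) by (simp flip: of_real_diff)
    ultimately have eq: "sc (of_real t - of_real s) g = sc (a t - a s) v" and "a t - a s \<noteq> 0"
      using g0 by auto
    then have "v = sc (1 / (a t - a s)) (sc (a t - a s) v)"
      by simp
    then have v: "v = sc ((of_real t - of_real s) / (a t - a s)) g"
      by (simp flip: eq)
    obtain c where Tg: "T g = sc c g"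
    proof
      show "T g = sc (a t * ((of_real t - of_real s) / (a t - a s)) - of_real t) g"
        using ma[of t] v unfolding v_def[symmetric]
        by (metis add_diff_cancel_right' scale_left_diff_distrib scale_scale)
    qed
    then have "norm c = 1"
      using norm_T[of g] g0 by (simp add: norm_sc)
    have "(T ^^ n) g = sc (c ^ n) g" for n
      by (induction n) (simp_all add: Tg T_sc mult.commute)
    then have "norm (ip ((T ^^ n) g) g) = (norm g)\<^sup>2" for n
      by (simp add: ip_sc_left norm_mult norm_power \<open>norm c = 1\<close> ip_self)
    moreover have "(\<lambda>n. norm (ip ((T ^^ n) g) g)) \<longlonglongrightarrow> 0"
      using g(1) unfolding N_def weakly_null_def by (auto intro: tendsto_norm_zero)
    ultimately show False
      using g0 by (simp add: LIMSEQ_const_iff)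
  qed
  moreover have "x \<in> N"
    using x by (simp add: N_def)
  ultimately show ?thesis
    using cover[of x] by (auto simp: pow_zero)
qed

text \<open>In a plane weak convergence is norm convergence. If \<open>w\<close> is orthogonal to
  \<open>M\<close>, the compressed vectors approximating it tend to 0 in norm; their norms are
  \<open>norm (\<alpha> k) * norm (P y)\<close>, so the scalars tend to 0 and with them the full
  approximants, whence \<open>w = 0\<close>. An eigenvector enters with
  \<open>v = 0\<close>.\<close>

lemma reducing_plane_eq_UNIV:
  assumes uv: "ip u v = 0" and M: "M = {sc a u + sc b v | a b. True}" and ne: "M \<noteq> {0}"
    and surj: "\<And>z. z \<in> M \<Longrightarrow> \<exists>z'\<in>M. T z' = z" and inv: "\<And>z. z \<in> M \<Longrightarrow> T z \<in> M"
  shows "M = UNIV"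
proof -
  define P where "P x = sc (ip x u / ip u u) u + sc (ip x v / ip v v) v" for x
  have vu: "ip v u = 0"
    using uv by (metis ip_commute cj_zero)
  have uM: "u \<in> M" and vM: "v \<in> M"
    unfolding M using scale_one scale_zero_left add_0_left add_0_right by (metis (mono_tags, lifting) mem_Collect_eq)+
  have PM: "P x \<in> M" for x
    unfolding P_def M by blast
  have Pu: "ip (x - P x) u = 0" for x
    by (cases "u = 0") (auto simp: P_def ip_diff_left ip_add_left ip_sc_left vu ip_eq_zero_iff)
  have Pv: "ip (x - P x) v = 0" for x
    by (cases "v = 0") (auto simp: P_def ip_diff_left ip_add_left ip_sc_left uv ip_eq_zero_iff)
  have orth: "ip (x - P x) z = 0" if "z \<in> M" for x z
    using that Pu Pv unfolding M by (auto simp: ip_add_right ip_sc_right)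
  have Pid: "P z = z" if zM: "z \<in> M" for z
  proof -
    obtain a b where z: "z = sc a u + sc b v"
      using zM unfolding M by blast
    then show ?thesis
      unfolding P_def by (rule orthogonal_expansion[OF uv])
  qed
  have w0: "w = 0" if w: "\<And>z. z \<in> M \<Longrightarrow> ip w z = 0" for w
  proof -
    obtain \<alpha> n C where
      lim: "\<And>z. (\<lambda>k. ip (sc (\<alpha> k) ((T ^^ n k) y)) z) \<longlonglongrightarrow> ip w z"
      and limM: "\<And>z. z \<in> M \<Longrightarrow> (\<lambda>k. ip (sc (\<alpha> k) ((T ^^ n k) (P y))) z) \<longlonglongrightarrow> ip w z"
      by (rule compressed_orbit[of M "P y" w]) (use surj orth in auto)
    define Z where "Z k = sc (\<alpha> k) ((T ^^ n k) (P y))" for k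
    have "(T ^^ m) (P y) \<in> M" for m
      using PM inv by (induction m) auto
    moreover have "sc c z \<in> M" if zM: "z \<in> M" for c z
    proof -
      obtain a b where "z = sc a u + sc b v"
        using zM unfolding M by blast
      then have "sc c z = sc (c * a) u + sc (c * b) v"
        by (simp add: scale_right_distrib)
      then show ?thesis
        unfolding M by blast
    qed
    ultimately have "Z k \<in> M" for k
      by (simp add: Z_def)
    then have Z: "P (Z k) = Z k" for k
      using Pid by blast
    have "(\<lambda>k. ip (Z k) u / ip u u) \<longlonglongrightarrow> 0" "(\<lambda>k. ip (Z k) v / ip v v) \<longlonglongrightarrow> 0"
      using limM[OF uM] limM[OF vM] w[OF uM] w[OF vM] unfolding Z_def by (auto intro: tendsto_divide_zero)
    then have "(\<lambda>k. norm (ip (Z k) u / ip u u) * norm u + norm (ip (Z k) v / ip v v) * norm v) \<longlonglongrightarrow>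
        norm (0 :: 'a) * norm u + norm (0 :: 'a) * norm v"
      by (intro tendsto_intros)
    then have coeffs: "(\<lambda>k. norm (ip (Z k) u / ip u u) * norm u + norm (ip (Z k) v / ip v v) * norm v) \<longlonglongrightarrow> 0"
      by simp
    have "norm (Z k) \<le> norm (ip (Z k) u / ip u u) * norm u + norm (ip (Z k) v / ip v v) * norm v" for k
      using norm_triangle_ineq[of "sc (ip (Z k) u / ip u u) u" "sc (ip (Z k) v / ip v v) v"] Z[of k]
      unfolding P_def by (simp add: norm_sc)
    then have "Z \<longlonglongrightarrow> 0"
      by (intro Lim_null_comparison[OF _ coeffs] always_eventually allI)
    then have "(\<lambda>k. norm (Z k)) \<longlonglongrightarrow> 0"
      by (rule tendsto_norm_zero)
    then have *: "(\<lambda>k. norm (\<alpha> k) * norm (P y)) \<longlonglongrightarrow> 0"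
      by (simp add: Z_def norm_sc)
    \<comment> \<open>Otherwise all compressed orbits vanish and no nonzero vector of
      \<open>M\<close> could be a weak limit.\<close>
    have "P y \<noteq> 0"
    proof
      assume "P y = 0"
      have "h = 0" if h: "h \<in> M" for h
      proof -
        obtain \<beta> l D where "\<And>z. z \<in> M \<Longrightarrow> (\<lambda>k. ip (sc (\<beta> k) ((T ^^ l k) (P y))) z) \<longlonglongrightarrow> ip h z"
          by (rule compressed_orbit[of M "P y" h]) (use surj orth in auto)
        then have "(\<lambda>k. ip (sc (\<beta> k) ((T ^^ l k) (P y))) h) \<longlonglongrightarrow> ip h h"
          using h by blast
        moreover have "(T ^^ m) (P y) = 0" for m
          by (simp add: \<open>P y = 0\<close> pow_zero)
        ultimately have "ip h h = 0"
          by (simp add: LIMSEQ_const_iff)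
        then show ?thesis
          by (simp add: ip_eq_zero_iff)
      qed
      moreover have "0 \<in> M"
        using PM[of y] \<open>P y = 0\<close> by simp
      ultimately show False
        using ne by blast
    qed
    then have "(\<lambda>k. norm (\<alpha> k) * norm (P y) / norm (P y)) \<longlonglongrightarrow> 0"
      using * by (intro tendsto_divide_zero)
    then have "(\<lambda>k. norm (\<alpha> k) * (norm y * norm w)) \<longlonglongrightarrow> 0"
      using \<open>P y \<noteq> 0\<close> by (auto intro: tendsto_mult_left_zero)
    moreover have "norm (ip (sc (\<alpha> k) ((T ^^ n k) y)) w) \<le> norm (\<alpha> k) * (norm y * norm w)" for k
      using norm_ip_le[of "sc (\<alpha> k) ((T ^^ n k) y)" w] by (simp add: norm_sc mult.assoc)
    ultimately have "(\<lambda>k. ip (sc (\<alpha> k) ((T ^^ n k) y)) w) \<longlonglongrightarrow> 0"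
      using Lim_null_comparison by (metis (no_types, lifting) eventuallyI)
    then have "ip w w = 0"
      using lim LIMSEQ_unique by blast
    then show ?thesis
      by (simp add: ip_eq_zero_iff)
  qed
  have "x \<in> M" for x
    using w0[of "x - P x"] orth PM[of x] by simp
  then show ?thesis
    by blast
qed

end

subsection \<open>Weak quasistability\<close>

lemma liminf_norm_eq_zero:
  fixes a :: "nat \<Rightarrow> 'a::real_normed_vector"
  assumes "\<And>e N. 0 < e \<Longrightarrow> \<exists>n\<ge>N. norm (a n) < e"
  shows "liminf (\<lambda>n. ereal (norm (a n))) = 0"
proof (rule antisym)
  show "0 \<le> liminf (\<lambda>n. ereal (norm (a n)))"
    by (intro Liminf_bounded) simp
  show "liminf (\<lambda>n. ereal (norm (a n))) \<le> 0"
  proof (rule ccontr)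
    assume "\<not> ?thesis"
    then have "0 < liminf (\<lambda>n. ereal (norm (a n)))"
      by (simp only: not_le)
    then obtain c where c: "0 < ereal c" "ereal c < liminf (\<lambda>n. ereal (norm (a n)))"
      using ereal_dense2 by blast
    then have "eventually (\<lambda>n. ereal c < ereal (norm (a n))) sequentially"
      using less_LiminfD by blast
    then obtain N where "\<And>n. N \<le> n \<Longrightarrow> c < norm (a n)"
      unfolding eventually_sequentially by auto
    then show False
      using assms[of c N] c(1) by fastforce
  qed
qed

text \<open>Applied to squared norms of inner products along an orbit. Wiener's lemma delivers
  exactly these means, and \<open>closed_cesaro_null\<close> shows that the condition passes to sums
  and limits. The term at \<open>N = 0\<close> is \<open>0 / 0 = 0\<close>.\<close>

definition cesaro_null :: "(nat \<Rightarrow> real) \<Rightarrow> bool" where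
  "cesaro_null a \<longleftrightarrow> (\<lambda>N. (\<Sum>n<N. a n) / real N) \<longlonglongrightarrow> 0"

lemma cesaro_null_linear_combination:
  assumes "cesaro_null a" "cesaro_null b"
  shows "cesaro_null (\<lambda>n. c * a n + d * b n)"
proof -
  have "(\<lambda>N. c * ((\<Sum>n<N. a n) / real N) + d * ((\<Sum>n<N. b n) / real N)) \<longlonglongrightarrow> c * 0 + d * 0"
    using assms unfolding cesaro_null_def by (intro tendsto_intros)
  then show ?thesis
    unfolding cesaro_null_def by (simp add: sum.distrib sum_distrib_left add_divide_distrib)
qed

lemma cesaro_null_le:
  assumes b: "cesaro_null b" and le: "\<And>n. a n \<le> b n" and nonneg: "\<And>n. 0 \<le> a n"
  shows "cesaro_null a"
  unfolding cesaro_null_def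
proof (rule real_tendsto_sandwich[where f = "\<lambda>_. 0"])
  show "(\<lambda>N. (\<Sum>n<N. b n) / real N) \<longlonglongrightarrow> 0"
    using b unfolding cesaro_null_def .
  show "eventually (\<lambda>N. (\<Sum>n<N. a n) / real N \<le> (\<Sum>n<N. b n) / real N) sequentially"
    using le by (intro always_eventually allI divide_right_mono sum_mono) auto
  show "eventually (\<lambda>N. 0 \<le> (\<Sum>n<N. a n) / real N) sequentially"
    using nonneg by (intro always_eventually allI divide_nonneg_nonneg sum_nonneg) auto
qed simp

text \<open>The error \<open>e\<close> is uniform in \<open>n\<close>, so averaging does not enlarge
  it; this is what closedness in \<open>closed_cesaro_null\<close> rests on.\<close>

lemma cesaro_null_approx:
  assumes nonneg: "\<And>n. 0 \<le> a n"
    and approx: "\<And>e. 0 < e \<Longrightarrow> \<exists>b. cesaro_null b \<and> (\<forall>n. a n \<le> b n + e)"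
  shows "cesaro_null a"
  unfolding cesaro_null_def
proof (rule LIMSEQ_I)
  fix e :: real
  assume "0 < e"
  then obtain b where b: "cesaro_null b" "\<And>n. a n \<le> b n + e / 2"
    using approx[of "e / 2"] by auto
  obtain M where M: "\<And>N. M \<le> N \<Longrightarrow> norm ((\<Sum>n<N. b n) / real N) < e / 2"
    using LIMSEQ_D[OF b(1)[unfolded cesaro_null_def] half_gt_zero[OF \<open>0 < e\<close>]]
    unfolding diff_0_right by blast
  have "norm ((\<Sum>n<N. a n) / real N - 0) < e" if "M \<le> N" for N
  proof (cases "N = 0")
    case False
    have "(\<Sum>n<N. a n) \<le> (\<Sum>n<N. b n + e / 2)"
      using b(2) by (intro sum_mono)
    then have "(\<Sum>n<N. a n) / real N \<le> ((\<Sum>n<N. b n) + real N * (e / 2)) / real N"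
      by (intro divide_right_mono) (simp_all add: sum.distrib)
    also have "\<dots> = (\<Sum>n<N. b n) / real N + e / 2"
      using False by (simp add: add_divide_distrib)
    finally have "(\<Sum>n<N. a n) / real N < e"
      using M[OF that] unfolding real_norm_def by linarith
    moreover have "0 \<le> (\<Sum>n<N. a n) / real N"
      using nonneg by (simp add: sum_nonneg)
    ultimately show ?thesis
      by simp
  qed (use \<open>0 < e\<close> in simp)
  then show "\<exists>M. \<forall>N\<ge>M. norm ((\<Sum>n<N. a n) / real N - 0) < e"
    by blast
qed

text \<open>Prepending one term adds \<open>a 0 / (N + 1)\<close> to the mean, and the larger
  denominator only helps because the terms are nonnegative.\<close>

lemma cesaro_null_Suc_imp:
  assumes nonneg: "\<And>n. 0 \<le> a n" and null: "cesaro_null (\<lambda>n. a (Suc n))"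
  shows "cesaro_null a"
  unfolding cesaro_null_def
proof (rule LIMSEQ_imp_Suc, rule real_tendsto_sandwich[where f = "\<lambda>_. 0"])
  have "(\<lambda>N. a 0 * inverse (real (Suc N)) + (\<Sum>n<N. a (Suc n)) / real N) \<longlonglongrightarrow> a 0 * 0 + 0"
    using null unfolding cesaro_null_def
    by (intro tendsto_intros LIMSEQ_inverse_real_of_nat)
  then show "(\<lambda>N. a 0 * inverse (real (Suc N)) + (\<Sum>n<N. a (Suc n)) / real N) \<longlonglongrightarrow> 0"
    by simp
  have "(\<Sum>n<N. a (Suc n)) / real (Suc N) \<le> (\<Sum>n<N. a (Suc n)) / real N" for N
    using nonneg by (cases "N = 0") (auto intro!: divide_left_mono sum_nonneg)
  then have "(\<Sum>n<Suc N. a n) / real (Suc N) \<le> a 0 * inverse (real (Suc N)) + (\<Sum>n<N. a (Suc n)) / real N" for N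
    unfolding sum.lessThan_Suc_shift add_divide_distrib by (simp add: divide_inverse)
  then show "eventually (\<lambda>N. (\<Sum>n<Suc N. a n) / real (Suc N) \<le>
      a 0 * inverse (real (Suc N)) + (\<Sum>n<N. a (Suc n)) / real N) sequentially"
    by simp
  show "eventually (\<lambda>N. 0 \<le> (\<Sum>n<Suc N. a n) / real (Suc N)) sequentially"
    using nonneg by (intro always_eventually allI divide_nonneg_nonneg sum_nonneg) auto
qed simp

lemma cesaro_null_shift:
  assumes nonneg: "\<And>n. 0 \<le> a n" and null: "cesaro_null a"
  shows "cesaro_null (\<lambda>n. a (Suc n))"
proof -
  have "(\<lambda>N. (\<Sum>n<Suc N. a n) / real (Suc N) * 2) \<longlonglongrightarrow> 0 * 2"
    using null unfolding cesaro_null_def by (intro tendsto_intros LIMSEQ_Suc)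
  then have lim: "(\<lambda>N. (\<Sum>n<Suc N. a n) / real (Suc N) * 2) \<longlonglongrightarrow> 0"
    by simp
  show ?thesis
    unfolding cesaro_null_def
  proof (rule real_tendsto_sandwich[OF _ _ _ lim])
    \<comment> \<open>The factor 2 pays for the smaller denominator, as \<open>N + 1\<close> is at
      most \<open>2 * N\<close> once \<open>N\<close> is positive.\<close>
    have "(\<Sum>n<N. a (Suc n)) / real N \<le> (\<Sum>n<Suc N. a n) / real (Suc N) * 2" if "1 \<le> N" for N
    proof -
      define s where "s = (\<Sum>n<N. a (Suc n))"
      have "0 \<le> s"
        unfolding s_def using nonneg by (intro sum_nonneg) auto
      have "real (Suc N) \<le> 2 * real N"
        using that by simp
      then have "s * real (Suc N) \<le> s * (2 * real N)"
        using \<open>0 \<le> s\<close> by (intro mult_left_mono)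
      then have "s / real N \<le> 2 * s / real (Suc N)"
        using that by (simp add: field_simps)
      also have "\<dots> \<le> 2 * (a 0 + s) / real (Suc N)"
        using nonneg[of 0] by (intro divide_right_mono) auto
      finally show ?thesis
        unfolding sum.lessThan_Suc_shift s_def by (simp add: mult.commute)
    qed
    then show "eventually (\<lambda>N. (\<Sum>n<N. a (Suc n)) / real N \<le> (\<Sum>n<Suc N. a n) / real (Suc N) * 2) sequentially"
      unfolding eventually_sequentially by blast
    show "eventually (\<lambda>N. 0 \<le> (\<Sum>n<N. a (Suc n)) / real N) sequentially"
      using nonneg by (intro always_eventually allI divide_nonneg_nonneg sum_nonneg) auto
  qed simp
qed

text \<open>If all terms from \<open>N\<close> on were at least \<open>e\<close>, the first
  \<open>L\<close> terms would sum to at least \<open>e * (L - N)\<close>, and the means could not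
  tend to 0.\<close>

lemma cesaro_null_frequently_small:
  assumes nonneg: "\<And>n. 0 \<le> a n" and null: "cesaro_null a" and "0 < e"
  shows "\<exists>n\<ge>N. a n < e"
proof (rule ccontr)
  assume "\<not> ?thesis"
  then have ge: "e \<le> a n" if "N \<le> n" for n
    using that by (meson not_le)
  have "e - e * real N * inverse (real (Suc M)) \<le> (\<Sum>n<Suc M. a n) / real (Suc M)" for M
  proof -
    have "(\<Sum>n<L. e) - e * real N \<le> (\<Sum>n<L. a n)" for L
    proof (induction L)
      case (Suc L)
      show ?case
      proof (cases "N \<le> L")
        case True
        then show ?thesis
          using Suc.IH ge[OF True] by (simp add: distrib_right)
      next
        case False
        then have "(\<Sum>n<Suc L. e) \<le> e * real N"
          using \<open>0 < e\<close> by (simp add: mult.commute)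
        moreover have "0 \<le> (\<Sum>n<Suc L. a n)"
          using nonneg by (intro sum_nonneg)
        ultimately show ?thesis
          by linarith
      qed
    qed (use \<open>0 < e\<close> in simp)
    from this[of "Suc M"]
    have "(e * real (Suc M) - e * real N) / real (Suc M) \<le> (\<Sum>n<Suc M. a n) / real (Suc M)"
      by (intro divide_right_mono) (simp_all add: mult.commute)
    then show ?thesis
      by (simp only: diff_divide_distrib divide_inverse) (simp add: field_simps)
  qed
  moreover have "(\<lambda>M. e - e * real N * inverse (real (Suc M))) \<longlonglongrightarrow> e - e * real N * 0"
    by (intro tendsto_intros LIMSEQ_inverse_real_of_nat)
  moreover have "(\<lambda>M. (\<Sum>n<Suc M. a n) / real (Suc M)) \<longlonglongrightarrow> 0"
    using null unfolding cesaro_null_def by (rule LIMSEQ_Suc)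
  ultimately have "e \<le> 0"
    using LIMSEQ_le by fastforce
  then show False
    using \<open>0 < e\<close> by simp
qed

context scalar_hilbert_space
begin

text \<open>Homogeneity is demanded only for the norms, so that the lemma covers both arguments of
  the inner product, the linear one and the conjugate-linear one. Both parts rest on |a + b|^2 being
  at most 2|a|^2 + 2|b|^2.\<close>

lemma closed_cesaro_null:
  fixes b :: "nat \<Rightarrow> 'h \<Rightarrow> 'f"
  assumes add: "\<And>n x y. b n (x + y) = b n x + b n y"
    and sc: "\<And>n c x. norm (b n (sc c x)) = norm c * norm (b n x)"
    and bound: "\<And>n x. norm (b n x) \<le> K * norm x"
  shows "closed {x. cesaro_null (\<lambda>n. (norm (b n x))\<^sup>2)}" (is "closed ?Z")
    and "subspace {x. cesaro_null (\<lambda>n. (norm (b n x))\<^sup>2)}"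
proof -
  have sq: "(norm (b n (x + y)))\<^sup>2 \<le> 2 * (norm (b n x))\<^sup>2 + 2 * (norm (b n y))\<^sup>2" for n x y
  proof -
    have "(norm (b n (x + y)))\<^sup>2 \<le> (norm (b n x) + norm (b n y))\<^sup>2"
      unfolding add by (intro power_mono norm_triangle_ineq) simp
    also have "\<dots> \<le> 2 * (norm (b n x))\<^sup>2 + 2 * (norm (b n y))\<^sup>2"
      using sum_squares_bound[of "norm (b n x)" "norm (b n y)"] by (simp add: power2_sum)
    finally show ?thesis .
  qed
  show "subspace ?Z"
    unfolding subspace_def
  proof (intro conjI ballI allI)
    have "b n 0 = 0" for n
      using sc[of n 0 0] by simp
    then show "0 \<in> ?Z"
      by (simp add: cesaro_null_def)
    show "x + y \<in> ?Z" if "x \<in> ?Z" "y \<in> ?Z" for x y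
      using that cesaro_null_le[OF cesaro_null_linear_combination sq] by simp
    show "sc c x \<in> ?Z" if "x \<in> ?Z" for c x
      using that cesaro_null_linear_combination[of _ _ "(norm c)\<^sup>2" 0]
      by (fastforce simp: sc power_mult_distrib)
  qed
  show "closed ?Z"
    unfolding closed_sequential_limits
  proof (intro allI impI, elim conjE)
    fix X l
    assume X: "\<forall>k. X k \<in> ?Z" "X \<longlonglongrightarrow> l"
    have "cesaro_null (\<lambda>n. (norm (b n l))\<^sup>2)"
    proof (rule cesaro_null_approx)
      fix e :: real
      assume "0 < e"
      have "(\<lambda>k. 2 * (K * norm (l - X k))\<^sup>2) \<longlonglongrightarrow> 2 * (K * norm (l - l))\<^sup>2"
        using X(2) by (intro tendsto_intros)
      then have "eventually (\<lambda>k. 2 * (K * norm (l - X k))\<^sup>2 < e) sequentially"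
        using \<open>0 < e\<close> by (intro order_tendstoD(2)) auto
      then obtain k where k: "2 * (K * norm (l - X k))\<^sup>2 < e"
        using eventually_happens' sequentially_bot by blast
      have "(norm (b n l))\<^sup>2 \<le> (2 * (norm (b n (X k)))\<^sup>2 + 0 * (norm (b n (X k)))\<^sup>2) + e" for n
      proof -
        have "(norm (b n (l - X k)))\<^sup>2 \<le> (K * norm (l - X k))\<^sup>2"
          using bound by (intro power_mono) auto
        then show ?thesis
          using sq[of n "X k" "l - X k"] k by simp
      qed
      moreover have "cesaro_null (\<lambda>n. 2 * (norm (b n (X k)))\<^sup>2 + 0 * (norm (b n (X k)))\<^sup>2)"
        using X(1) by (intro cesaro_null_linear_combination) auto
      ultimately show "\<exists>c. cesaro_null c \<and> (\<forall>n. (norm (b n l))\<^sup>2 \<le> c n + e)"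
        by (intro exI conjI allI)
    qed simp
    then show "l \<in> ?Z"
      by simp
  qed
qed

end

context supercyclic_isometry
begin

text \<open>Cyclicity is used twice, for the right argument with \<open>y\<close> on the left and
  then for the left argument. Invariance is a shift of the sequence: applying \<open>T\<close> on
  the right delays it by one index, on the left it advances it.\<close>

lemma cesaro_null_orbit:
  assumes "cesaro_null (\<lambda>n. (norm (ip ((T ^^ n) y) y))\<^sup>2)"
  shows "cesaro_null (\<lambda>n. (norm (ip ((T ^^ n) x) z))\<^sup>2)"
proof -
  define Z where "Z = {z. cesaro_null (\<lambda>n. (norm (ip ((T ^^ n) y) z))\<^sup>2)}"
  have "norm (ip ((T ^^ n) y) z) \<le> norm y * norm z" for n z
    using norm_ip_le[of "(T ^^ n) y" z] by simp
  then have "closed Z" "subspace Z"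
    unfolding Z_def
    by (intro closed_cesaro_null[where K = "norm y"]; simp add: ip_add_right ip_sc_right norm_mult norm_cj)+
  moreover have "T z \<in> Z" if "z \<in> Z" for z
    using that cesaro_null_Suc_imp[of "\<lambda>n. (norm (ip ((T ^^ n) y) (T z)))\<^sup>2"]
    unfolding Z_def by simp
  moreover have "y \<in> Z"
    using assms by (simp add: Z_def)
  ultimately have Z: "Z = UNIV"
    by (rule cyclic)
  define X where "X = {x. cesaro_null (\<lambda>n. (norm (ip ((T ^^ n) x) z))\<^sup>2)}"
  have "norm (ip ((T ^^ n) x) z) \<le> norm z * norm x" for n x
    using norm_ip_le[of "(T ^^ n) x" z] by (simp add: mult.commute)
  then have "closed X" "subspace X"
    unfolding X_def
    by (intro closed_cesaro_null[where K = "norm z"];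
        simp add: pow_add pow_sc ip_add_left ip_sc_left norm_mult)+
  moreover have "T x \<in> X" if "x \<in> X" for x
    using that cesaro_null_shift[of "\<lambda>n. (norm (ip ((T ^^ n) x) z))\<^sup>2"]
    unfolding X_def by (simp add: funpow_swap1)
  moreover have "y \<in> X"
    using Z by (auto simp: X_def Z_def)
  ultimately have "X = UNIV"
    by (rule cyclic)
  then show ?thesis
    by (auto simp: X_def)
qed

lemma weakly_quasistable_if_cesaro_null:
  assumes "cesaro_null (\<lambda>n. (norm (ip ((T ^^ n) y) y))\<^sup>2)"
  shows "weakly_quasistable sc T"
  unfolding weakly_quasistable_def
proof (intro allI ballI liminf_norm_eq_zero)
  fix x f and e :: real and N
  assume "f \<in> dual sc" "0 < e"
  then obtain z where z: "\<And>x. f x = ip x z"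
    using riesz_representation by blast
  obtain n where n: "N \<le> n" "(norm (ip ((T ^^ n) x) z))\<^sup>2 < e\<^sup>2"
    using cesaro_null_frequently_small[OF _ cesaro_null_orbit[OF assms, of x z], where e = "e\<^sup>2" and N = N] \<open>0 < e\<close> by auto
  then show "\<exists>n\<ge>N. norm (f ((T ^^ n) x)) < e"
    using \<open>0 < e\<close> z power2_less_imp_less less_imp_le by metis
qed

lemma unitary_T: "unitary sc T"
  using isometry surj_T by (simp add: unitary_def)

end

section \<open>Recurrence and quasistability in a plane\<close>

context hilbert_isometry
begin

text \<open>The coordinates of the orbit are bounded, so two late iterates along a convergent
  subsequence are close; cancelling the smaller power, which is isometric, leaves a return of
  \<open>x\<close> to itself.\<close>

lemma plane_recurrence:
  assumes uv: "ip u v = 0" and plane: "\<And>x. \<exists>a b. x = sc a u + sc b v" and "0 < e"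
  shows "\<exists>p\<ge>N. norm ((T ^^ p) x - x) < e"
proof -
  define c where "c n = (ip ((T ^^ n) x) u / ip u u, ip ((T ^^ n) x) v / ip v v)" for n
  have "norm (c n) \<le> norm x * norm u / norm (ip u u) + norm x * norm v / norm (ip v v)" for n
  proof -
    have "norm (c n) \<le> norm (ip ((T ^^ n) x) u / ip u u) + norm (ip ((T ^^ n) x) v / ip v v)"
      unfolding c_def by (rule norm_Pair_le)
    also have "\<dots> \<le> norm x * norm u / norm (ip u u) + norm x * norm v / norm (ip v v)"
      unfolding norm_divide
      using norm_ip_le[of "(T ^^ n) x" u] norm_ip_le[of "(T ^^ n) x" v]
      by (intro add_mono divide_right_mono) auto
    finally show ?thesis .
  qed
  then have "bounded (range c)"
    unfolding bounded_iff by blast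
  then obtain l r where r: "strict_mono r" "(c \<circ> r) \<longlonglongrightarrow> l"
    using bounded_imp_convergent_subsequence by blast
  have exp: "(T ^^ n) x = sc (fst (c n)) u + sc (snd (c n)) v" for n
    using orthogonal_expansion[OF uv] plane[of "(T ^^ n) x"] unfolding c_def by auto
  have "(\<lambda>k. sc (fst ((c \<circ> r) k)) u + sc (snd ((c \<circ> r) k)) v) \<longlonglongrightarrow> sc (fst l) u + sc (snd l) v"
    by (intro tendsto_add tendsto_sc_left tendsto_fst tendsto_snd r(2))
  then have "(\<lambda>k. (T ^^ r k) x) \<longlonglongrightarrow> sc (fst l) u + sc (snd l) v"
    unfolding exp comp_def .
  then have "Cauchy (\<lambda>k. (T ^^ r k) x)"
    using convergent_Cauchy convergent_def by blast
  then obtain M where M: "\<And>m n. M \<le> m \<Longrightarrow> M \<le> n \<Longrightarrow> norm ((T ^^ r m) x - (T ^^ r n) x) < e"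
    using \<open>0 < e\<close> unfolding Cauchy_iff by blast
  \<comment> \<open>A strictly increasing index gains at least 1 per step, so the return time
    \<open>p\<close> is at least \<open>N\<close>.\<close>
  have "r M + N \<le> r (M + N)"
  proof (induction N)
    case (Suc N)
    have "r (M + N) < r (M + Suc N)"
      using r(1) by (simp add: strict_mono_Suc_iff)
    then show ?case
      using Suc by simp
  qed simp
  then obtain p where p: "r (M + N) = r M + p" "N \<le> p"
    by (metis add_le_cancel_left le_Suc_ex add.assoc le_add1)
  have "(T ^^ r M) ((T ^^ p) x - x) = (T ^^ r (M + N)) x - (T ^^ r M) x"
    by (simp add: pow_diff p(1) funpow_add)
  then have "norm ((T ^^ p) x - x) < e"
    using M[of "M + N" M] norm_pow[of "r M" "(T ^^ p) x - x"] by simp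
  then show ?thesis
    using p(2) by blast
qed

end

context supercyclic_isometry
begin

text \<open>Weak approximation of \<open>h\<close> by \<open>Z k\<close> is norm approximation in a
  plane; dividing by the scalar \<open>\<alpha> k\<close> brings the line of \<open>h\<close> close
  to the orbit itself.\<close>

lemma plane_orbit_approximates_line:
  assumes uv: "ip u v = 0" and plane: "\<And>x. \<exists>a b. x = sc a u + sc b v"
    and "h \<noteq> 0" "0 < d"
  shows "\<exists>m c. norm ((T ^^ m) y - sc c h) < d"
proof -
  obtain \<alpha> n where lim: "\<And>z. (\<lambda>k. ip (sc (\<alpha> k) ((T ^^ n k) y)) z) \<longlonglongrightarrow> ip h z"
    using orbit_converges_weakly[of h] by blast
  define Z where "Z k = sc (\<alpha> k) ((T ^^ n k) y)" for k
  have exp: "sc (ip x u / ip u u) u + sc (ip x v / ip v v) v = x" for x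
    using orthogonal_expansion[OF uv] plane[of x] by blast
  have "(\<lambda>k. sc (ip (Z k) u * inverse (ip u u)) u + sc (ip (Z k) v * inverse (ip v v)) v) \<longlonglongrightarrow>
      sc (ip h u * inverse (ip u u)) u + sc (ip h v * inverse (ip v v)) v"
    unfolding Z_def by (intro tendsto_add tendsto_sc_left tendsto_mult tendsto_const lim)
  then have Zh: "Z \<longlonglongrightarrow> h"
    unfolding exp divide_inverse[symmetric] .
  then have "(\<lambda>k. norm (Z k)) \<longlonglongrightarrow> norm h"
    by (rule tendsto_norm)
  then have "eventually (\<lambda>k. norm h / 2 < norm (Z k)) sequentially"
    using \<open>h \<noteq> 0\<close> by (intro order_tendstoD(1)) auto
  \<comment> \<open>The tolerance anticipates the division by \<open>\<alpha> k\<close>, whose norm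
    exceeds \<open>norm h / (2 * norm y)\<close> by the preceding bound.\<close>
  moreover have "eventually (\<lambda>k. norm (Z k - h) < d * norm h / (2 * norm y)) sequentially"
    using Zh \<open>0 < d\<close> \<open>h \<noteq> 0\<close> y_nonzero unfolding tendsto_iff dist_norm by simp
  ultimately have "eventually (\<lambda>k. norm h / 2 < norm (Z k) \<and> norm (Z k - h) < d * norm h / (2 * norm y)) sequentially"
    by (rule eventually_conj)
  then obtain k where k: "norm h / 2 < norm (\<alpha> k) * norm y" "norm (Z k - h) < d * norm h / (2 * norm y)"
    unfolding Z_def norm_sc norm_pow using eventually_happens' sequentially_bot by blast
  have a0: "\<alpha> k \<noteq> 0"
    using k(1) \<open>h \<noteq> 0\<close> by auto
  have "norm (\<alpha> k) * norm ((T ^^ n k) y - sc (inverse (\<alpha> k)) h) = norm (Z k - h)"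
    unfolding norm_sc[symmetric] Z_def scale_right_diff_distrib using a0 by simp
  also have "\<dots> < d * (norm h / 2) / norm y"
    using k(2) by (simp add: field_simps)
  also have "\<dots> \<le> d * norm (\<alpha> k)"
    using k(1) \<open>0 < d\<close> y_nonzero mult_left_mono[of "norm h / 2" "norm (\<alpha> k) * norm y" d]
    by (simp add: pos_divide_le_eq mult.assoc)
  finally have "norm ((T ^^ n k) y - sc (inverse (\<alpha> k)) h) < d"
    using a0 by (simp add: mult.commute)
  then show ?thesis
    by blast
qed

text \<open>The orbit of \<open>y\<close> comes close to the line of \<open>x\<close> at time
  \<open>i\<close> and to the line of some \<open>w\<close> orthogonal to \<open>z\<close> at time
  \<open>j\<close>. A late return time \<open>p\<close> closes the loop: after
  \<open>p - i + j\<close> steps a multiple of \<open>x\<close> is near the line of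
  \<open>w\<close>, hence nearly orthogonal to \<open>z\<close>.\<close>

lemma weakly_quasistable_plane:
  assumes uv: "ip u v = 0" and plane: "\<And>x. \<exists>a b. x = sc a u + sc b v"
  shows "weakly_quasistable sc T"
  unfolding weakly_quasistable_def
proof (intro allI ballI liminf_norm_eq_zero)
  fix x f and e :: real and N
  assume "f \<in> dual sc" and e: "0 < e"
  then obtain z where z: "\<And>x. f x = ip x z"
    using riesz_representation by blast
  have "\<exists>n\<ge>N. norm (ip ((T ^^ n) x) z) < e"
  proof (cases "x = 0 \<or> z = 0")
    case True
    then have "ip ((T ^^ N) x) z = 0"
      by (auto simp: pow_zero)
    then show ?thesis
      using e by auto
  next
    case False
    obtain w where w: "w \<noteq> 0" "ip w z = 0"
    proof (rule ccontr)
      assume no: "\<not> thesis"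
      have "h = sc (ip h z / ip z z) z" for h
      proof -
        have "ip (h - sc (ip h z / ip z z) z) z = 0"
          using False by (simp add: ip_diff_left ip_sc_left ip_eq_zero_iff)
        then have "h - sc (ip h z / ip z z) z = 0"
          using no that by blast
        then show ?thesis
          by simp
      qed
      then show False
        using not_dim_gt_one_line dim_gt_one by blast
    qed
    \<comment> \<open>Three errors of size \<open>d\<close> arise. The first bound keeps
      \<open>norm c * norm x\<close> above \<open>norm y / 2\<close>; the second, with its 12, makes
      the final estimate \<open>e / 2\<close>.\<close>
    define d where "d = min (norm y / 2) (e * norm y / (12 * norm z * norm x))"
    have d: "0 < d" "d \<le> norm y / 2" "d \<le> e * norm y / (12 * norm z * norm x)"
      unfolding d_def using False e y_nonzero by auto
    obtain i c where c: "norm ((T ^^ i) y - sc c x) < d"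
      using plane_orbit_approximates_line[OF uv plane _ d(1), of x] False by blast
    obtain j b where b: "norm ((T ^^ j) y - sc b w) < d"
      using plane_orbit_approximates_line[OF uv plane w(1) d(1)] by blast
    obtain p where p: "i + N \<le> p" "norm ((T ^^ p) y - y) < d"
      using plane_recurrence[OF uv plane d(1)] by blast
    define n where "n = (p - i) + j"
    have ni: "n + i = j + p"
      using p(1) by (simp add: n_def)
    \<comment> \<open>The three errors: replacing the multiple of \<open>x\<close> by the orbit
      point at time \<open>i\<close>, the return at time \<open>p\<close>, and the approach to the
      line of \<open>w\<close>. Powers of \<open>T\<close> do not enlarge them.\<close>
    define A B C where "A = (T ^^ n) (sc c x - (T ^^ i) y)" and "B = (T ^^ j) ((T ^^ p) y - y)"
      and "C = (T ^^ j) y - sc b w"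
    have "(T ^^ n) ((T ^^ i) y) = (T ^^ j) ((T ^^ p) y)"
      using ni by (metis comp_apply funpow_add)
    then have "sc c ((T ^^ n) x) = A + B + C + sc b w"
      unfolding A_def B_def C_def by (simp add: pow_diff pow_sc)
    then have "ip (sc c ((T ^^ n) x)) z = ip (A + B + C) z"
      by (simp add: ip_add_left ip_sc_left w(2))
    then have "norm (ip (sc c ((T ^^ n) x)) z) \<le> norm (A + B + C) * norm z"
      by (simp only: norm_ip_le)
    then have "norm c * norm (ip ((T ^^ n) x) z) \<le> norm (A + B + C) * norm z"
      unfolding ip_sc_left norm_mult .
    also have "norm (A + B + C) \<le> 3 * d"
    proof -
      have "norm A < d" "norm B < d" "norm C < d"
        using c b p(2) unfolding A_def B_def C_def norm_pow by (simp_all add: norm_minus_commute)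
      then show ?thesis
        using norm_triangle_ineq[of "A + B" C] norm_triangle_ineq[of A B] by linarith
    qed
    finally have le: "norm c * norm (ip ((T ^^ n) x) z) \<le> 3 * d * norm z"
      by (simp add: mult_right_mono)
    have "norm y - norm c * norm x \<le> norm ((T ^^ i) y - sc c x)"
      using norm_triangle_ineq2[of "(T ^^ i) y" "sc c x"] by (simp add: norm_sc)
    then have cx: "norm y / 2 \<le> norm c * norm x"
      using c d(2) by linarith
    have "norm y / 2 * norm (ip ((T ^^ n) x) z) \<le> norm c * norm x * norm (ip ((T ^^ n) x) z)"
      using cx by (rule mult_right_mono) simp
    also have "\<dots> \<le> 3 * d * norm z * norm x"
      using mult_right_mono[OF le, of "norm x"] by (simp add: algebra_simps)
    also have "\<dots> \<le> 3 * (e * norm y / (12 * norm z * norm x)) * norm z * norm x"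
      using d(3) by (intro mult_right_mono mult_left_mono) auto
    also have "\<dots> = norm y / 2 * (e / 2)"
      using False by (simp add: field_simps)
    finally have "norm (ip ((T ^^ n) x) z) \<le> e / 2"
      using y_nonzero by simp
    then have "norm (ip ((T ^^ n) x) z) < e"
      using e by linarith
    moreover have "N \<le> n"
      using p(1) by (simp add: n_def)
    ultimately show ?thesis
      by blast
  qed
  then show "\<exists>n\<ge>N. norm (f ((T ^^ n) x)) < e"
    by (simp add: z)
qed

end

subsection \<open>Herglotz' theorem\<close>

sublocale complex_hilbert_space \<subseteq> scalar_hilbert_space scaleC cinner cnj
proof
  show "complex_of_real r *\<^sub>C x = r *\<^sub>R x" for r x
    by (rule scaleC_of_real)
  show "a * cnj a = complex_of_real ((norm a)\<^sup>2)" for a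
    by (rule complex_norm_square[symmetric])
qed (rule cinner_commute cinner_add_left cinner_scaleC_left cinner_self complex_cnj_add complex_cnj_mult)+

lemma sets_circle_borel: "A \<in> sets circle_borel \<longleftrightarrow> A \<in> sets borel \<and> A \<subseteq> sphere 0 1"
  by (auto simp: circle_borel_def sets_restrict_space_iff)

lemma space_circle_borel [simp]: "space circle_borel = sphere 0 1"
  by (simp add: circle_borel_def space_restrict_space)

lemma measurable_circle_borel: "f \<in> borel_measurable borel \<Longrightarrow> f \<in> borel_measurable circle_borel"
  unfolding circle_borel_def by (rule measurable_restrict_space1)

lemma measurable_cis_circle [measurable]: "(\<lambda>t. cis (2 * pi * t)) \<in> borel \<rightarrow>\<^sub>M circle_borel"
  unfolding circle_borel_def
proof (rule measurable_restrict_space2)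
  show "(\<lambda>t. cis (2 * pi * t)) \<in> borel_measurable borel"
    by (intro borel_measurable_continuous_onI continuous_intros)
qed simp

lemma integrable_cis: "integrable lborel (\<lambda>t. indicator {0..1} t *\<^sub>R cis (2 * pi * of_int i * t))"
  by (intro borel_integrable_compact continuous_intros) simp

lemma integral_cis:
  "(\<integral>t. indicator {0..1} t *\<^sub>R cis (2 * pi * of_int i * t) \<partial>lborel) = (if i = 0 then 1 else 0)"
proof (cases "i = 0")
  case False
  define F where "F t = cis (2 * pi * of_int i * t) / (\<i> * of_real (2 * pi * of_int i))" for t
  have ne: "\<i> * complex_of_real (2 * pi * of_int i) \<noteq> 0"
    using False by simp
  have "(F has_vector_derivative cis (2 * pi * of_int i * t)) (at t within {0..1})" for t
  proof -
    have "((\<lambda>t. cis (2 * pi * of_int i * t)) has_vector_derivative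
        (2 * pi * of_int i) *\<^sub>R (\<i> * cis (2 * pi * of_int i * t))) (at t within {0..1})"
      unfolding has_vector_derivative_def
      by (rule has_derivative_eq_rhs) (auto intro!: derivative_eq_intros simp: scaleR_conv_of_real algebra_simps fun_eq_iff)
    then have "(F has_vector_derivative
        ((2 * pi * of_int i) *\<^sub>R (\<i> * cis (2 * pi * of_int i * t))) / (\<i> * of_real (2 * pi * of_int i))) (at t within {0..1})"
      unfolding F_def by (rule has_vector_derivative_divide)
    then show ?thesis
      using False by (simp add: scaleR_conv_of_real)
  qed
  then have "(\<integral>t. indicator {0..1} t *\<^sub>R cis (2 * pi * of_int i * t) \<partial>lborel) = F 1 - F 0"
    by (intro integral_FTC_Icc continuous_intros) auto
  also have "F 1 - F 0 = 0"
    unfolding F_def using cis_multiple_2pi[of "of_int i"] by simp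
  finally show ?thesis
    using False by simp
qed simp

locale complex_isometry = complex_hilbert_space + hilbert_isometry scaleC cinner cnj
begin

text \<open>A squared norm that is at the same time a trigonometric polynomial in the correlations
  of the orbit: the Fejer densities built from it are nonnegative by construction.\<close>

lemma trigonometric_sum_norm:
  "complex_of_real ((norm (\<Sum>k<L. cis (- (2 * pi * real k * t)) *\<^sub>C (T ^^ k) x))\<^sup>2) =
     (\<Sum>k<L. \<Sum>j<L. cinner ((T ^^ k) x) ((T ^^ j) x) * cis (2 * pi * of_int (int j - int k) * t))"
proof -
  have "cinner (cis (- (2 * pi * real k * t)) *\<^sub>C u) (cis (- (2 * pi * real j * t)) *\<^sub>C w) =
      cinner u w * cis (2 * pi * of_int (int j - int k) * t)" for k j u w
  proof -
    have "cis (- (2 * pi * real k * t)) * cnj (cis (- (2 * pi * real j * t))) =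
        cis (2 * pi * of_int (int j - int k) * t)"
      by (simp add: cis_cnj cis_mult left_diff_distrib right_diff_distrib)
    then show ?thesis
      unfolding ip_sc_left ip_sc_right mult.assoc[symmetric] by (simp only: mult.commute)
  qed
  then show ?thesis
    unfolding cinner_self[symmetric] bounded_bilinear.sum_left[OF bounded_bilinear_ip]
      bounded_bilinear.sum_right[OF bounded_bilinear_ip]
    by (subst sum.swap) simp
qed

text \<open>Orthogonality of the characters keeps only the pairs \<open>k = j + n\<close>; each
  contributes the same inner product because \<open>T\<close> is isometric. There are
  \<open>L - n\<close> of them, the truncated subtraction giving 0 once \<open>n\<close> reaches
  \<open>L\<close>.\<close>

lemma integral_trigonometric_sum:
  fixes x L n
  defines "f \<equiv> \<lambda>t. (norm (\<Sum>k<L. cis (- (2 * pi * real k * t)) *\<^sub>C (T ^^ k) x))\<^sup>2"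
  shows "integrable lborel (\<lambda>t. indicator {0..1} t *\<^sub>R (f t *\<^sub>R cis (2 * pi * real n * t)))"
    and "(\<integral>t. indicator {0..1} t *\<^sub>R (f t *\<^sub>R cis (2 * pi * real n * t)) \<partial>lborel) =
      of_nat (L - n) * cinner ((T ^^ n) x) x"
proof -
  define a where "a k j = cinner ((T ^^ k) x) ((T ^^ j) x)" for k j
  have eq: "indicator {0..1} t *\<^sub>R (f t *\<^sub>R cis (2 * pi * real n * t)) =
      (\<Sum>k<L. \<Sum>j<L. a k j * (indicator {0..1} t *\<^sub>R cis (2 * pi * of_int (int j - int k + int n) * t)))" for t
  proof -
    have "f t *\<^sub>R cis (2 * pi * real n * t) =
        (\<Sum>k<L. \<Sum>j<L. a k j * cis (2 * pi * of_int (int j - int k) * t)) * cis (2 * pi * real n * t)"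
      unfolding f_def scaleR_conv_of_real trigonometric_sum_norm a_def ..
    also have "\<dots> = (\<Sum>k<L. \<Sum>j<L. a k j * cis (2 * pi * of_int (int j - int k + int n) * t))"
      unfolding sum_distrib_right by (intro sum.cong refl) (simp add: cis_mult algebra_simps)
    finally show ?thesis
      by (simp add: scaleR_conv_of_real sum_distrib_left mult.left_commute)
  qed
  show "integrable lborel (\<lambda>t. indicator {0..1} t *\<^sub>R (f t *\<^sub>R cis (2 * pi * real n * t)))"
    unfolding eq by (intro Bochner_Integration.integrable_sum integrable_mult_right integrable_cis)
  have "(\<integral>t. indicator {0..1} t *\<^sub>R (f t *\<^sub>R cis (2 * pi * real n * t)) \<partial>lborel) =
      (\<Sum>k<L. \<Sum>j<L. a k j * (if int j - int k + int n = 0 then 1 else 0))"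
    unfolding eq
    by (simp only: Bochner_Integration.integral_sum Bochner_Integration.integrable_sum
        integrable_mult_right integrable_cis integral_mult_right_zero integral_cis)
  also have "\<dots> = (\<Sum>j<L. \<Sum>k<L. if k = j + n then a k j else 0)"
    by (subst sum.swap, intro sum.cong refl) auto
  also have "\<dots> = (\<Sum>j<L. if j + n < L then cinner ((T ^^ n) x) x else 0)"
    by (intro sum.cong refl) (simp add: a_def funpow_add)
  also have "\<dots> = (\<Sum>j\<in>{j \<in> {..<L}. j + n < L}. cinner ((T ^^ n) x) x)"
    by (rule sum.inter_filter[symmetric]) simp
  also have "{j \<in> {..<L}. j + n < L} = {..<L - n}"
    by auto
  also have "(\<Sum>j<L - n. cinner ((T ^^ n) x) x) = of_nat (L - n) * cinner ((T ^^ n) x) x"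
    by simp
  finally show "(\<integral>t. indicator {0..1} t *\<^sub>R (f t *\<^sub>R cis (2 * pi * real n * t)) \<partial>lborel) =
      of_nat (L - n) * cinner ((T ^^ n) x) x" .
qed

text \<open>The measure is a weak subsequential limit of the Fejer densities.\<close>

lemma herglotz_interval:
  assumes "x \<noteq> 0"
  shows "\<exists>M. real_distribution M \<and>
    (\<forall>n. (\<integral>t. cis (2 * pi * real n * t) \<partial>M) = cinner ((T ^^ n) x) x / of_real ((norm x)\<^sup>2))"
proof -
  define f where "f N t = (norm (\<Sum>k<Suc N. cis (- (2 * pi * real k * t)) *\<^sub>C (T ^^ k) x))\<^sup>2" for N t
  \<comment> \<open>Divided by the integral of \<open>f N\<close> over the unit interval, so that
    each \<open>\<nu> N\<close> is a probability measure and the tightness theorem applies.\<close>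
  define d where "d N t = indicator {0..1} t * (f N t / (real (Suc N) * (norm x)\<^sup>2))" for N :: nat and t :: real
  define \<nu> where "\<nu> N = density lborel (\<lambda>t. ennreal (d N t))" for N
  have nonneg: "0 \<le> d N t" for N t
    by (simp add: d_def f_def)
  have "continuous_on UNIV (f N)" for N
  proof -
    have "continuous_on UNIV (\<lambda>t. cis (- (2 * pi * real k * t)) *\<^sub>C (T ^^ k) x)" for k
      by (intro bounded_linear.continuous_on[OF bounded_linear_sc_left] continuous_intros)
    then show ?thesis
      unfolding f_def by (intro continuous_intros)
  qed
  then have [measurable]: "f N \<in> borel_measurable borel" for N
    by (rule borel_measurable_continuous_onI)
  have d_meas [measurable]: "d N \<in> borel_measurable borel" for N
    unfolding d_def by measurable
  have d_cis: "d N t *\<^sub>R cis (2 * pi * real n * t) =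
      (indicator {0..1} t *\<^sub>R (f N t *\<^sub>R cis (2 * pi * real n * t))) / of_real (real (Suc N) * (norm x)\<^sup>2)" for N n t
    by (simp add: d_def scaleR_conv_of_real)
  have cis_meas [measurable]: "(\<lambda>t. cis (2 * pi * real n * t)) \<in> borel_measurable borel" for n
    by (intro borel_measurable_continuous_onI continuous_intros)
  have int_d: "integrable lborel (\<lambda>t. d N t *\<^sub>R cis (2 * pi * real n * t))" for N n
    unfolding d_cis using integral_trigonometric_sum(1)[where L = "Suc N"] unfolding f_def by simp
  have int_\<nu>: "(\<integral>t. cis (2 * pi * real n * t) \<partial>\<nu> N) =
      of_nat (Suc N - n) / of_nat (Suc N) * (cinner ((T ^^ n) x) x / of_real ((norm x)\<^sup>2))" for N n
  proof -
    have "(\<integral>t. cis (2 * pi * real n * t) \<partial>\<nu> N) = (\<integral>t. d N t *\<^sub>R cis (2 * pi * real n * t) \<partial>lborel)"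
      unfolding \<nu>_def by (intro integral_density) (auto simp: nonneg)
    also have "\<dots> = of_nat (Suc N - n) * cinner ((T ^^ n) x) x / of_real (real (Suc N) * (norm x)\<^sup>2)"
      unfolding d_cis using integral_trigonometric_sum(2)[where L = "Suc N"] unfolding f_def by simp
    finally show ?thesis
      by simp
  qed
  have dist: "real_distribution (\<nu> N)" for N
  proof -
    have "complex_of_real (\<integral>t. d N t \<partial>lborel) = (\<integral>t. d N t *\<^sub>R cis (2 * pi * real 0 * t) \<partial>lborel)"
      by (simp add: scaleR_conv_of_real)
    also have "\<dots> = (\<integral>t. cis (2 * pi * real 0 * t) \<partial>\<nu> N)"
      unfolding \<nu>_def by (intro integral_density[symmetric]) (auto simp: nonneg)
    also have "\<dots> = of_real 1"
      unfolding int_\<nu> using assms by (simp add: cinner_self del: of_nat_Suc)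
    finally have one: "(\<integral>t. d N t \<partial>lborel) = 1"
      by (simp only: of_real_eq_iff)
    have "integrable lborel (\<lambda>t. d N t)"
      using integrable_Re[OF int_d[of N 0]] by simp
    then have "(\<integral>\<^sup>+t. ennreal (d N t) \<partial>lborel) = 1"
      using nn_integral_eq_integral[of lborel "d N"] nonneg one by simp
    then have "prob_space (\<nu> N)"
      unfolding \<nu>_def by (intro prob_spaceI) (simp add: emeasure_density)
    then show ?thesis
      unfolding real_distribution_def real_distribution_axioms_def by (simp add: \<nu>_def)
  qed
  have "tight \<nu>"
    unfolding tight_def
  proof (intro conjI allI impI dist)
    fix e :: real
    assume "0 < e"
    \<comment> \<open>Tightness speaks of half-open intervals; starting at -1 keeps the endpoint 0
      of the support inside.\<close>
    have "measure (\<nu> N) {-1<..1} = 1" for N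
    proof -
      interpret real_distribution "\<nu> N"
        by (rule dist)
      have "emeasure (\<nu> N) (- {-1<..1}) = (\<integral>\<^sup>+t. ennreal (d N t) * indicator (- {-1<..1}) t \<partial>lborel)"
        unfolding \<nu>_def by (intro emeasure_density) auto
      also have "\<dots> = (\<integral>\<^sup>+(t :: real). 0 \<partial>lborel)"
        by (intro nn_integral_cong) (auto simp: d_def indicator_def)
      finally have "prob (space (\<nu> N) - {-1<..1}) = 0"
        by (simp add: measure_def Compl_eq_Diff_UNIV)
      then show ?thesis
        by (subst (asm) prob_compl) auto
    qed
    then show "\<exists>a b. a < b \<and> (\<forall>n. 1 - e < measure (\<nu> n) {a<..b})"
      using \<open>0 < e\<close> by (intro exI[of _ "-1"] exI[of _ 1]) auto
  qed
  then obtain r M where r: "strict_mono r" and M: "real_distribution M"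
    and weak: "weak_conv_m (\<nu> \<circ> id \<circ> r) M"
    using tight_imp_convergent_subsubsequence[of \<nu> id] by (auto simp: strict_mono_def)
  have "(\<integral>t. cis (2 * pi * real n * t) \<partial>M) = cinner ((T ^^ n) x) x / of_real ((norm x)\<^sup>2)" for n
  proof (rule LIMSEQ_unique)
    let ?c = "cinner ((T ^^ n) x) x / of_real ((norm x)\<^sup>2)"
    show "(\<lambda>k. \<integral>t. cis (2 * pi * real n * t) \<partial>(\<nu> \<circ> id \<circ> r) k) \<longlonglongrightarrow> (\<integral>t. cis (2 * pi * real n * t) \<partial>M)"
    proof (rule weak_conv_imp_integral_bdd_continuous_conv[OF _ M weak])
      have "continuous_on UNIV (\<lambda>t. cis (2 * pi * real n * t))"
        by (intro continuous_intros)
      then show "isCont (\<lambda>t. cis (2 * pi * real n * t)) t" for t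
        by (simp add: continuous_on_eq_continuous_at)
      show "norm (cis (2 * pi * real n * t)) \<le> 1" for t
        by simp
    qed (simp add: dist)
    \<comment> \<open>The Fejer factor \<open>(Suc N - n) / Suc N\<close> tends to 1 for fixed
      \<open>n\<close>, so the correct moments appear in the limit.\<close>
    have "(\<lambda>N. complex_of_real (1 - real n * inverse (real (Suc N))) * ?c) \<longlonglongrightarrow> complex_of_real (1 - real n * 0) * ?c"
      by (intro tendsto_intros LIMSEQ_inverse_real_of_nat)
    moreover have "complex_of_real (1 - real n * inverse (real (Suc N))) * ?c = (\<integral>t. cis (2 * pi * real n * t) \<partial>\<nu> N)"
      if "n \<le> N" for N
    proof -
      have "real (Suc N - n) / real (Suc N) = 1 - real n * inverse (real (Suc N))"
        using that by (simp add: field_simps of_nat_diff)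
      then have "of_nat (Suc N - n) / of_nat (Suc N) = complex_of_real (1 - real n * inverse (real (Suc N)))"
        by (metis of_real_divide of_real_of_nat_eq)
      then show ?thesis
        unfolding int_\<nu> by simp
    qed
    then have "eventually (\<lambda>N. complex_of_real (1 - real n * inverse (real (Suc N))) * ?c =
        (\<integral>t. cis (2 * pi * real n * t) \<partial>\<nu> N)) sequentially"
      unfolding eventually_sequentially by blast
    ultimately have "(\<lambda>N. \<integral>t. cis (2 * pi * real n * t) \<partial>\<nu> N) \<longlonglongrightarrow> complex_of_real (1 - real n * 0) * ?c"
      by (rule Lim_transform_eventually)
    then have "(\<lambda>N. \<integral>t. cis (2 * pi * real n * t) \<partial>\<nu> N) \<longlonglongrightarrow> ?c"
      by simp
    then show "(\<lambda>k. \<integral>t. cis (2 * pi * real n * t) \<partial>(\<nu> \<circ> id \<circ> r) k) \<longlonglongrightarrow> ?c"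
      using LIMSEQ_subseq_LIMSEQ[OF _ r] by (auto simp: comp_def)
  qed
  then show ?thesis
    using M by blast
qed

text \<open>The probability measure from the interval is multiplied by the squared norm of
  \<open>x\<close> and pushed forward to the circle; \<open>x = 0\<close> is the null
  measure.\<close>

lemma herglotz_nonneg_powers:
  "\<exists>\<mu>. finite_measure \<mu> \<and> sets \<mu> = sets circle_borel \<and>
    (\<forall>n. (\<integral>z. z ^ n \<partial>\<mu>) = cinner ((T ^^ n) x) x)"
proof (cases "x = 0")
  case True
  then show ?thesis
    by (intro exI[of _ "null_measure circle_borel"]) (auto intro!: finite_measureI)
next
  case False
  obtain M where "real_distribution M"
    and M: "\<And>n. (\<integral>t. cis (2 * pi * real n * t) \<partial>M) = cinner ((T ^^ n) x) x / of_real ((norm x)\<^sup>2)"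
    using herglotz_interval[OF False] by blast
  then interpret M: real_distribution M
    by simp
  define N where "N = density M (\<lambda>_. ennreal ((norm x)\<^sup>2))"
  define \<mu> where "\<mu> = distr N circle_borel (\<lambda>t. cis (2 * pi * t))"
  have "emeasure N UNIV = ennreal ((norm x)\<^sup>2)"
    using M.emeasure_space_1 by (simp add: N_def emeasure_density)
  then interpret N: finite_measure N
    by (intro finite_measureI) (simp add: N_def)
  have cis_N: "(\<lambda>t. cis (2 * pi * t)) \<in> N \<rightarrow>\<^sub>M circle_borel"
    using measurable_cis_circle by (simp add: N_def cong: measurable_cong_sets)
  have "(\<integral>z. z ^ n \<partial>\<mu>) = cinner ((T ^^ n) x) x" for n
  proof -
    have "(\<integral>z. z ^ n \<partial>\<mu>) = (\<integral>t. cis (2 * pi * t) ^ n \<partial>N)"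
      unfolding \<mu>_def by (intro integral_distr cis_N measurable_circle_borel) measurable
    also have "\<dots> = (\<integral>t. cis (2 * pi * real n * t) \<partial>N)"
      unfolding Complex.DeMoivre by (simp add: mult_ac)
    also have "\<dots> = (\<integral>t. (norm x)\<^sup>2 *\<^sub>R cis (2 * pi * real n * t) \<partial>M)"
      unfolding N_def
      by (intro integral_density) (auto intro!: borel_measurable_continuous_onI continuous_intros cong: measurable_cong_sets)
    also have "\<dots> = cinner ((T ^^ n) x) x"
      using False by (simp add: M scaleR_conv_of_real)
    finally show ?thesis .
  qed
  moreover have "finite_measure \<mu>"
    unfolding \<mu>_def using cis_N by (rule N.finite_measure_distr)
  ultimately show ?thesis
    by (intro exI[of _ \<mu>]) (simp add: \<mu>_def)
qed

text \<open>On the circle \<open>z * cnj z = 1\<close>, so a mixed moment reduces to a pure power,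
  matching \<open>ip_pow\<close>; the case \<open>m < n\<close> is the complex conjugate.\<close>

lemma herglotz:
  "\<exists>\<mu>. finite_measure \<mu> \<and> sets \<mu> = sets circle_borel \<and>
    (\<forall>m n. (\<integral>z. z ^ m * cnj z ^ n \<partial>\<mu>) = cinner ((T ^^ m) x) ((T ^^ n) x))"
proof -
  obtain \<mu> where \<mu>: "finite_measure \<mu>" "sets \<mu> = sets circle_borel"
    and pow: "\<And>n. (\<integral>z. z ^ n \<partial>\<mu>) = cinner ((T ^^ n) x) x"
    using herglotz_nonneg_powers[of x] by blast
  have space: "space \<mu> = sphere 0 1"
    using sets_eq_imp_space_eq[OF \<mu>(2)] by simp
  have ge: "(\<integral>z. z ^ m * cnj z ^ n \<partial>\<mu>) = cinner ((T ^^ m) x) ((T ^^ n) x)" if nm: "n \<le> m" for m n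
  proof -
    obtain k where k: "m = n + k"
      using nm le_Suc_ex by blast
    have "z ^ m * cnj z ^ n = z ^ k" if "z \<in> space \<mu>" for z
    proof -
      have "z * cnj z = 1"
        using that by (simp add: space flip: complex_norm_square)
      then have "(z * cnj z) ^ n * z ^ k = z ^ k"
        by simp
      then show ?thesis
        unfolding k power_mult_distrib power_add by (simp add: mult_ac)
    qed
    then have "(\<integral>z. z ^ m * cnj z ^ n \<partial>\<mu>) = (\<integral>z. z ^ k \<partial>\<mu>)"
      by (intro Bochner_Integration.integral_cong) auto
    then show ?thesis
      by (simp add: pow k funpow_add)
  qed
  have "(\<integral>z. z ^ m * cnj z ^ n \<partial>\<mu>) = cinner ((T ^^ m) x) ((T ^^ n) x)" for m n
  proof (cases "n \<le> m")
    case False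
    have "(\<integral>z. z ^ m * cnj z ^ n \<partial>\<mu>) = (\<integral>z. cnj (z ^ n * cnj z ^ m) \<partial>\<mu>)"
      by (simp add: mult.commute)
    also have "\<dots> = cnj (\<integral>z. z ^ n * cnj z ^ m \<partial>\<mu>)"
      by (rule Bochner_Integration.integral_cnj)
    also have "\<dots> = cinner ((T ^^ m) x) ((T ^^ n) x)"
      using False ge[of m n] cinner_commute[of "(T ^^ m) x"] by simp
    finally show ?thesis .
  qed (rule ge)
  then show ?thesis
    using \<mu> by blast
qed

end

subsection \<open>Borel functional calculus\<close>

locale complex_unitary = complex_isometry +
  assumes surj_T: "surj T"
begin

definition Ti :: "'a \<Rightarrow> 'a" where
  "Ti = inv T"

lemma T_Ti [simp]: "T (Ti x) = x"
  by (simp add: Ti_def surj_T surj_f_inv_f)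

lemma T_eq_iff: "T x = T y \<longleftrightarrow> x = y"
  using norm_T[of "x - y"] by (auto simp: T_diff)

lemma Ti_T [simp]: "Ti (T x) = x"
  using T_Ti[of "T x"] by (simp only: T_eq_iff)

lemma Ti_add: "Ti (x + y) = Ti x + Ti y"
  by (metis T_Ti T_add T_eq_iff)

lemma Ti_sc: "Ti (c *\<^sub>C x) = c *\<^sub>C Ti x"
  by (metis T_Ti T_sc T_eq_iff)

lemma cinner_T_Ti: "cinner (T x) y = cinner x (Ti y)"
  by (metis T_Ti ip_T)

lemma tendsto_T: "X \<longlonglongrightarrow> l \<Longrightarrow> (\<lambda>n. T (X n)) \<longlonglongrightarrow> T l"
  using continuous_on_tendsto_compose[OF continuous_T[of UNIV]] by auto

text \<open>Mixed moments are recorded so that multiplying by \<open>z\<close> or by its conjugate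
  only raises an exponent, as the induction in \<open>calculus_moments\<close> requires.\<close>

definition distribution :: "'a \<Rightarrow> complex measure" where
  "distribution x = (SOME \<mu>. finite_measure \<mu> \<and> sets \<mu> = sets circle_borel \<and>
    (\<forall>m n. (\<integral>z. z ^ m * cnj z ^ n \<partial>\<mu>) = cinner ((T ^^ m) x) ((T ^^ n) x)))"

lemma finite_measure_distribution: "finite_measure (distribution x)"
  and sets_distribution: "sets (distribution x) = sets circle_borel"
  and integral_distribution: "(\<integral>z. z ^ m * cnj z ^ n \<partial>distribution x) = cinner ((T ^^ m) x) ((T ^^ n) x)"
  using someI_ex[OF herglotz[of x]] unfolding distribution_def[symmetric] by blast+

lemma space_distribution: "space (distribution x) = sphere 0 1"
  using sets_eq_imp_space_eq[OF sets_distribution] by simp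

lemma measurable_distribution: "borel_measurable (distribution x) = borel_measurable circle_borel"
  by (rule measurable_cong_sets[OF sets_distribution refl])

text \<open>
  \<open>calculus f A B\<close> says that \<open>A = f(T)\<close> with adjoint \<open>B\<close>. Carrying the adjoint along makes the
  \<open>L\<^sup>2\<close> isometry available inside the induction.
\<close>

inductive calculus :: "(complex \<Rightarrow> complex) \<Rightarrow> ('a \<Rightarrow> 'a) \<Rightarrow> ('a \<Rightarrow> 'a) \<Rightarrow> bool" where
  one: "calculus (\<lambda>_. 1) (\<lambda>x. x) (\<lambda>x. x)"
| mult: "calculus f A B \<Longrightarrow> calculus (\<lambda>z. z * f z) (\<lambda>x. T (A x)) (\<lambda>x. Ti (B x))"
| mult_cnj: "calculus f A B \<Longrightarrow> calculus (\<lambda>z. cnj z * f z) (\<lambda>x. Ti (A x)) (\<lambda>x. T (B x))"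
| add: "calculus f A B \<Longrightarrow> calculus g C D \<Longrightarrow>
    calculus (\<lambda>z. f z + g z) (\<lambda>x. A x + C x) (\<lambda>x. B x + D x)"
| scale: "calculus f A B \<Longrightarrow> calculus (\<lambda>z. c * f z) (\<lambda>x. c *\<^sub>C A x) (\<lambda>x. cnj c *\<^sub>C B x)"
| lim: "(\<And>n::nat. calculus (F n) (A n) (B n)) \<Longrightarrow>
    (\<And>n z. norm z = 1 \<Longrightarrow> norm (F n z) \<le> K) \<Longrightarrow> (\<And>z. norm z = 1 \<Longrightarrow> (\<lambda>n. F n z) \<longlonglongrightarrow> f z) \<Longrightarrow>
    (\<And>x. (\<lambda>n. A n x) \<longlonglongrightarrow> A' x) \<Longrightarrow> (\<And>x. (\<lambda>n. B n x) \<longlonglongrightarrow> B' x) \<Longrightarrow> calculus f A' B'"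

text \<open>The rules are symmetric in an operator and its adjoint, so every fact about the first
  operator also holds for the second.\<close>

lemma calculus_cnj: "calculus f A B \<Longrightarrow> calculus (\<lambda>z. cnj (f z)) B A"
proof (induction rule: calculus.induct)
  case (lim F A B K f A' B')
  show ?case
    by (rule calculus.lim[OF lim.IH, where K = K]) (use lim.hyps in \<open>auto simp: lim_cnj\<close>)
next
  case (scale f A B c)
  then show ?case
    using calculus.scale[of "\<lambda>z. cnj (f z)" B A "cnj c"] by simp
qed (simp_all add: calculus.intros)

lemma calculus_linear:
  assumes "calculus f A B"
  shows "A (x + y) = A x + A y" "A (c *\<^sub>C x) = c *\<^sub>C A x" "A (T x) = T (A x)"
proof -
  have "(\<forall>x y. A (x + y) = A x + A y) \<and> (\<forall>c x. A (c *\<^sub>C x) = c *\<^sub>C A x) \<and> (\<forall>x. A (T x) = T (A x))"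
    using assms
  proof (induction rule: calculus.induct)
    case (mult_cnj f A B)
    then show ?case
      by (simp add: Ti_add Ti_sc)
  next
    case (lim F A B K f A' B')
    have "A' (x + y) = A' x + A' y" for x y
    proof (rule LIMSEQ_unique[OF lim.hyps(4)])
      show "(\<lambda>n. A n (x + y)) \<longlonglongrightarrow> A' x + A' y"
        using tendsto_add[OF lim.hyps(4) lim.hyps(4), of x y] lim.IH by simp
    qed
    moreover have "A' (c *\<^sub>C x) = c *\<^sub>C A' x" for c x
    proof (rule LIMSEQ_unique[OF lim.hyps(4)])
      show "(\<lambda>n. A n (c *\<^sub>C x)) \<longlonglongrightarrow> c *\<^sub>C A' x"
        using tendsto_sc_right[OF lim.hyps(4), of c x] lim.IH by simp
    qed
    moreover have "A' (T x) = T (A' x)" for x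
    proof (rule LIMSEQ_unique[OF lim.hyps(4)])
      show "(\<lambda>n. A n (T x)) \<longlonglongrightarrow> T (A' x)"
        using tendsto_T[OF lim.hyps(4), of x] lim.IH by simp
    qed
    ultimately show ?case
      by blast
  qed (simp_all add: T_add T_sc scale_right_distrib mult.commute)
  then show "A (x + y) = A x + A y" "A (c *\<^sub>C x) = c *\<^sub>C A x" "A (T x) = T (A x)"
    by simp_all
qed

lemma calculus_measurable:
  assumes "calculus f A B"
  shows "f \<in> borel_measurable circle_borel" "\<exists>K. \<forall>z. norm z = 1 \<longrightarrow> norm (f z) \<le> K"
proof -
  have [measurable]: "(\<lambda>z. z) \<in> borel_measurable circle_borel" "cnj \<in> borel_measurable circle_borel"
    by (auto intro!: measurable_circle_borel borel_measurable_continuous_onI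
        linear_continuous_on[OF bounded_linear_cnj])
  have "f \<in> borel_measurable circle_borel \<and> (\<exists>K. \<forall>z. norm z = 1 \<longrightarrow> norm (f z) \<le> K)"
    using assms
  proof (induction rule: calculus.induct)
    case one
    then show ?case
      by auto
  next
    case (mult f A B)
    then show ?case
      by (auto simp: norm_mult)
  next
    case (mult_cnj f A B)
    then show ?case
      by (auto simp: norm_mult)
  next
    case (add f A B g C D)
    then obtain K L where "\<forall>z. norm z = 1 \<longrightarrow> norm (f z) \<le> K" "\<forall>z. norm z = 1 \<longrightarrow> norm (g z) \<le> L"
      by blast
    then have "\<forall>z. norm z = 1 \<longrightarrow> norm (f z + g z) \<le> K + L"
      using norm_triangle_mono by blast
    then show ?case
      using add.IH by auto
  next
    case (scale f A B c)
    then obtain K where "\<forall>z. norm z = 1 \<longrightarrow> norm (f z) \<le> K"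
      by blast
    then have "\<forall>z. norm z = 1 \<longrightarrow> norm (c * f z) \<le> norm c * K"
      by (auto simp: norm_mult mult_left_mono)
    then show ?case
      using scale.IH by auto
  next
    case (lim F A B K f A' B')
    have "f \<in> borel_measurable circle_borel"
      by (rule borel_measurable_LIMSEQ_metric[of F]) (use lim.IH lim.hyps(3) in auto)
    moreover have "norm (f z) \<le> K" if "norm z = 1" for z
      using lim.hyps(2)[OF that] by (intro LIMSEQ_le_const2[OF tendsto_norm[OF lim.hyps(3)[OF that]]]) blast
    ultimately show ?case
      by blast
  qed
  then show "f \<in> borel_measurable circle_borel" "\<exists>K. \<forall>z. norm z = 1 \<longrightarrow> norm (f z) \<le> K"
    by blast+
qed

lemma integrable_distribution:
  fixes f :: "complex \<Rightarrow> 'c::{banach, second_countable_topology}"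
  assumes "f \<in> borel_measurable circle_borel" "\<And>z. norm z = 1 \<Longrightarrow> norm (f z) \<le> K"
  shows "integrable (distribution x) f"
proof -
  interpret finite_measure "distribution x"
    by (rule finite_measure_distribution)
  show ?thesis
    using assms by (intro integrable_const_bound[where B = K]) (auto simp: measurable_distribution space_distribution)
qed

lemma integral_distribution_lim:
  fixes f :: "complex \<Rightarrow> 'c::{banach, second_countable_topology}"
  assumes "\<And>n. F n \<in> borel_measurable circle_borel" "\<And>n z. norm z = 1 \<Longrightarrow> norm (F n z) \<le> K"
    and lim: "\<And>z. norm z = 1 \<Longrightarrow> (\<lambda>n. F n z) \<longlonglongrightarrow> f z"
  shows "(\<lambda>n. \<integral>z. F n z \<partial>distribution x) \<longlonglongrightarrow> (\<integral>z. f z \<partial>distribution x)"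
proof -
  have "f \<in> borel_measurable circle_borel"
    by (rule borel_measurable_LIMSEQ_metric[of F]) (use assms in auto)
  then show ?thesis
    using assms integrable_distribution[of "\<lambda>_. K" "norm K" x]
    by (intro integral_dominated_convergence[where w = "\<lambda>_. K"])
      (auto simp: measurable_distribution space_distribution)
qed

lemma calculus_adjoint:
  assumes "calculus f A B"
  shows "cinner (A x) y = cinner x (B y)"
proof -
  have "\<forall>x y. cinner (A x) y = cinner x (B y)"
    using assms
  proof (induction rule: calculus.induct)
    case (mult f A B)
    have "B (Ti y) = Ti (B y)" for y
      using calculus_linear(3)[OF calculus_cnj[OF mult.hyps], of "Ti y"] by (metis Ti_T T_Ti)
    then show ?case
      using mult.IH by (simp add: cinner_T_Ti)
  next
    case (mult_cnj f A B)
    have "B (T y) = T (B y)" for y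
      by (rule calculus_linear(3)[OF calculus_cnj[OF mult_cnj.hyps]])
    moreover have "cinner (Ti u) v = cinner u (T v)" for u v
      by (metis T_Ti ip_T)
    ultimately show ?case
      using mult_cnj.IH by simp
  next
    case (lim F A B K f A' B')
    have "cinner (A' x) y = cinner x (B' y)" for x y
    proof (rule LIMSEQ_unique)
      show "(\<lambda>n. cinner (A n x) y) \<longlonglongrightarrow> cinner (A' x) y"
        by (intro tendsto_ip lim.hyps(4) tendsto_const)
      show "(\<lambda>n. cinner (A n x) y) \<longlonglongrightarrow> cinner x (B' y)"
        unfolding lim.IH[rule_format] by (intro tendsto_ip lim.hyps(5) tendsto_const)
    qed
    then show ?case
      by blast
  qed (simp_all add: ip_add_left ip_add_right ip_sc_left ip_sc_right)
  then show ?thesis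
    by blast
qed

text \<open>Strengthened by the powers \<open>m\<close> and \<open>n\<close> so that the induction
  closes: a factor \<open>T\<close> raises \<open>m\<close>, and a factor \<open>Ti\<close> raises
  \<open>n\<close> after both sides are moved by \<open>T\<close>.\<close>

lemma calculus_moments:
  assumes "calculus f A B"
  shows "cinner ((T ^^ m) (A x)) ((T ^^ n) x) = (\<integral>z. f z * (z ^ m * cnj z ^ n) \<partial>distribution x)"
proof -
  have [measurable]: "(\<lambda>z. z) \<in> borel_measurable circle_borel" "cnj \<in> borel_measurable circle_borel"
    by (auto intro!: measurable_circle_borel borel_measurable_continuous_onI
        linear_continuous_on[OF bounded_linear_cnj])
  have meas: "(\<lambda>z. f z * (z ^ m * cnj z ^ n)) \<in> borel_measurable circle_borel"
    if [measurable]: "f \<in> borel_measurable circle_borel" for f m n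
    by measurable
  have int: "integrable (distribution x) (\<lambda>z. f z * (z ^ m * cnj z ^ n))"
    if calc: "calculus f A B" for f A B m n
  proof -
    obtain K where "\<And>z. norm z = 1 \<Longrightarrow> norm (f z) \<le> K"
      using calculus_measurable(2)[OF calc] by blast
    then show ?thesis
      using meas[OF calculus_measurable(1)[OF calc]]
      by (intro integrable_distribution[where K = K]) (auto simp: norm_mult norm_power)
  qed
  have "\<forall>m n. cinner ((T ^^ m) (A x)) ((T ^^ n) x) = (\<integral>z. f z * (z ^ m * cnj z ^ n) \<partial>distribution x)"
    using assms
  proof (induction rule: calculus.induct)
    case one
    then show ?case
      by (simp add: integral_distribution)
  next
    case (mult f A B)
    have "cinner ((T ^^ m) (T (A x))) ((T ^^ n) x) = (\<integral>z. f z * (z ^ Suc m * cnj z ^ n) \<partial>distribution x)" for m n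
      using mult.IH[rule_format, of "Suc m" n] by (simp add: funpow_swap1)
    then show ?case
      by (simp add: mult_ac)
  next
    case (mult_cnj f A B)
    have "cinner ((T ^^ m) (Ti (A x))) ((T ^^ n) x) = (\<integral>z. f z * (z ^ m * cnj z ^ Suc n) \<partial>distribution x)" for m n
    proof -
      have "cinner ((T ^^ m) (Ti (A x))) ((T ^^ n) x) = cinner (T ((T ^^ m) (Ti (A x)))) (T ((T ^^ n) x))"
        by simp
      also have "T ((T ^^ m) (Ti (A x))) = (T ^^ m) (A x)"
        by (simp add: funpow_swap1)
      finally show ?thesis
        using mult_cnj.IH[rule_format, of m "Suc n"] by simp
    qed
    then show ?case
      by (simp add: mult_ac)
  next
    case (add f A B g C D)
    then show ?case
      using int[OF add.hyps(1)] int[OF add.hyps(2)]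
      by (simp add: distrib_right pow_add ip_add_left)
  next
    case (scale f A B c)
    then show ?case
      by (simp add: pow_sc ip_sc_left mult.assoc)
  next
    case (lim F A B K f A' B')
    have "cinner ((T ^^ m) (A' x)) ((T ^^ n) x) = (\<integral>z. f z * (z ^ m * cnj z ^ n) \<partial>distribution x)" for m n
    proof (rule LIMSEQ_unique)
      show "(\<lambda>k. cinner ((T ^^ m) (A k x)) ((T ^^ n) x)) \<longlonglongrightarrow> cinner ((T ^^ m) (A' x)) ((T ^^ n) x)"
        using continuous_on_tendsto_compose[OF continuous_pow[of UNIV] lim.hyps(4)]
        by (intro tendsto_ip tendsto_const) auto
      show "(\<lambda>k. cinner ((T ^^ m) (A k x)) ((T ^^ n) x)) \<longlonglongrightarrow> (\<integral>z. f z * (z ^ m * cnj z ^ n) \<partial>distribution x)"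
        unfolding lim.IH[rule_format]
      proof (rule integral_distribution_lim[where K = K])
        show "(\<lambda>z. F k z * (z ^ m * cnj z ^ n)) \<in> borel_measurable circle_borel" for k
          using calculus_measurable(1)[OF lim.hyps(1)] meas by blast
      qed (use lim.hyps in \<open>auto simp: norm_mult norm_power intro!: tendsto_intros\<close>)
    qed
    then show ?case
      by blast
  qed
  then show ?thesis
    by blast
qed

lemma calculus_integral:
  assumes "calculus f A B"
  shows "cinner (A x) x = (\<integral>z. f z \<partial>distribution x)"
  using calculus_moments[OF assms, of 0 x 0] by simp

lemma calculus_mult:
  assumes "calculus f A B" and g: "calculus g C D"
  shows "calculus (\<lambda>z. f z * g z) (\<lambda>x. A (C x)) (\<lambda>x. B (D x))"
  using assms(1)
proof (induction rule: calculus.induct)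
  case one
  then show ?case
    using g by simp
next
  case (mult f A B)
  then show ?case
    using calculus.mult by (fastforce simp: mult.assoc)
next
  case (mult_cnj f A B)
  then show ?case
    using calculus.mult_cnj by (fastforce simp: mult.assoc)
next
  case (add f A B h A' B')
  then show ?case
    using calculus.add by (fastforce simp: distrib_right)
next
  case (scale f A B c)
  then show ?case
    using calculus.scale by (fastforce simp: mult.assoc)
next
  case (lim F A B K f A' B')
  obtain L where L: "\<And>z. norm z = 1 \<Longrightarrow> norm (g z) \<le> L"
    using calculus_measurable(2)[OF g] by blast
  show ?case
  proof (rule calculus.lim[OF lim.IH])
    show "norm (F n z * g z) \<le> norm K * L" if "norm z = 1" for n z
    proof -
      have "norm (F n z) \<le> norm K"
        using lim.hyps(2)[OF that, of n] by simp
      then show ?thesis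
        using L[OF that] by (simp add: norm_mult mult_mono)
    qed
    show "(\<lambda>n. F n z * g z) \<longlonglongrightarrow> f z * g z" if "norm z = 1" for z
      using lim.hyps(3)[OF that] by (intro tendsto_intros)
  qed (rule lim.hyps)+
qed

text \<open>The square of the norm is the quadratic form of the adjoint composed with the operator,
  which belongs to the function \<open>cnj (f z) * f z\<close>. All uniqueness and convergence
  statements of the calculus rest on this isometry.\<close>

lemma calculus_norm:
  assumes "calculus f A B"
  shows "(norm (A x))\<^sup>2 = (\<integral>z. (norm (f z))\<^sup>2 \<partial>distribution x)"
proof -
  have "complex_of_real ((norm (A x))\<^sup>2) = cinner (B (A x)) x"
    unfolding cinner_self[symmetric] using calculus_adjoint[OF calculus_cnj[OF assms]] by simp
  also have "\<dots> = (\<integral>z. cnj (f z) * f z \<partial>distribution x)"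
    by (rule calculus_integral[OF calculus_mult[OF calculus_cnj[OF assms] assms]])
  also have "\<dots> = (\<integral>z. complex_of_real ((norm (f z))\<^sup>2) \<partial>distribution x)"
    unfolding complex_norm_square by (simp only: mult.commute)
  also have "\<dots> = complex_of_real (\<integral>z. (norm (f z))\<^sup>2 \<partial>distribution x)"
    by (rule integral_complex_of_real)
  finally show ?thesis
    by (simp only: of_real_eq_iff)
qed

lemma calculus_diff:
  assumes "calculus f A B" "calculus g C D"
  shows "calculus (\<lambda>z. f z - g z) (\<lambda>x. A x - C x) (\<lambda>x. B x - D x)"
  using calculus.add[OF assms(1) calculus.scale[OF assms(2), of "-1"]] by simp

lemma calculus_unique:
  assumes "calculus f A B" "calculus g C D" "\<And>z. norm z = 1 \<Longrightarrow> f z = g z"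
  shows "A = C"
proof
  fix x
  have "(\<integral>z. (norm (f z - g z))\<^sup>2 \<partial>distribution x) = (\<integral>z. 0 \<partial>distribution x)"
    using assms(3) by (intro Bochner_Integration.integral_cong) (auto simp: space_distribution)
  then have "(norm (A x - C x))\<^sup>2 = 0"
    unfolding calculus_norm[OF calculus_diff[OF assms(1,2)]] by simp
  then show "A x = C x"
    by simp
qed

lemma calculus_L2_tendsto_zero:
  assumes meas: "\<And>n::nat. F n \<in> borel_measurable circle_borel"
    and bound: "\<And>n z. norm z = 1 \<Longrightarrow> norm (F n z) \<le> K"
    and lim: "\<And>z. norm z = 1 \<Longrightarrow> (\<lambda>n. F n z) \<longlonglongrightarrow> (f z :: complex)"
  shows "(\<lambda>n. \<integral>z. (norm (F n z - f z))\<^sup>2 \<partial>distribution x) \<longlonglongrightarrow> 0"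
proof -
  have [measurable]: "f \<in> borel_measurable circle_borel"
    by (rule borel_measurable_LIMSEQ_metric[OF meas]) (use lim in auto)
  note meas [measurable]
  have f_bound: "norm (f z) \<le> K" if "norm z = 1" for z
    using bound[OF that] by (intro LIMSEQ_le_const2[OF tendsto_norm[OF lim[OF that]]]) blast
  have "(\<lambda>n. \<integral>z. (norm (F n z - f z))\<^sup>2 \<partial>distribution x) \<longlonglongrightarrow> (\<integral>z. 0 \<partial>distribution x)"
  proof (rule integral_distribution_lim[where K = "(2 * K)\<^sup>2"])
    show "norm ((norm (F n z - f z))\<^sup>2) \<le> (2 * K)\<^sup>2" if "norm z = 1" for n z
    proof -
      have "norm (F n z - f z) \<le> 2 * K"
        using norm_triangle_ineq4[of "F n z" "f z"] bound[OF that, of n] f_bound[OF that] by linarith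
      then have "(norm (F n z - f z))\<^sup>2 \<le> (2 * K)\<^sup>2"
        by (intro power_mono) auto
      then show ?thesis
        by simp
    qed
    show "(\<lambda>n. (norm (F n z - f z))\<^sup>2) \<longlonglongrightarrow> 0" if "norm z = 1" for z
      using tendsto_power[OF tendsto_norm[OF tendsto_diff[OF lim[OF that] tendsto_const[of "f z"]]], of 2] by simp
  qed measurable
  then show ?thesis
    by simp
qed

lemma calculus_tendsto:
  assumes calc: "\<And>n. calculus (F n) (A n) (B n)" "calculus f A' B'"
    and bound: "\<And>n z. norm z = 1 \<Longrightarrow> norm (F n z) \<le> K"
    and lim: "\<And>z. norm z = 1 \<Longrightarrow> (\<lambda>n. F n z) \<longlonglongrightarrow> f z"
  shows "(\<lambda>n. A n x) \<longlonglongrightarrow> A' x"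
proof -
  have "(\<lambda>n. (norm (A n x - A' x))\<^sup>2) \<longlonglongrightarrow> 0"
    unfolding calculus_norm[OF calculus_diff[OF calc]]
    using calculus_L2_tendsto_zero[OF calculus_measurable(1)[OF calc(1)] bound lim] .
  then have "(\<lambda>n. sqrt ((norm (A n x - A' x))\<^sup>2)) \<longlonglongrightarrow> sqrt 0"
    by (rule tendsto_real_sqrt)
  then show ?thesis
    by (simp add: tendsto_norm_zero_iff LIM_zero_iff)
qed

text \<open>No operator for \<open>f\<close> is available yet: comparing \<open>F m\<close> and
  \<open>F n\<close> through \<open>f\<close> in square mean makes the vectors Cauchy, which
  supplies the operator limits demanded by the rule \<open>calculus.lim\<close>.\<close>

lemma calculus_Cauchy:
  assumes calc: "\<And>n. calculus (F n) (A n) (B n)"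
    and bound: "\<And>n z. norm z = 1 \<Longrightarrow> norm (F n z) \<le> K"
    and lim: "\<And>z. norm z = 1 \<Longrightarrow> (\<lambda>n. F n z) \<longlonglongrightarrow> f z"
  shows "convergent (\<lambda>n. A n x)"
proof -
  define I where "I n = (\<integral>z. (norm (F n z - f z))\<^sup>2 \<partial>distribution x)" for n
  have I: "I \<longlonglongrightarrow> 0"
    unfolding I_def by (rule calculus_L2_tendsto_zero[OF calculus_measurable(1)[OF calc] bound lim])
  have meas [measurable]: "F n \<in> borel_measurable circle_borel" for n
    by (rule calculus_measurable(1)[OF calc])
  have [measurable]: "f \<in> borel_measurable circle_borel"
    by (rule borel_measurable_LIMSEQ_metric[OF meas]) (use lim in auto)
  have f_bound: "norm (f z) \<le> K" if "norm z = 1" for z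
    using bound[OF that] by (intro LIMSEQ_le_const2[OF tendsto_norm[OF lim[OF that]]]) blast
  have int: "integrable (distribution x) (\<lambda>z. (norm (F n z - f z))\<^sup>2)" for n
  proof (rule integrable_distribution[where K = "(2 * K)\<^sup>2"])
    show "norm ((norm (F n z - f z))\<^sup>2) \<le> (2 * K)\<^sup>2" if "norm z = 1" for z
    proof -
      have "norm (F n z - f z) \<le> 2 * K"
        using norm_triangle_ineq4[of "F n z" "f z"] bound[OF that, of n] f_bound[OF that] by linarith
      then have "(norm (F n z - f z))\<^sup>2 \<le> (2 * K)\<^sup>2"
        by (intro power_mono) auto
      then show ?thesis
        by simp
    qed
  qed measurable
  have le: "(norm (A m x - A n x))\<^sup>2 \<le> 2 * I m + 2 * I n" for m n
  proof -
    have "(norm (A m x - A n x))\<^sup>2 = (\<integral>z. (norm (F m z - F n z))\<^sup>2 \<partial>distribution x)"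
      by (rule calculus_norm[OF calculus_diff[OF calc calc]])
    also have "\<dots> \<le> (\<integral>z. 2 * (norm (F m z - f z))\<^sup>2 + 2 * (norm (F n z - f z))\<^sup>2 \<partial>distribution x)"
    proof (rule integral_mono')
      show "(norm (F m z - F n z))\<^sup>2 \<le> 2 * (norm (F m z - f z))\<^sup>2 + 2 * (norm (F n z - f z))\<^sup>2" for z
      proof -
        have "norm (F m z - F n z) \<le> norm (F m z - f z) + norm (F n z - f z)"
          using norm_triangle_ineq4[of "F m z - f z" "F n z - f z"] by simp
        then have "(norm (F m z - F n z))\<^sup>2 \<le> (norm (F m z - f z) + norm (F n z - f z))\<^sup>2"
          by (intro power_mono) auto
        then show ?thesis
          using sum_squares_bound[of "norm (F m z - f z)" "norm (F n z - f z)"] by (simp add: power2_sum)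
      qed
    qed (use int in auto)
    also have "\<dots> = 2 * I m + 2 * I n"
      unfolding I_def using int by simp
    finally show ?thesis .
  qed
  have "Cauchy (\<lambda>n. A n x)"
  proof (rule metric_CauchyI)
    fix e :: real
    assume "0 < e"
    then have "eventually (\<lambda>n. I n < e\<^sup>2 / 4) sequentially"
      using I by (intro order_tendstoD(2)) auto
    then obtain N where N: "\<And>n. N \<le> n \<Longrightarrow> I n < e\<^sup>2 / 4"
      unfolding eventually_sequentially by blast
    have "dist (A m x) (A n x) < e" if "N \<le> m" "N \<le> n" for m n
    proof -
      have "(norm (A m x - A n x))\<^sup>2 < e\<^sup>2"
        using le[of m n] N[OF that(1)] N[OF that(2)] by linarith
      then show ?thesis
        using \<open>0 < e\<close> by (simp add: dist_norm power2_less_imp_less)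
    qed
    then show "\<exists>N. \<forall>m\<ge>N. \<forall>n\<ge>N. dist (A m x) (A n x) < e"
      by blast
  qed
  then show ?thesis
    by (rule Cauchy_convergent)
qed

section \<open>From polynomials to indicators of Borel sets\<close>

definition calculable :: "(complex \<Rightarrow> complex) \<Rightarrow> bool" where
  "calculable f \<longleftrightarrow> (\<exists>A B. calculus f A B)"

lemma calculable_add: "calculable f \<Longrightarrow> calculable g \<Longrightarrow> calculable (\<lambda>z. f z + g z)"
  unfolding calculable_def by (elim exE) (rule exI, rule exI, rule calculus.add)

lemma calculable_mult: "calculable f \<Longrightarrow> calculable g \<Longrightarrow> calculable (\<lambda>z. f z * g z)"
  unfolding calculable_def by (elim exE) (rule exI, rule exI, rule calculus_mult)

lemma calculable_scale: "calculable f \<Longrightarrow> calculable (\<lambda>z. c * f z)"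
  unfolding calculable_def by (elim exE) (rule exI, rule exI, rule calculus.scale)

lemma calculable_diff: "calculable f \<Longrightarrow> calculable g \<Longrightarrow> calculable (\<lambda>z. f z - g z)"
  unfolding calculable_def by (elim exE) (rule exI, rule exI, rule calculus_diff)

lemma calculable_const: "calculable (\<lambda>_. c)"
  using calculable_scale[of "\<lambda>_. 1" c] calculus.one unfolding calculable_def by auto

lemma calculable_lim:
  assumes calc: "\<And>n::nat. calculable (F n)"
    and bound: "\<And>n z. norm z = 1 \<Longrightarrow> norm (F n z) \<le> K"
    and lim: "\<And>z. norm z = 1 \<Longrightarrow> (\<lambda>n. F n z) \<longlonglongrightarrow> f z"
  shows "calculable f"
proof -
  obtain A B where AB: "\<And>n. calculus (F n) (A n) (B n)"
    using calc unfolding calculable_def by metis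
  have "convergent (\<lambda>n. A n x)" for x
    using calculus_Cauchy[OF AB bound lim] .
  moreover have "convergent (\<lambda>n. B n x)" for x
    by (rule calculus_Cauchy[OF calculus_cnj[OF AB], where K = K and f = "\<lambda>z. cnj (f z)"])
      (use bound lim in \<open>auto simp: lim_cnj\<close>)
  ultimately have "(\<lambda>n. A n x) \<longlonglongrightarrow> lim (\<lambda>n. A n x)" "(\<lambda>n. B n x) \<longlonglongrightarrow> lim (\<lambda>n. B n x)" for x
    by (simp_all add: convergent_LIMSEQ_iff)
  then have "calculus f (\<lambda>x. lim (\<lambda>n. A n x)) (\<lambda>x. lim (\<lambda>n. B n x))"
    by (intro calculus.lim[OF AB bound lim])
  then show ?thesis
    unfolding calculable_def by blast
qed

lemma calculable_polynomial:
  assumes "real_polynomial_function p"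
  shows "calculable (\<lambda>z. of_real (p z))"
  using assms
proof (induction rule: real_polynomial_function.induct)
  case (linear h)
  interpret bounded_linear h
    by fact
  \<comment> \<open>A real-linear functional on the complex plane is a combination of
    \<open>z\<close> and its conjugate. The factors 1 match the functions that the rules
    \<open>mult\<close> and \<open>mult_cnj\<close> produce from \<open>one\<close>.\<close>
  have "complex_of_real (h z) = (h 1 - \<i> * h \<i>) / 2 * (z * 1) + (h 1 + \<i> * h \<i>) / 2 * (cnj z * 1)" for z
  proof -
    have "z = Re z *\<^sub>R 1 + Im z *\<^sub>R \<i>"
      by (simp add: complex_eq_iff)
    then have "h z = Re z * h 1 + Im z * h \<i>"
      by (metis add scaleR real_scaleR_def)
    then show ?thesis
      by (simp add: complex_eq_iff field_simps)
  qed
  then have eq: "(\<lambda>z. complex_of_real (h z)) =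
      (\<lambda>z. (h 1 - \<i> * h \<i>) / 2 * (z * 1) + (h 1 + \<i> * h \<i>) / 2 * (cnj z * 1))"
    by (rule ext)
  have "calculable (\<lambda>z. z * 1)" "calculable (\<lambda>z. cnj z * 1)"
    unfolding calculable_def using calculus.mult[OF calculus.one] calculus.mult_cnj[OF calculus.one] by blast+
  then show ?case
    unfolding eq by (intro calculable_add calculable_scale)
qed (simp_all add: calculable_const calculable_add calculable_mult)

text \<open>Stone-Weierstrass on the circle gives approximation within \<open>1 / (n + 1)\<close>,
  so \<open>C + 1\<close> bounds all approximants.\<close>

lemma calculable_continuous:
  fixes g :: "complex \<Rightarrow> real"
  assumes g: "continuous_on (sphere 0 1) g"
  shows "calculable (\<lambda>z. of_real (g z))"
proof -
  have "\<forall>n. \<exists>p. real_polynomial_function p \<and> (\<forall>z\<in>sphere 0 1. \<bar>g z - p z\<bar> < inverse (real (Suc n)))"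
    using Stone_Weierstrass_real_polynomial_function[OF compact_sphere g]
    by (metis inverse_positive_iff_positive of_nat_0_less_iff zero_less_Suc)
  then obtain p where p: "\<And>n. real_polynomial_function (p n)"
    and close: "\<And>n z. norm z = 1 \<Longrightarrow> \<bar>g z - p n z\<bar> < inverse (real (Suc n))"
    by (metis (no_types, lifting) dist_0_norm mem_sphere)
  obtain C where "\<forall>x\<in>g ` sphere 0 1. norm x \<le> C"
    using compact_imp_bounded[OF compact_continuous_image[OF g compact_sphere]] unfolding bounded_iff by blast
  then have C: "\<bar>g z\<bar> \<le> C" if "norm z = 1" for z
    using that by auto
  show ?thesis
  proof (rule calculable_lim)
    show "calculable (\<lambda>z. of_real (p n z))" for n
      by (rule calculable_polynomial[OF p])
    show "norm (complex_of_real (p n z)) \<le> C + 1" if "norm z = 1" for n z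
    proof -
      have "inverse (real (Suc n)) \<le> 1"
        by (simp add: inverse_le_1_iff)
      then show ?thesis
        using close[OF that, of n] C[OF that] unfolding norm_of_real by linarith
    qed
    show "(\<lambda>n. complex_of_real (p n z)) \<longlonglongrightarrow> complex_of_real (g z)" if "norm z = 1" for z
    proof -
      have "(\<lambda>n. p n z - g z) \<longlonglongrightarrow> 0"
        using close[OF that] by (intro Lim_null_comparison[OF _ LIMSEQ_inverse_real_of_nat])
          (auto simp: abs_minus_commute intro!: always_eventually less_imp_le)
      then show ?thesis
        using LIM_zero_iff by (intro tendsto_of_real) blast
    qed
  qed
qed

text \<open>Truncated multiples of the distance to the complement increase to the indicator.
  \<open>U = UNIV\<close> is separate because the distance to the empty set is 0 by
  convention.\<close>

lemma calculable_indicator_open: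
  assumes "open U"
  shows "calculable (indicator U)"
proof (cases "U = UNIV")
  case True
  then have "indicator U = (\<lambda>_. 1 :: complex)"
    by auto
  then show ?thesis
    by (simp add: calculable_const)
next
  case False
  define g where "g n z = min 1 (real n * infdist z (- U))" for n :: nat and z :: complex
  show ?thesis
  proof (rule calculable_lim)
    show "calculable (\<lambda>z. of_real (g n z))" for n
      unfolding g_def by (intro calculable_continuous continuous_intros)
    show "norm (complex_of_real (g n z)) \<le> 1" for n z
      unfolding g_def norm_of_real by (simp add: infdist_nonneg)
    show "(\<lambda>n. complex_of_real (g n z)) \<longlonglongrightarrow> indicator U z" for z
    proof (cases "z \<in> U")
      case True
      have pos: "0 < infdist z (- U)"
        using infdist_pos_not_in_closed[of "- U" z] True False assms by auto
      then obtain N where N: "1 \<le> real N * infdist z (- U)"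
        by (metis reals_Archimedean3 less_imp_le)
      have "g n z = 1" if "N \<le> n" for n
      proof -
        have "real N * infdist z (- U) \<le> real n * infdist z (- U)"
          using that pos by (intro mult_right_mono) auto
        then show ?thesis
          using N by (simp add: g_def)
      qed
      then have "eventually (\<lambda>n. complex_of_real (g n z) = 1) sequentially"
        unfolding eventually_sequentially by auto
      then show ?thesis
        using True by (simp add: tendsto_eventually)
    next
      case False
      then show ?thesis
        by (simp add: g_def)
    qed
  qed
qed

text \<open>Open sets form an intersection-stable generator, so closure under complements and
  disjoint countable unions suffices.\<close>

lemma calculable_indicator:
  assumes "A \<in> sets borel"
  shows "calculable (indicator A)"
proof -
  have "Int_stable {S :: complex set. open S}"
    by (auto simp: Int_stable_def)
  moreover have "{S :: complex set. open S} \<subseteq> Pow UNIV"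
    by simp
  moreover have "A \<in> sigma_sets UNIV {S. open S}"
    using assms by (simp add: borel_def)
  ultimately show ?thesis
  proof (induction A rule: sigma_sets_induct_disjoint)
    case (basic A)
    then show ?case
      using calculable_indicator_open by simp
  next
    case empty
    then show ?case
      using calculable_const[of 0] by (simp add: indicator_def)
  next
    case (compl A)
    have "indicator (UNIV - A) = (\<lambda>z. 1 - indicator A z :: complex)"
      by (auto simp: indicator_def)
    then show ?case
      using calculable_diff[OF calculable_const compl.IH] by simp
  next
    case (union A)
    have UN: "calculable (indicator (\<Union>i<n. A i))" for n
    proof (induction n)
      case 0
      then show ?case
        using calculable_const[of 0] by (simp add: indicator_def)
    next
      case (Suc n)
      have "A n \<inter> A i = {}" if "i < n" for i
        using disjoint_family_onD[OF union.hyps(1), of n i] that by simp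
      then have "A n \<inter> (\<Union>i<n. A i) = {}"
        by blast
      then have "indicator (\<Union>i<Suc n. A i) = (\<lambda>z. indicator (A n) z + indicator (\<Union>i<n. A i) z :: complex)"
        by (auto simp: lessThan_Suc indicator_def fun_eq_iff)
      then show ?case
        using calculable_add[OF union.IH Suc] by simp
    qed
    show ?case
    proof (rule calculable_lim[where F = "\<lambda>n. indicator (\<Union>i<n. A i)" and K = 1])
      show "norm (indicator (\<Union>i<n. A i) z :: complex) \<le> 1" for n z
        by (simp add: indicator_def)
    qed (rule UN LIMSEQ_indicator_UN)+
  qed
qed

end

subsection \<open>Singularity and atoms\<close>

text \<open>\<open>Y n\<close> is the part of a Hahn decomposition where \<mu> is at most n times
  \<nu>. If all these sets are \<mu>-null, then outside their union \<mu> is at least n times \<nu>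
  for every n; finiteness of \<mu> makes \<nu> vanish there.\<close>

lemma mutually_singular_or_dominated:
  assumes "finite_measure \<mu>" "finite_measure \<nu>" and sets: "sets \<mu> = sets \<nu>"
  obtains "mutually_singular \<mu> \<nu>"
  | n Y where "Y \<in> sets \<mu>" "emeasure \<mu> Y \<noteq> 0"
      "\<And>B. B \<in> sets \<mu> \<Longrightarrow> B \<subseteq> Y \<Longrightarrow> emeasure \<mu> B \<le> of_nat n * emeasure \<nu> B"
proof -
  interpret \<mu>: finite_measure \<mu> by fact
  interpret \<nu>: finite_measure \<nu> by fact
  have "\<exists>Y\<in>sets \<nu>. (\<forall>X\<in>sets \<nu>. X \<subseteq> Y \<longrightarrow> emeasure \<mu> X \<le> of_nat n * emeasure \<nu> X) \<and>
      (\<forall>X\<in>sets \<nu>. X \<inter> Y = {} \<longrightarrow> of_nat n * emeasure \<nu> X \<le> emeasure \<mu> X)" for n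
  proof -
    have "finite_measure (scale_measure (of_nat n) \<nu>)"
      by (intro finite_measureI) (simp add: space_scale_measure ennreal_mult_eq_top_iff)
    from finite_unsigned_Hahn_decomposition[OF this assms(1)] show ?thesis
      using sets by simp
  qed
  then obtain Y where Y: "\<And>n. Y n \<in> sets \<nu>"
      "\<And>n X. X \<in> sets \<nu> \<Longrightarrow> X \<subseteq> Y n \<Longrightarrow> emeasure \<mu> X \<le> of_nat n * emeasure \<nu> X"
      "\<And>n X. X \<in> sets \<nu> \<Longrightarrow> X \<inter> Y n = {} \<Longrightarrow> of_nat n * emeasure \<nu> X \<le> emeasure \<mu> X"
    by metis
  show thesis
  proof (cases "\<exists>n. emeasure \<mu> (Y n) \<noteq> 0")
    case True
    then show thesis
      using that(2) Y(1,2) sets by metis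
  next
    case False
    define Z where "Z = space \<mu> - (\<Union>n. Y n)"
    have Z: "Z \<in> sets \<mu>"
      unfolding Z_def using Y(1) sets by (intro sets.Diff sets.top sets.countable_UN) auto
    have "space \<mu> - Z = (\<Union>n. Y n)"
      unfolding Z_def using Y(1) sets.sets_into_space sets by blast
    moreover have "emeasure \<mu> (\<Union>n. Y n) = 0"
      using False Y(1) sets by (intro emeasure_UN_eq_0) auto
    moreover have "emeasure \<nu> Z = 0"
    proof -
      have le: "real n * measure \<nu> Z \<le> measure \<mu> Z" for n
      proof -
        have "of_nat n * emeasure \<nu> Z \<le> emeasure \<mu> Z"
          using Z sets by (intro Y(3)) (auto simp: Z_def)
        then show ?thesis
          by (simp add: \<mu>.emeasure_eq_measure \<nu>.emeasure_eq_measure ennreal_of_nat_eq_real_of_nat flip: ennreal_mult)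
      qed
      have "measure \<nu> Z = 0"
      proof (rule ccontr)
        assume "measure \<nu> Z \<noteq> 0"
        then have "0 < measure \<nu> Z"
          by (simp add: zero_less_measure_iff)
        then obtain n where "measure \<mu> Z < real n * measure \<nu> Z"
          using reals_Archimedean3 by blast
        then show False
          using le[of n] by linarith
      qed
      then show ?thesis
        by (simp add: \<nu>.emeasure_eq_measure)
    qed
    ultimately have "mutually_singular \<mu> \<nu>"
      unfolding mutually_singular_def using Z by (intro bexI[of _ Z]) simp_all
    then show thesis
      by (rule that(1))
  qed
qed

lemma sets_circle_lebesgue [simp]: "sets circle_lebesgue = sets circle_borel"
  by (simp add: circle_lebesgue_def)

lemma measurable_cis_restrict:
  "(\<lambda>t. cis (2 * pi * t)) \<in> restrict_space lborel {0..1} \<rightarrow>\<^sub>M circle_borel"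
  using measurable_cis_circle by (intro measurable_restrict_space1) simp

lemma finite_measure_circle_lebesgue: "finite_measure circle_lebesgue"
proof -
  have "finite_measure (restrict_space lborel {0..1 :: real})"
    by (intro finite_measureI) (simp add: space_restrict_space emeasure_restrict_space)
  then show ?thesis
    unfolding circle_lebesgue_def
    by (intro finite_measure.finite_measure_distr measurable_cis_restrict)
qed

lemma parseval_circle:
  fixes c :: "nat \<Rightarrow> complex"
  shows "(\<integral>z. (norm (\<Sum>k<L. c k * z ^ k))\<^sup>2 \<partial>circle_lebesgue) = (\<Sum>k<L. (norm (c k))\<^sup>2)"
proof -
  have meas: "(\<lambda>z. complex_of_real ((norm (\<Sum>k<L. c k * z ^ k))\<^sup>2)) \<in> borel_measurable circle_borel"
    by (intro measurable_circle_borel borel_measurable_continuous_onI continuous_intros)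
  have eq: "complex_of_real ((norm (\<Sum>k<L. c k * cis (2 * pi * t) ^ k))\<^sup>2) =
      (\<Sum>k<L. \<Sum>j<L. c k * cnj (c j) * cis (2 * pi * of_int (int k - int j) * t))" for t
  proof -
    have "cis (2 * pi * t) ^ k * cnj (cis (2 * pi * t) ^ j) = cis (2 * pi * of_int (int k - int j) * t)" for k j
      unfolding Complex.DeMoivre by (simp add: cis_cnj cis_mult algebra_simps)
    moreover have "a * u * cnj (b * v) = a * cnj b * (u * cnj v)" for a b u v
      by simp
    ultimately have "c k * cis (2 * pi * t) ^ k * cnj (c j * cis (2 * pi * t) ^ j) =
        c k * cnj (c j) * cis (2 * pi * of_int (int k - int j) * t)" for k j
      by (simp only:)
    then show ?thesis
      unfolding complex_norm_square cnj_sum sum_product by (simp only:)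
  qed
  have "complex_of_real (\<integral>z. (norm (\<Sum>k<L. c k * z ^ k))\<^sup>2 \<partial>circle_lebesgue) =
      (\<integral>z. complex_of_real ((norm (\<Sum>k<L. c k * z ^ k))\<^sup>2) \<partial>circle_lebesgue)"
    by (rule integral_complex_of_real[symmetric])
  also have "\<dots> = (\<integral>t. complex_of_real ((norm (\<Sum>k<L. c k * cis (2 * pi * t) ^ k))\<^sup>2) \<partial>restrict_space lborel {0..1})"
    unfolding circle_lebesgue_def by (rule integral_distr[OF measurable_cis_restrict meas])
  also have "\<dots> = (\<integral>t. indicator {0..1} t *\<^sub>R complex_of_real ((norm (\<Sum>k<L. c k * cis (2 * pi * t) ^ k))\<^sup>2) \<partial>lborel)"
    by (rule integral_restrict_space) simp
  also have "\<dots> = (\<integral>t. (\<Sum>k<L. \<Sum>j<L. c k * cnj (c j) *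
      (indicator {0..1} t *\<^sub>R cis (2 * pi * of_int (int k - int j) * t))) \<partial>lborel)"
    unfolding eq scaleR_sum_right mult_scaleR_right ..
  also have "\<dots> = (\<Sum>k<L. \<Sum>j<L. c k * cnj (c j) * (if int k - int j = 0 then 1 else 0))"
    by (simp only: Bochner_Integration.integral_sum Bochner_Integration.integrable_sum
        integrable_mult_right integrable_cis integral_mult_right_zero integral_cis)
  also have "\<dots> = (\<Sum>k<L. \<Sum>j<L. if j = k then c k * cnj (c j) else 0)"
    by (intro sum.cong refl) auto
  also have "\<dots> = complex_of_real (\<Sum>k<L. (norm (c k))\<^sup>2)"
    by (simp add: complex_norm_square flip: of_real_power)
  finally show ?thesis
    by (simp only: of_real_eq_iff)
qed

text \<open>Off the diagonal the geometric sums stay bounded by 2 divided by the norm of 1 -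
  \<zeta>, so their means vanish in the limit; on the diagonal every summand is 1.\<close>

lemma cesaro_geometric_tendsto:
  fixes z w :: complex
  assumes "norm z = 1" "norm w = 1"
  shows "(\<lambda>N. (\<Sum>n<N. (z * cnj w) ^ n) / of_nat N) \<longlonglongrightarrow> indicator {w} z"
proof (cases "z = w")
  case True
  then have "z * cnj w = 1"
    using assms by (simp flip: complex_norm_square)
  then have "(\<Sum>n<N. (z * cnj w) ^ n) / of_nat N = 1" if "1 \<le> N" for N
    using that by simp
  then have "eventually (\<lambda>N. (\<Sum>n<N. (z * cnj w) ^ n) / of_nat N = 1) sequentially"
    unfolding eventually_sequentially by blast
  then show ?thesis
    using True by (simp add: tendsto_eventually)
next
  case False
  define \<zeta> where "\<zeta> = z * cnj w"
  have "\<zeta> \<noteq> 1"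
  proof
    assume "\<zeta> = 1"
    moreover have "cnj w * w = 1"
      using assms(2) by (simp add: mult.commute flip: complex_norm_square)
    ultimately have "z = w"
      unfolding \<zeta>_def by (metis mult.assoc mult.right_neutral mult_1)
    then show False
      using False by simp
  qed
  have nz: "norm \<zeta> = 1"
    unfolding \<zeta>_def using assms by (simp add: norm_mult)
  have bound: "norm ((\<Sum>n<N. \<zeta> ^ n) / of_nat N) \<le> 2 / norm (1 - \<zeta>) * inverse (real N)" for N
  proof -
    have "norm (1 - \<zeta> ^ N) \<le> 2"
      using norm_triangle_ineq4[of 1 "\<zeta> ^ N"] nz by (simp add: norm_power)
    then have "norm (\<Sum>n<N. \<zeta> ^ n) \<le> 2 / norm (1 - \<zeta>)"
      using \<open>\<zeta> \<noteq> 1\<close> by (simp add: sum_gp_strict norm_divide divide_right_mono)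
    then have "norm (\<Sum>n<N. \<zeta> ^ n) * inverse (real N) \<le> 2 / norm (1 - \<zeta>) * inverse (real N)"
      by (rule mult_right_mono) simp
    then show ?thesis
      by (simp only: norm_divide norm_of_nat) (simp only: divide_inverse)
  qed
  have "(\<lambda>N. 2 / norm (1 - \<zeta>) * inverse (real N)) \<longlonglongrightarrow> 0"
    by (intro tendsto_mult_right_zero lim_inverse_n)
  then have "(\<lambda>N. (\<Sum>n<N. \<zeta> ^ n) / of_nat N) \<longlonglongrightarrow> 0"
    by (rule Lim_null_comparison[OF always_eventually[OF allI[OF bound]]])
  then show ?thesis
    using False by (simp add: \<zeta>_def)
qed

section \<open>The spectral measure of a unitary operator\<close>

context complex_unitary
begin

definition E :: "complex set \<Rightarrow> 'a \<Rightarrow> 'a" where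
  "E A = (SOME P. \<exists>B. calculus (indicator A) P B)"

lemma calculus_E:
  assumes "A \<in> sets circle_borel"
  shows "calculus (indicator A) (E A) (E A)"
proof -
  have "\<exists>P B. calculus (indicator A) P B"
    using calculable_indicator assms unfolding calculable_def sets_circle_borel by blast
  then have "\<exists>B. calculus (indicator A) (E A) B"
    unfolding E_def by (rule someI_ex)
  then obtain B where B: "calculus (indicator A) (E A) B" ..
  \<comment> \<open>An indicator is real, so the projection and its adjoint come from the same
    function.\<close>
  have "B = E A"
    by (rule calculus_unique[OF calculus_cnj[OF B] B]) (simp add: indicator_def)
  then show ?thesis
    using B by simp
qed

lemma norm_E:
  assumes "A \<in> sets circle_borel"
  shows "(norm (E A x))\<^sup>2 = measure (distribution x) A"
proof -
  have "A \<subseteq> space (distribution x)"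
    using assms by (simp add: sets_circle_borel space_distribution)
  then have "(\<integral>z. indicator A z \<partial>distribution x) = measure (distribution x) A"
    by (simp add: Int_absorb2)
  moreover have "(norm (indicator A z :: complex))\<^sup>2 = indicator A z" for z
    by (simp add: indicator_def)
  ultimately show ?thesis
    unfolding calculus_norm[OF calculus_E[OF assms]] by simp
qed

lemma E_Int:
  assumes "A \<in> sets circle_borel" "B \<in> sets circle_borel"
  shows "E (A \<inter> B) = E A \<circ> E B"
  unfolding comp_def
  using assms by (intro calculus_unique[OF calculus_E calculus_mult[OF calculus_E calculus_E]])
    (auto simp: indicator_inter_arith)

lemma cinner_E:
  assumes "A \<in> sets circle_borel"
  shows "cinner (E A x) x = of_real (measure (distribution x) A)"
proof -
  have "E A (E A x) = E A x"
    using E_Int[OF assms assms] by (metis Int_absorb comp_apply)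
  then have "cinner (E A x) x = cinner (E A x) (E A x)"
    using calculus_adjoint[OF calculus_E[OF assms], of "E A x" x] by simp
  then show ?thesis
    by (simp only: cinner_self norm_E[OF assms])
qed

lemma E_sums:
  assumes A: "range A \<subseteq> sets circle_borel" and disj: "disjoint_family A"
  shows "(\<lambda>n. E (A n) x) sums E (\<Union>n. A n) x"
proof -
  have fin: "(\<Sum>i<n. E (A i) x) = E (\<Union>i<n. A i) x" for n
  proof (induction n)
    case 0
    have "calculus (indicator {}) (E {}) (E {})"
      by (intro calculus_E) simp
    then have "E {} = (\<lambda>x. 0 *\<^sub>C x)"
      by (rule calculus_unique[OF _ calculus.scale[OF calculus.one]]) simp
    then show ?case
      by simp
  next
    case (Suc n)
    have sets: "A n \<in> sets circle_borel" "(\<Union>i<n. A i) \<in> sets circle_borel" "(\<Union>i<Suc n. A i) \<in> sets circle_borel"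
      using A by auto
    have "A n \<inter> A i = {}" if "i < n" for i
      using disjoint_family_onD[OF disj, of n i] that by simp
    then have "indicator (\<Union>i<Suc n. A i) z = (indicator (A n) z + indicator (\<Union>i<n. A i) z :: complex)" for z
      by (fastforce simp: lessThan_Suc indicator_def)
    then have "E (\<Union>i<Suc n. A i) = (\<lambda>x. E (A n) x + E (\<Union>i<n. A i) x)"
      by (intro calculus_unique[OF calculus_E calculus.add[OF calculus_E calculus_E]] sets)
    then show ?case
      using Suc by (simp add: add.commute)
  qed
  show ?thesis
    unfolding sums_def fin
  proof (rule calculus_tendsto[where A = "\<lambda>n. E (\<Union>i<n. A i)" and A' = "E (\<Union>n. A n)" and x = x and K = 1])
    show "calculus (indicator (\<Union>i<n. A i)) (E (\<Union>i<n. A i)) (E (\<Union>i<n. A i))" for n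
      using A by (intro calculus_E) auto
    show "calculus (indicator (\<Union>n. A n)) (E (\<Union>n. A n)) (E (\<Union>n. A n))"
      using A by (intro calculus_E) auto
    show "norm (indicator (\<Union>i<n. A i) z :: complex) \<le> 1" for n z
      by (simp add: indicator_def)
  qed (rule LIMSEQ_indicator_UN)
qed

lemma spectral_measure_E: "spectral_measure E"
  unfolding spectral_measure_def
proof (intro conjI ballI allI impI)
  show "orthogonal_projection (E A)" if A: "A \<in> sets circle_borel" for A
    unfolding orthogonal_projection_def Vector_Spaces.linear_iff
  proof (intro conjI allI vector_space_axioms)
    show "E A (E A x) = E A x" for x
      using E_Int[OF A A] by (metis Int_absorb comp_apply)
    show "cinner (E A x) y = cinner x (E A y)" for x y
      by (rule calculus_adjoint[OF calculus_E[OF A]])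
  qed (rule calculus_linear[OF calculus_E[OF A]])+
  have "E (sphere 0 1) = (\<lambda>x. x)"
    by (rule calculus_unique[OF calculus_E calculus.one]) (auto simp: sets_circle_borel)
  then show "E (sphere 0 1) = id"
    by (simp add: id_def)
qed (auto intro: E_Int E_sums)

lemma spectral_distribution_E: "spectral_distribution E x = distribution x"
proof -
  interpret finite_measure "distribution x"
    by (rule finite_measure_distribution)
  have "spectral_distribution E x =
      measure_of (space circle_borel) (sets circle_borel) (emeasure (distribution x))"
    unfolding spectral_distribution_def
    by (intro measure_of_eq sets.space_closed)
      (simp add: sets.sigma_sets_eq cinner_E emeasure_eq_measure del: space_circle_borel)
  also have "\<dots> = distribution x"
    using measure_of_of_measure[of "distribution x"] by (simp add: sets_distribution space_distribution)
  finally show ?thesis .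
qed

lemma spectral_measure_of_E: "spectral_measure_of E T"
  unfolding spectral_measure_of_def spectral_distribution_E
  using spectral_measure_E integral_distribution[where m = 1 and n = 0] by simp

text \<open>If \<open>A\<close> is null for the distribution of \<open>y\<close>, then
  \<open>y\<close> lies in the kernel of \<open>E A\<close>, which is a closed subspace invariant
  under \<open>T\<close>; cyclicity makes it the whole space.\<close>

lemma scalar_spectral_measure_distribution:
  assumes cyclic: "\<And>M. \<lbrakk>closed M; subspace M; \<And>x. x \<in> M \<Longrightarrow> T x \<in> M; y \<in> M\<rbrakk> \<Longrightarrow> M = UNIV"
  shows "scalar_spectral_measure E (distribution y)"
  unfolding scalar_spectral_measure_def
proof (intro conjI ballI iffI sets_distribution finite_measure_distribution)
  fix A
  assume A: "A \<in> sets circle_borel"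
  interpret finite_measure "distribution y"
    by (rule finite_measure_distribution)
  note calc = calculus_E[OF A]
  show "emeasure (distribution y) A = 0" if "E A = (\<lambda>x. 0)"
    using norm_E[OF A, of y] that by (simp add: emeasure_eq_measure)
  assume "emeasure (distribution y) A = 0"
  then have "E A y = 0"
    using norm_E[OF A, of y] by (simp add: measure_def)
  have "bounded_linear (E A)"
  proof
    show "E A (r *\<^sub>R x) = r *\<^sub>R E A x" for r x
      using calculus_linear(2)[OF calc, of "of_real r" x] by (simp only: sc_of_real)
    have "(norm (E A x))\<^sup>2 \<le> (norm x)\<^sup>2" for x
    proof -
      interpret finite_measure "distribution x"
        by (rule finite_measure_distribution)
      have "E (sphere 0 1) = id"
        using spectral_measure_E by (simp add: spectral_measure_def)
      then have "measure (distribution x) (space (distribution x)) = (norm x)\<^sup>2"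
        using norm_E[of "sphere 0 1" x] by (simp add: space_distribution sets_circle_borel)
      then show ?thesis
        unfolding norm_E[OF A] using bounded_measure[of A] by simp
    qed
    then have "norm (E A x) \<le> norm x" for x
      by (rule power2_le_imp_le) simp
    then show "\<exists>K. \<forall>x. norm (E A x) \<le> norm x * K"
      by (intro exI[of _ 1]) simp
  qed (rule calculus_linear(1)[OF calc])
  then have "{x. E A x = 0} = UNIV"
  proof (intro cyclic)
    show "closed {x. E A x = 0}" if "bounded_linear (E A)"
      using linear_continuous_on[OF that] by (intro closed_Collect_eq continuous_on_const)
    have "E A 0 = 0"
      using calculus_linear(2)[OF calc, of 0 0] by simp
    then show "subspace {x. E A x = 0}"
      by (simp add: subspace_def calculus_linear[OF calc])
    show "T x \<in> {x. E A x = 0}" if "x \<in> {x. E A x = 0}" for x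
      using that T_sc[of 0 0] by (simp add: calculus_linear(3)[OF calc])
  qed (simp_all add: \<open>E A y = 0\<close>)
  then show "E A = (\<lambda>x. 0)"
    by auto
qed

text \<open>On a singleton the identity function is constant:
  \<open>w * indicator {z} w = z * indicator {z} w\<close>, so the range of \<open>E {z}\<close>
  consists of eigenvectors, and the mass of the atom is the squared norm of
  \<open>E {z} y\<close>.\<close>

lemma atom_imp_eigenvector:
  assumes z: "norm z = 1" and atom: "emeasure (distribution y) {z} \<noteq> 0"
  shows "\<exists>x. x \<noteq> 0 \<and> T x = z *\<^sub>C x"
proof -
  interpret finite_measure "distribution y"
    by (rule finite_measure_distribution)
  have sets: "{z} \<in> sets circle_borel"
    using z by (simp add: sets_circle_borel)
  have "(\<lambda>x. T (E {z} x)) = (\<lambda>x. z *\<^sub>C E {z} x)"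
    by (rule calculus_unique[OF calculus.mult[OF calculus_E] calculus.scale[OF calculus_E]])
      (use sets in \<open>auto simp: indicator_def\<close>)
  then have "T (E {z} y) = z *\<^sub>C E {z} y"
    by (rule fun_cong)
  moreover have "E {z} y \<noteq> 0"
    using norm_E[OF sets, of y] atom by (auto simp: emeasure_eq_measure)
  ultimately show ?thesis
    by blast
qed

text \<open>Wiener's lemma, by integrating the Cesaro means of \<open>(z * cnj w) ^ n\<close> first in \<open>z\<close>, then in \<open>w\<close>.\<close>

lemma wiener_no_atoms:
  assumes atoms: "\<And>z. norm z = 1 \<Longrightarrow> emeasure (distribution y) {z} = 0"
  shows "cesaro_null (\<lambda>n. (norm (cinner ((T ^^ n) y) y))\<^sup>2)"
proof -
  interpret finite_measure "distribution y"
    by (rule finite_measure_distribution)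
  define a where "a n = (\<integral>z. z ^ n \<partial>distribution y)" for n
  have a: "a n = cinner ((T ^^ n) y) y" for n
    using integral_distribution[where m = n and n = 0 and x = y] by (simp add: a_def)
  have int_pow: "integrable (distribution y) (\<lambda>z. z ^ n)" for n
    by (rule integrable_distribution[where K = 1])
      (auto intro!: measurable_circle_borel simp: norm_power)
  \<comment> \<open>\<open>G N w\<close> tends to the mass of the point \<open>w\<close>, which is
    0; integrating it over \<open>w\<close> turns \<open>a n * cnj w ^ n\<close> into |a
    n|^2.\<close>
  define G where "G N w = (\<Sum>n<N. a n * cnj w ^ n) / of_nat N" for N w
  have meas [measurable]: "(\<lambda>z. (\<Sum>n<N. c n * cnj z ^ n) / of_nat N) \<in> borel_measurable circle_borel" for N c
    by (intro measurable_circle_borel borel_measurable_divide borel_measurable_const)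
      (intro borel_measurable_continuous_onI continuous_intros)
  have meas' [measurable]: "(\<lambda>z. (\<Sum>n<N. (z * w) ^ n) / of_nat N) \<in> borel_measurable circle_borel" for N w
    by (intro measurable_circle_borel borel_measurable_divide borel_measurable_const)
      (intro borel_measurable_continuous_onI continuous_intros)
  have bound: "norm ((\<Sum>n<N. (z * cnj w) ^ n) / of_nat N) \<le> 1" if "norm z = 1" "norm w = 1" for z w N
  proof -
    have "norm (\<Sum>n<N. (z * cnj w) ^ n) \<le> (\<Sum>n<N. 1)"
      using that by (intro sum_norm_le) (simp add: norm_power norm_mult)
    then show ?thesis
      by (cases "N = 0") (auto simp: norm_divide)
  qed
  have G_eq: "G N w = (\<integral>z. (\<Sum>n<N. (z * cnj w) ^ n) / of_nat N \<partial>distribution y)" for N w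
    unfolding G_def a_def using int_pow by (simp add: power_mult_distrib)
  have "(\<lambda>N. G N w) \<longlonglongrightarrow> 0" if w: "norm w = 1" for w
  proof -
    have "(\<lambda>N. G N w) \<longlonglongrightarrow> (\<integral>z. indicator {w} z \<partial>distribution y)"
      unfolding G_eq
      by (rule integral_distribution_lim[where K = 1])
        (use w meas' bound cesaro_geometric_tendsto in auto)
    also have "(\<integral>z. indicator {w} z \<partial>distribution y) = (0 :: complex)"
    proof -
      have "(\<integral>z. indicator {w} z \<partial>distribution y) = complex_of_real (\<integral>z. indicator {w} z \<partial>distribution y)"
        unfolding integral_complex_of_real[symmetric] by (simp add: indicator_def of_bool_def if_distrib cong: if_cong)
      moreover have "{w} \<inter> space (distribution y) = {w}"
        using w by (auto simp: space_distribution)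
      ultimately show ?thesis
        using atoms[OF w] by (simp add: measure_def)
    qed
    finally show ?thesis .
  qed
  moreover have "norm (G N w) \<le> measure (distribution y) (space (distribution y))" if w: "norm w = 1" for N w
  proof -
    have "norm (G N w) \<le> (\<integral>z. norm ((\<Sum>n<N. (z * cnj w) ^ n) / of_nat N) \<partial>distribution y)"
      unfolding G_eq by (rule integral_norm_bound)
    also have "\<dots> \<le> (\<integral>z. 1 \<partial>distribution y)"
      by (intro integral_mono integrable_norm integrable_distribution[where K = 1] meas')
        (use bound w in \<open>auto simp: space_distribution\<close>)
    finally show ?thesis
      by simp
  qed
  ultimately have "(\<lambda>N. \<integral>w. G N w \<partial>distribution y) \<longlonglongrightarrow> (\<integral>w. 0 \<partial>distribution y)"
    by (intro integral_distribution_lim) (auto simp: G_def meas)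
  moreover have "(\<integral>w. G N w \<partial>distribution y) = complex_of_real ((\<Sum>n<N. (norm (a n))\<^sup>2) / real N)" for N
  proof -
    have "integrable (distribution y) (\<lambda>w. cnj w ^ n)" for n
      using integrable_cnj[OF int_pow[of n]] by simp
    moreover have "(\<integral>w. cnj w ^ n \<partial>distribution y) = cnj (a n)" for n
      unfolding a_def by (simp flip: Bochner_Integration.integral_cnj)
    ultimately have "(\<integral>w. G N w \<partial>distribution y) = (\<Sum>n<N. a n * cnj (a n)) / of_nat N"
      unfolding G_def by simp
    then show ?thesis
      by (simp flip: complex_norm_square)
  qed
  ultimately have "(\<lambda>N. complex_of_real ((\<Sum>n<N. (norm (a n))\<^sup>2) / real N)) \<longlonglongrightarrow> of_real 0"
    by simp
  then show ?thesis
    unfolding cesaro_null_def a by (simp only: tendsto_of_real_iff)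
qed

text \<open>The left side is the integral over \<open>Y\<close> of |p|^2 for the polynomial
  \<open>p\<close> with coefficients \<open>c\<close>. Domination compares it with \<open>N\<close>
  times the Lebesgue integral of |p|^2, which Parseval evaluates. This is the dual form of Bessel's
  inequality for the orbit of \<open>E Y y\<close>.\<close>

lemma dominated_bessel:
  assumes Y: "Y \<in> sets circle_borel"
    and dom: "\<And>B. B \<in> sets circle_borel \<Longrightarrow> B \<subseteq> Y \<Longrightarrow>
      emeasure (distribution y) B \<le> of_nat N * emeasure circle_lebesgue B"
  shows "(norm (\<Sum>k<L. c k *\<^sub>C (T ^^ k) (E Y y)))\<^sup>2 \<le> real N * (\<Sum>k<L. (norm (c k))\<^sup>2)"
proof -
  interpret \<mu>: finite_measure "distribution y"
    by (rule finite_measure_distribution)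
  interpret m: finite_measure circle_lebesgue
    by (rule finite_measure_circle_lebesgue)
  define p where "p z = (\<Sum>k<L. c k * z ^ k)" for z
  have pow: "\<exists>B. calculus (\<lambda>z. z ^ k) (\<lambda>x. (T ^^ k) x) B" for k
  proof (induction k)
    case 0
    then show ?case
      using calculus.one by auto
  next
    case (Suc k)
    then show ?case
      using calculus.mult by fastforce
  qed
  have "\<exists>B. calculus (\<lambda>z. \<Sum>k<l. c k * z ^ k) (\<lambda>x. \<Sum>k<l. c k *\<^sub>C (T ^^ k) x) B" for l
  proof (induction l)
    case 0
    then show ?case
      using calculus.scale[OF calculus.one, of 0] by auto
  next
    case (Suc l)
    obtain B D where B: "calculus (\<lambda>z. \<Sum>k<l. c k * z ^ k) (\<lambda>x. \<Sum>k<l. c k *\<^sub>C (T ^^ k) x) B"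
      and D: "calculus (\<lambda>z. z ^ l) (\<lambda>x. (T ^^ l) x) D"
      using Suc pow[of l] by blast
    show ?case
      using calculus.add[OF B calculus.scale[OF D, of "c l"]] unfolding sum.lessThan_Suc by blast
  qed
  then obtain B where "calculus p (\<lambda>x. \<Sum>k<L. c k *\<^sub>C (T ^^ k) x) B"
    unfolding p_def by blast
  from calculus_norm[OF calculus_mult[OF this calculus_E[OF Y]], of y]
  have "(norm (\<Sum>k<L. c k *\<^sub>C (T ^^ k) (E Y y)))\<^sup>2 =
      (\<integral>z. (norm (p z * indicator Y z))\<^sup>2 \<partial>distribution y)" .
  also have "\<dots> = (\<integral>z. (norm (p z))\<^sup>2 * indicator Y z \<partial>distribution y)"
    by (intro Bochner_Integration.integral_cong) (auto simp: indicator_def)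
  finally have norm_eq: "(norm (\<Sum>k<L. c k *\<^sub>C (T ^^ k) (E Y y)))\<^sup>2 =
      (\<integral>z. (norm (p z))\<^sup>2 * indicator Y z \<partial>distribution y)" .
  have p_meas [measurable]: "(\<lambda>z. (norm (p z))\<^sup>2) \<in> borel_measurable circle_borel"
    unfolding p_def by (intro measurable_circle_borel borel_measurable_continuous_onI continuous_intros)
  have ind_meas [measurable]: "(\<lambda>z. indicator Y z :: real) \<in> borel_measurable circle_borel"
    "(\<lambda>z. indicator Y z :: ennreal) \<in> borel_measurable circle_borel"
    using Y by simp_all
  have p_bound: "(norm (p z))\<^sup>2 \<le> (\<Sum>k<L. norm (c k))\<^sup>2" if "norm z = 1" for z
  proof -
    have "norm (p z) \<le> (\<Sum>k<L. norm (c k))"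
      unfolding p_def using that by (intro sum_norm_le) (simp add: norm_mult norm_power)
    then show ?thesis
      by (intro power_mono) auto
  qed
  have "ennreal (\<integral>z. (norm (p z))\<^sup>2 * indicator Y z \<partial>distribution y) =
      (\<integral>\<^sup>+z. ennreal ((norm (p z))\<^sup>2 * indicator Y z) \<partial>distribution y)"
  proof (rule nn_integral_eq_integral[symmetric])
    show "integrable (distribution y) (\<lambda>z. (norm (p z))\<^sup>2 * indicator Y z)"
    proof (rule integrable_distribution[where K = "(\<Sum>k<L. norm (c k))\<^sup>2"])
      show "norm ((norm (p z))\<^sup>2 * indicator Y z) \<le> (\<Sum>k<L. norm (c k))\<^sup>2" if "norm z = 1" for z
        using p_bound[OF that] by (auto simp: indicator_def)
    qed measurable
  qed simp
  also have "\<dots> = (\<integral>\<^sup>+z. indicator Y z * ennreal ((norm (p z))\<^sup>2) \<partial>distribution y)"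
    by (intro nn_integral_cong) (simp add: indicator_def)
  also have "\<dots> = (\<integral>\<^sup>+z. ennreal ((norm (p z))\<^sup>2) \<partial>density (distribution y) (indicator Y))"
    by (intro nn_integral_density[symmetric]) (simp_all add: measurable_distribution)
  also have "\<dots> \<le> (\<integral>\<^sup>+z. ennreal ((norm (p z))\<^sup>2) \<partial>scale_measure (of_nat N) circle_lebesgue)"
  proof (rule nn_integral_mono_measure)
    show sets: "sets (density (distribution y) (indicator Y)) = sets (scale_measure (of_nat N) circle_lebesgue)"
      by (simp add: sets_distribution)
    have le: "emeasure (density (distribution y) (indicator Y)) B \<le> of_nat N * emeasure circle_lebesgue B"
      if B: "B \<in> sets circle_borel" for B
    proof -
      have "emeasure (density (distribution y) (indicator Y)) B = (\<integral>\<^sup>+z. indicator Y z * indicator B z \<partial>distribution y)"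
        using B by (intro emeasure_density) (simp_all add: measurable_distribution sets_distribution)
      also have "\<dots> = (\<integral>\<^sup>+z. indicator (B \<inter> Y) z \<partial>distribution y)"
        by (intro nn_integral_cong) (auto simp: indicator_def)
      also have "\<dots> = emeasure (distribution y) (B \<inter> Y)"
        using B Y by (intro nn_integral_indicator) (auto simp: sets_distribution)
      also have "\<dots> \<le> of_nat N * emeasure circle_lebesgue (B \<inter> Y)"
        using B Y by (intro dom) auto
      also have "\<dots> \<le> of_nat N * emeasure circle_lebesgue B"
        using B by (intro mult_left_mono emeasure_mono) auto
      finally show ?thesis .
    qed
    \<comment> \<open>The order on measures compares values on all sets; outside the Borel sets of
      the circle both sides are 0.\<close>
    have "emeasure (density (distribution y) (indicator Y)) B \<le> emeasure (scale_measure (of_nat N) circle_lebesgue) B" for B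
    proof (cases "B \<in> sets circle_borel")
      case False
      then show ?thesis
        by (simp add: emeasure_notin_sets sets_distribution)
    qed (simp add: le)
    then show "density (distribution y) (indicator Y) \<le> scale_measure (of_nat N) circle_lebesgue"
      using sets sets_eq_imp_space_eq[OF sets] by (simp add: le_measure_iff le_fun_def del: emeasure_scale_measure)
  qed
  also have "\<dots> = of_nat N * (\<integral>\<^sup>+z. ennreal ((norm (p z))\<^sup>2) \<partial>circle_lebesgue)"
    by (intro nn_integral_scale_measure) (simp cong: measurable_cong_sets)
  also have "(\<integral>\<^sup>+z. ennreal ((norm (p z))\<^sup>2) \<partial>circle_lebesgue) = ennreal (\<Sum>k<L. (norm (c k))\<^sup>2)"
  proof -
    have "integrable circle_lebesgue (\<lambda>z. (norm (p z))\<^sup>2)"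
      using p_bound sets_eq_imp_space_eq[OF sets_circle_lebesgue]
      by (intro m.integrable_const_bound[where B = "(\<Sum>k<L. norm (c k))\<^sup>2"]) (auto cong: measurable_cong_sets)
    then show ?thesis
      using parseval_circle[of c L] unfolding p_def by (subst nn_integral_eq_integral) auto
  qed
  also have "of_nat N * ennreal (\<Sum>k<L. (norm (c k))\<^sup>2) = ennreal (real N * (\<Sum>k<L. (norm (c k))\<^sup>2))"
    by (simp add: ennreal_mult sum_nonneg ennreal_of_nat_eq_real_of_nat)
  finally show ?thesis
    unfolding norm_eq by (simp add: sum_nonneg)
qed

text \<open>Taking the conjugates of the inner products as coefficients gives
  \<open>S L = cinner V w\<close>; Cauchy-Schwarz and the bound on \<open>V\<close> yield S^2 at
  most N S |w|^2, so the partial sums are bounded and the terms tend to 0.\<close>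

lemma dominated_weakly_null:
  assumes Y: "Y \<in> sets circle_borel"
    and dom: "\<And>B. B \<in> sets circle_borel \<Longrightarrow> B \<subseteq> Y \<Longrightarrow>
      emeasure (distribution y) B \<le> of_nat N * emeasure circle_lebesgue B"
  shows "(\<lambda>k. cinner ((T ^^ k) (E Y y)) w) \<longlonglongrightarrow> 0"
proof -
  define a where "a k = cinner ((T ^^ k) (E Y y)) w" for k
  define S where "S L = (\<Sum>k<L. (norm (a k))\<^sup>2)" for L
  have "S L \<le> real N * (norm w)\<^sup>2" for L
  proof -
    define V where "V = (\<Sum>k<L. cnj (a k) *\<^sub>C (T ^^ k) (E Y y))"
    have "complex_of_real (S L) = cinner V w"
      unfolding S_def V_def bounded_bilinear.sum_left[OF bounded_bilinear_ip] ip_sc_left of_real_sum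
        complex_norm_square a_def by (simp only: mult.commute)
    then have "\<bar>S L\<bar> \<le> norm V * norm w"
      by (metis norm_ip_le norm_of_real)
    then have "(S L)\<^sup>2 \<le> (norm V * norm w)\<^sup>2"
      using abs_le_square_iff[of "S L" "norm V * norm w"] by simp
    also have "\<dots> \<le> (real N * S L) * (norm w)\<^sup>2"
      using dominated_bessel[OF Y dom, where c = "\<lambda>k. cnj (a k)" and L = L]
      unfolding power_mult_distrib V_def S_def by (intro mult_right_mono) auto
    finally have "S L * S L \<le> S L * (real N * (norm w)\<^sup>2)"
      by (simp add: power2_eq_square mult_ac)
    moreover have "0 \<le> S L"
      by (simp add: S_def sum_nonneg)
    ultimately show ?thesis
      by (cases "S L = 0") auto
  qed
  then have "summable (\<lambda>k. (norm (a k))\<^sup>2)"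
    unfolding S_def by (intro summableI_nonneg_bounded) auto
  then have "(\<lambda>k. sqrt ((norm (a k))\<^sup>2)) \<longlonglongrightarrow> sqrt 0"
    by (intro tendsto_real_sqrt summable_LIMSEQ_zero)
  then show ?thesis
    unfolding a_def by (simp add: tendsto_norm_zero_iff)
qed

text \<open>If the distribution of \<open>y\<close> were not singular, a non-null dominated set
  \<open>Y\<close> would make \<open>E Y y\<close> weakly null, hence 0, although its squared norm
  is the mass of \<open>Y\<close>.\<close>

lemma singular_continuousI:
  assumes cyclic: "\<And>M. \<lbrakk>closed M; subspace M; \<And>x. x \<in> M \<Longrightarrow> T x \<in> M; y \<in> M\<rbrakk> \<Longrightarrow> M = UNIV"
    and atoms: "\<And>z. norm z = 1 \<Longrightarrow> emeasure (distribution y) {z} = 0"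
    and null: "\<And>x. (\<And>w. (\<lambda>k. cinner ((T ^^ k) x) w) \<longlonglongrightarrow> 0) \<Longrightarrow> x = 0"
  shows "singular_continuous T"
proof -
  have "mutually_singular (distribution y) circle_lebesgue"
  proof (rule mutually_singular_or_dominated[OF finite_measure_distribution finite_measure_circle_lebesgue])
    show "sets (distribution y) = sets circle_lebesgue"
      by (simp add: sets_distribution)
  next
    fix N Y
    assume Y: "Y \<in> sets (distribution y)" "emeasure (distribution y) Y \<noteq> 0"
      and "\<And>B. B \<in> sets (distribution y) \<Longrightarrow> B \<subseteq> Y \<Longrightarrow>
        emeasure (distribution y) B \<le> of_nat N * emeasure circle_lebesgue B"
    then have "E Y y = 0"
      by (intro null dominated_weakly_null) (simp_all add: sets_distribution)
    then have "measure (distribution y) Y = 0"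
      using norm_E[of Y y] Y(1) by (simp add: sets_distribution)
    then show ?thesis
      using Y(2) finite_measure.emeasure_eq_measure[OF finite_measure_distribution[of y]] by simp
  qed
  then have "singular_continuous_measure (distribution y)"
    using atoms by (simp add: singular_continuous_measure_def)
  then show ?thesis
    unfolding singular_continuous_def
    using spectral_measure_of_E scalar_spectral_measure_distribution[OF cyclic] by blast
qed

end

subsection \<open>The complex and the real case\<close>

lemma (in complex_hilbert_space) weakly_l_sequentially_supercyclic_isometry:
  assumes "dim_gt_one scaleC" "isometry scaleC T" "weakly_l_sequentially_supercyclic scaleC T"
  shows "weakly_quasistable scaleC T" "unitary scaleC T" "singular_continuous T"
proof -
  obtain y where y: "y \<noteq> 0" "weak_limit_set scaleC (projective_orbit scaleC T y) = UNIV"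
    using assms(3) unfolding weakly_l_sequentially_supercyclic_def by blast
  interpret S: supercyclic_isometry scaleC cinner cnj T y
    by unfold_locales (use assms y in auto)
  interpret U: complex_unitary scaleC cinner T
    by unfold_locales (rule S.surj_T)
  have atoms: "emeasure (U.distribution y) {z} = 0" if z: "norm z = 1" for z
  proof (rule ccontr)
    assume "emeasure (U.distribution y) {z} \<noteq> 0"
    then obtain x where x: "x \<noteq> 0" "T x = z *\<^sub>C x"
      using U.atom_imp_eigenvector[OF z] by blast
    \<comment> \<open>The eigenline written as a plane with second vector 0; if it were everything,
      the dimension would be at most 1.\<close>
    have "{a *\<^sub>C x + b *\<^sub>C 0 | a b. True} = UNIV"
    proof (rule S.reducing_plane_eq_UNIV[OF _ refl])
      have "x \<in> {a *\<^sub>C x + b *\<^sub>C 0 | a b. True}"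
        by (auto intro: exI[of _ 1])
      then show "{a *\<^sub>C x + b *\<^sub>C 0 | a b. True} \<noteq> {0}"
        using x(1) by blast
    next
      fix w
      assume "w \<in> {a *\<^sub>C x + b *\<^sub>C 0 | a b. True}"
      then obtain a where w: "w = a *\<^sub>C x"
        by auto
      have "T ((a / z) *\<^sub>C x) = w"
        using z by (auto simp: w S.T_sc x(2))
      then show "\<exists>z'\<in>{a *\<^sub>C x + b *\<^sub>C 0 | a b. True}. T z' = w"
        by (intro bexI[of _ "(a / z) *\<^sub>C x"]) auto
      show "T w \<in> {a *\<^sub>C x + b *\<^sub>C 0 | a b. True}"
        by (auto simp: w S.T_sc x(2) intro: exI[of _ "a * z"])
    qed simp
    then have "\<exists>a. w = a *\<^sub>C x" for w
      by auto
    then show False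
      using not_dim_gt_one_line assms(1) by blast
  qed
  show "weakly_quasistable scaleC T"
    by (intro S.weakly_quasistable_if_cesaro_null U.wiener_no_atoms atoms)
  show "unitary scaleC T"
    by (rule S.unitary_T)
  show "singular_continuous T"
    by (rule U.singular_continuousI[OF S.cyclic atoms])
      (use S.weakly_null_eq_zero in \<open>auto simp: S.weakly_null_def\<close>)
qed

section \<open>Complexification of real spaces\<close>

lemma scalar_hilbert_space_real:
  "scalar_hilbert_space ((*\<^sub>R) :: real \<Rightarrow> 'a::{real_inner,banach} \<Rightarrow> 'a) inner (\<lambda>x. x)"
  by unfold_locales
    (auto simp: algebra_simps inner_commute simp flip: power2_norm_eq_inner power2_eq_square)

lemma complexify_inner_zero:
  "complexify_inner (x, u) (w, 0) = Complex (inner x w) (inner u w)"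
  by (simp add: complexify_inner_def)

lemma map_prod_pow:
  fixes f :: "'a \<Rightarrow> 'a"
  shows "(map_prod f f ^^ n) (x, u) = ((f ^^ n) x, (f ^^ n) u)"
  by (induction n) simp_all

lemma isometry_complexify:
  fixes S :: "'a::{real_inner,banach} \<Rightarrow> 'a"
  assumes "isometry (*\<^sub>R) S"
  shows "isometry complexify_scale (map_prod S S)"
proof -
  interpret complex_hilbert_space complexify_scale "complexify_inner :: 'a \<times> 'a \<Rightarrow> 'a \<times> 'a \<Rightarrow> complex"
    by (rule complex_hilbert_space_complexify)
  have "linear S"
    by (rule linearI) (use assms in \<open>simp_all add: isometry_def Vector_Spaces.linear_iff\<close>)
  then interpret linear S .
  have "norm (S x) = norm x" for x
    using assms by (simp add: isometry_def)
  then show ?thesis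
    unfolding isometry_def Vector_Spaces.linear_iff
    by (auto simp: vector_space_axioms complexify_scale_def add diff scale norm_prod_def)
qed

text \<open>The real vectors in \<open>M\<close> form a closed real subspace invariant under
  \<open>S\<close> that contains \<open>y\<close>, hence all real vectors; adding multiples by the
  imaginary unit fills the complexification.\<close>

lemma complexify_cyclic:
  fixes y :: "'a::{real_inner,banach}"
  assumes cyclic: "\<And>M. \<lbrakk>closed M; module.subspace (*\<^sub>R) M; \<And>x. x \<in> M \<Longrightarrow> S x \<in> M; y \<in> M\<rbrakk> \<Longrightarrow> M = UNIV"
    and M: "closed M" "module.subspace complexify_scale M" "\<And>p. p \<in> M \<Longrightarrow> map_prod S S p \<in> M" "(y, 0) \<in> M"
    and S0: "S 0 = 0"
  shows "M = UNIV"
proof -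
  interpret C: complex_hilbert_space complexify_scale "complexify_inner :: 'a \<times> 'a \<Rightarrow> 'a \<times> 'a \<Rightarrow> complex"
    by (rule complex_hilbert_space_complexify)
  have "{x. (x, 0) \<in> M} = UNIV"
  proof (rule cyclic)
    have "closed ((\<lambda>x. (x, 0)) -` M)"
      using M(1) by (intro closed_vimage continuous_intros)
    then show "closed {x. (x, 0) \<in> M}"
      by (simp add: vimage_def)
    show "module.subspace (*\<^sub>R) {x. (x, 0) \<in> M}"
      unfolding subspace_raw_def[symmetric] subspace_def
    proof (intro conjI ballI allI)
      show "0 \<in> {x. (x, 0) \<in> M}"
        using C.subspace_0[OF M(2)] by (simp add: zero_prod_def)
      show "u + v \<in> {x. (x, 0) \<in> M}" if "u \<in> {x. (x, 0) \<in> M}" "v \<in> {x. (x, 0) \<in> M}" for u v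
        using C.subspace_add[OF M(2), of "(u, 0)" "(v, 0)"] that by simp
      show "r *\<^sub>R u \<in> {x. (x, 0) \<in> M}" if "u \<in> {x. (x, 0) \<in> M}" for r u
        using C.subspace_scale[OF M(2), of "(u, 0)" "of_real r"] that by (simp add: complexify_scale_def)
    qed
    show "S x \<in> {x. (x, 0) \<in> M}" if "x \<in> {x. (x, 0) \<in> M}" for x
      using M(3)[of "(x, 0)"] that by (simp add: S0)
  qed (simp add: M(4))
  then have real: "(x, 0) \<in> M" for x
    by blast
  have "(x, u) \<in> M" for x u
    using C.subspace_add[OF M(2) real[of x] C.subspace_scale[OF M(2) real[of u], of \<i>]]
    by (simp add: complexify_scale_def)
  then show ?thesis
    by auto
qed

lemma real_supercyclic_isometry:
  fixes S :: "'a::{real_inner,banach} \<Rightarrow> 'a"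
  assumes dim: "dim_gt_one ((*\<^sub>R) :: real \<Rightarrow> 'a \<Rightarrow> 'a)" and "isometry (*\<^sub>R) S"
    and "weakly_l_sequentially_supercyclic (*\<^sub>R) S"
  shows "weakly_quasistable (*\<^sub>R) S" "unitary (*\<^sub>R) S"
    and "Real_Vector_Spaces.dim (UNIV :: 'a set) \<noteq> 2 \<longrightarrow> singular_continuous_real S"
proof -
  obtain y where y: "y \<noteq> 0" "weak_limit_set (*\<^sub>R) (projective_orbit (*\<^sub>R) S y) = UNIV"
    using assms(3) unfolding weakly_l_sequentially_supercyclic_def by blast
  interpret R: scalar_hilbert_space "(*\<^sub>R) :: real \<Rightarrow> 'a \<Rightarrow> 'a" inner "\<lambda>x. x"
    by (rule scalar_hilbert_space_real)
  interpret S: supercyclic_isometry "(*\<^sub>R) :: real \<Rightarrow> 'a \<Rightarrow> 'a" inner "\<lambda>x. x" S y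
    by unfold_locales (use assms y in auto)
  interpret C: complex_hilbert_space complexify_scale "complexify_inner :: 'a \<times> 'a \<Rightarrow> 'a \<times> 'a \<Rightarrow> complex"
    by (rule complex_hilbert_space_complexify)
  interpret U: complex_unitary complexify_scale "complexify_inner :: 'a \<times> 'a \<Rightarrow> 'a \<times> 'a \<Rightarrow> complex" "map_prod S S"
    by unfold_locales
      (simp_all add: isometry_complexify[OF assms(2)] S.surj_T map_prod_surj)
  let ?\<mu> = "U.distribution (y, 0)"
  show "unitary (*\<^sub>R) S"
    by (rule S.unitary_T)
  have "weakly_quasistable (*\<^sub>R) S \<and>
      (Real_Vector_Spaces.dim (UNIV :: 'a set) \<noteq> 2 \<longrightarrow> singular_continuous_real S)"
  proof (cases "\<exists>z. norm z = 1 \<and> emeasure ?\<mu> {z} \<noteq> 0")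
    case True
    then obtain z where z: "norm z = 1" "emeasure ?\<mu> {z} \<noteq> 0"
      by blast
    obtain x u where xu: "(x, u) \<noteq> 0" "map_prod S S (x, u) = complexify_scale z (x, u)"
      using U.atom_imp_eigenvector[OF z] by force
    have Sx: "S x = Re z *\<^sub>R x - Im z *\<^sub>R u" and Su: "S u = Re z *\<^sub>R u + Im z *\<^sub>R x"
      using xu(2) by (simp_all add: complexify_scale_def)
    have zz: "(Re z)\<^sup>2 + (Im z)\<^sup>2 = 1"
      using z(1) by (simp add: cmod_def)
    define M where "M = {a *\<^sub>R x + b *\<^sub>R u | a b. True}"
    have MI: "a *\<^sub>R x + b *\<^sub>R u \<in> M" for a b
      unfolding M_def by blast
    have S_lin: "S (a *\<^sub>R x + b *\<^sub>R u) =
        (a * Re z + b * Im z) *\<^sub>R x + (b * Re z - a * Im z) *\<^sub>R u" for a b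
      by (simp add: S.T_add S.T_sc Sx Su algebra_simps)
    \<comment> \<open>The real and imaginary parts of the eigenvector need not be orthogonal, and
      one of them may be 0.\<close>
    obtain v where v: "inner x v = 0" "M = {a *\<^sub>R x + b *\<^sub>R v | a b. True}"
      unfolding M_def by (rule R.orthogonalize_plane)
    have "M = UNIV"
    proof (rule S.reducing_plane_eq_UNIV[OF v])
      have "x \<in> M" "u \<in> M"
        using MI[of 1 0] MI[of 0 1]
        by (simp_all only: scaleR_one scaleR_zero_left add_0_left add_0_right)
      then show "M \<noteq> {0}"
        using xu(1) by (auto simp: zero_prod_def)
    next
      fix w
      assume "w \<in> M"
      then obtain a b where w: "w = a *\<^sub>R x + b *\<^sub>R u"
        unfolding M_def by blast
      show "S w \<in> M"
        unfolding w S_lin by (rule MI)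
      \<comment> \<open>On coordinates, \<open>S\<close> multiplies \<open>a + \<i> * b\<close> by
        \<open>cnj z\<close>; the preimage is therefore found by multiplying with
        \<open>z\<close>.\<close>
      have "S ((a * Re z - b * Im z) *\<^sub>R x + (a * Im z + b * Re z) *\<^sub>R u) =
          (a * ((Re z)\<^sup>2 + (Im z)\<^sup>2)) *\<^sub>R x + (b * ((Re z)\<^sup>2 + (Im z)\<^sup>2)) *\<^sub>R u"
        unfolding S_lin by (simp add: power2_eq_square algebra_simps)
      then have "S ((a * Re z - b * Im z) *\<^sub>R x + (a * Im z + b * Re z) *\<^sub>R u) = w"
        by (simp add: zz w)
      then show "\<exists>z'\<in>M. S z' = w"
        using MI by blast
    qed
    then have plane: "\<exists>a b. w = a *\<^sub>R x + b *\<^sub>R v" for w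
      using v(2) by blast
    \<comment> \<open>A basis with more than one element inside the span of two vectors has exactly
      two, and being finite it is counted correctly by \<open>dim\<close>.\<close>
    have "Real_Vector_Spaces.dim (UNIV :: 'a set) = 2"
    proof -
      obtain B :: "'a set" where B: "independent B" "span B = UNIV" "infinite B \<or> card B > 1"
        using dim unfolding dim_gt_one_def dependent_raw_def[symmetric] span_raw_def[symmetric] by blast
      have "w \<in> span {x, v}" for w
      proof -
        obtain a b where w: "w = a *\<^sub>R x + b *\<^sub>R v"
          using plane by blast
        show ?thesis
          unfolding w by (intro span_add span_scale span_base) simp_all
      qed
      then have "B \<subseteq> span {x, v}"
        by blast
      then have "finite B \<and> card B \<le> card {x, v}"
        by (intro independent_span_bound B(1)) simp_all
      moreover have "card {x, v} \<le> 2"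
        by (simp add: card_insert_if)
      ultimately have "card B = 2"
        using B(3) by linarith
      then show ?thesis
        using dim_eq_card[of B UNIV] B(1,2) by simp
    qed
    then show ?thesis
      using S.weakly_quasistable_plane[OF v(1) plane] by blast
  next
    case False
    then have atoms: "emeasure ?\<mu> {z} = 0" if "norm z = 1" for z
      using that by blast
    \<comment> \<open>Between real vectors the complexified inner product is real, so Wiener's lemma
      upstairs speaks about \<open>S\<close> itself.\<close>
    have "norm (complexify_inner ((map_prod S S ^^ n) (y, 0)) (y, 0)) = norm (inner ((S ^^ n) y) y)" for n
      unfolding map_prod_pow complexify_inner_zero S.pow_zero by (simp add: cmod_def)
    then have "cesaro_null (\<lambda>n. (norm (inner ((S ^^ n) y) y))\<^sup>2)"
      using U.wiener_no_atoms[OF atoms] by (simp only:)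
    then have "weakly_quasistable (*\<^sub>R) S"
      by (rule S.weakly_quasistable_if_cesaro_null)
    moreover have "singular_continuous_real S"
      unfolding singular_continuous_real_def
    proof (rule U.singular_continuousI[OF _ atoms])
      fix M
      assume M: "closed M" "C.subspace M" "\<And>p. p \<in> M \<Longrightarrow> map_prod S S p \<in> M" "(y, 0) \<in> M"
      show "M = UNIV"
      proof (rule complexify_cyclic[where y = y and S = S, OF _ M])
        show "N = UNIV"
          if "closed N" "module.subspace (*\<^sub>R) N" "\<And>x. x \<in> N \<Longrightarrow> S x \<in> N" "y \<in> N" for N
          using that by (rule S.cyclic)
        show "S 0 = 0"
          using S.pow_zero[of 1] by simp
      qed
    next
      fix p
      assume null: "\<And>w. (\<lambda>n. complexify_inner ((map_prod S S ^^ n) p) w) \<longlonglongrightarrow> 0"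
      obtain x u where p: "p = (x, u)"
        by (cases p)
      \<comment> \<open>Testing only against real vectors \<open>(w, 0)\<close> separates the two
        components, so each is weakly null for \<open>S\<close>.\<close>
      have "(\<lambda>n. Complex (inner ((S ^^ n) x) w) (inner ((S ^^ n) u) w)) \<longlonglongrightarrow> 0" for w
        using null[of "(w, 0)"] by (simp add: p map_prod_pow complexify_inner_zero)
      then have "(\<lambda>n. inner ((S ^^ n) x) w) \<longlonglongrightarrow> 0 \<and> (\<lambda>n. inner ((S ^^ n) u) w) \<longlonglongrightarrow> 0" for w
        using tendsto_Re[of _ 0] tendsto_Im[of _ 0] by fastforce
      then have "S.weakly_null x" "S.weakly_null u"
        unfolding S.weakly_null_def by blast+
      then have "x = 0" "u = 0"
        using S.weakly_null_eq_zero by blast+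
      then show "p = 0"
        by (simp add: p zero_prod_def)
    qed
    ultimately show ?thesis
      by blast
  qed
  then show "weakly_quasistable (*\<^sub>R) S"
    and "Real_Vector_Spaces.dim (UNIV :: 'a set) \<noteq> 2 \<longrightarrow> singular_continuous_real S"
    by blast+
qed

theorem corollary5p5:
  fixes S :: "'a::{real_inner,banach} \<Rightarrow> 'a"
    and scaleC :: "complex \<Rightarrow> 'b::banach \<Rightarrow> 'b" and cinner :: "'b \<Rightarrow> 'b \<Rightarrow> complex"
    and T :: "'b \<Rightarrow> 'b"
  shows
   "(separable_space (euclidean :: 'a topology) \<and> dim_gt_one ((*\<^sub>R) :: real \<Rightarrow> 'a \<Rightarrow> 'a) \<and>
     isometry (*\<^sub>R) S \<and> weakly_l_sequentially_supercyclic (*\<^sub>R) S \<longrightarrow>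
       weakly_quasistable (*\<^sub>R) S \<and> unitary (*\<^sub>R) S \<and>
       (dim (UNIV :: 'a set) \<noteq> 2 \<longrightarrow> singular_continuous_real S)) \<and>
    (complex_hilbert_space scaleC cinner \<and>
     separable_space (euclidean :: 'b topology) \<and> dim_gt_one scaleC \<and>
     isometry scaleC T \<and> weakly_l_sequentially_supercyclic scaleC T \<longrightarrow>
       weakly_quasistable scaleC T \<and> unitary scaleC T \<and>
       complex_hilbert_space.singular_continuous scaleC cinner T)"
  using real_supercyclic_isometry[of S]
    complex_hilbert_space.weakly_l_sequentially_supercyclic_isometry[of scaleC cinner T]
  by blast

end
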